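(* Let $\varphi\in\mathcal F$. Then $\varphi$ satisfies Delorme's intertwining conditions, i.e. both (a) for every $N\ge1$ and each $\delta\in\mathcal D^N$ the map $\varphi_\delta$ preserves all closed invariant subspaces of $\pi_\delta$; and (b) for all $N_1,N_2\ge1$, all $\delta_1\in\mathcal D^{N_1}$, $\delta_2\in\mathcal D^{N_2}$, and all closed invariant subspaces $U_j\subset V_j$ for $\pi_{\delta_j}$ $(j=1,2)$, the induced maps $\bar\varphi_{\delta_j}\in\mathrm{End}(V_j/U_j)$ are intertwined by all $G$-intertwining operators $T:V_1/U_1\to V_2/U_2$, that is, $T\circ\bar\varphi_{\delta_1}=\bar\varphi_{\delta_2}\circ T$; if and only if $\varphi$ satisfies condition (a).
   Context: $G$ is a real reductive Lie group in the Harish-Chandra class, $K$ a maximal compact subgroup, $\mathfrak g=\mathfrak k\oplus\mathfrak p$ the associated Cartan decomposition, $\mathfrak a\subset\mathfrak p$ maximal abelian, $A=\exp\mathfrak a$. $\mathcal P(A)$ is the set of parabolic subgroups of $G$ containing $A$; $P=M_PA_PN_P$ is the Langlands decomposition, $\mathfrak a_P=\mathrm{Lie}(A_P)$. For each equivalence class $\omega$ of irreducible unitary representations of $M_P$ fix one smooth admissible Fréchet representation $\xi_\omega$ of $M_P$ infinitesimally equivalent to $\omega$ and topologically equivalent to a closed subrepresentation of a smooth minimal principal series representation of $M_P$; $M_{P,ds}^\wedge$ is the set of $\xi_\omega$ with $\omega$ in the discrete series. $C^\infty(K:\xi)=\{\psi\in C^\infty(K,V_\xi):\psi(mk)=\xi(m)\psi(k),\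 m\in K\cap M_P\}$. For $\lambda\in\mathfrak a_{P\mathbb C}^*$, $\pi_{P,\xi,\lambda}$ is the representation of $G$ on $C^\infty(K:\xi)$ obtained, via restriction to $K$, from the right regular representation on $\{\psi\in C^\infty(G,V_\xi):\psi(nmag)=a^{\lambda+\rho_P}\xi(m)\psi(g)\}$, $\rho_P=\frac12\mathrm{tr}(\mathrm{ad}(\cdot)|_{\mathfrak n_P})$. $\mathcal S(P,\xi)=\mathrm{End}(C^\infty(K:\xi))_{K\times K}$ ($K\times K$-finite continuous endomorphisms), $\mathcal S(P)=\bigoplus_{\xi\in M_{P,ds}^\wedge}\mathcal S(P,\xi)$, $\mathcal F_P=\mathcal O(\mathfrak a_{P\mathbb C}^* )\otimes\mathcal S(P)$, $\mathcal F=\bigoplus_{P\in\mathcal P(A)}\mathcal F_P$ (all algebraic; $\mathcal O$ = holomorphic functions). For a holomorphic $\mathrm{End}(V)$-valued function $\Phi$ on $\mathfrak a_{P\mathbb C}^*$ and $\eta\in\mathfrak a_{P\mathbb C}^*$, $\Phi^{(\eta)}(\lambda)(v_1,v_2)=(\Phi(\lambda)v_1+\frac{d}{dz}\Phi(\lambda+z\eta)v_2|_{z=0},\ \Phi(\lambda)v_2)$ on $V\oplus V$; for a finite sequence $\eta=(\eta_1,\dots,\eta_N)$, $\Phi^{(\eta)}=(\cdots(\Phi^{(\eta_N)})^{(\eta_{N-1})}\cdots)^{(\eta_1)}$ on $V^{(\eta)}=V^{\oplus 2^N}$. $\mathcal D$ is the set of $\delta=(P,\xi,\lambda,\eta)$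 with $P\in\mathcal P(A)$, $\xi\in M_{P,ds}^\wedge$, $\lambda\in\mathfrak a_{P\mathbb C}^*$ and $\eta$ a finite sequence in $\mathfrak a_{P\mathbb C}^*$. $\pi_\delta(x)=(\pi_{P,\xi,\cdot}(x))^{(\eta)}(\lambda)$ is a representation of $G$ on $C^\infty(K:\xi)^{(\eta)}$, and $\varphi_\delta=(\varphi_{P,\xi})^{(\eta)}(\lambda)$. For $\delta=(\delta_1,\dots,\delta_N)\in\mathcal D^N$: $\pi_\delta=\pi_{\delta_1}\oplus\cdots\oplus\pi_{\delta_N}$ and $\varphi_\delta=\varphi_{\delta_1}\oplus\cdots\oplus\varphi_{\delta_N}$. Intertwining operators are continuous linear $G$-equivariant maps. *)

theory Defs
  imports
    "HOL-Analysis.Analysis"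
    "HOL-Algebra.Generated_Groups"
    "HOL-Library.Function_Algebras"
begin

section \<open>Complex vector spaces\<close>

class complex_space = ab_group_add +
  fixes scaleC :: "complex \<Rightarrow> 'a \<Rightarrow> 'a"  (infixr "*\<^sub>C" 75)
  assumes scaleC_add_right: "c *\<^sub>C (x + y) = c *\<^sub>C x + c *\<^sub>C y"
    and scaleC_add_left: "(c + d) *\<^sub>C x = c *\<^sub>C x + d *\<^sub>C x"
    and scaleC_scaleC: "c *\<^sub>C d *\<^sub>C x = (c * d) *\<^sub>C x"
    and scaleC_one: "1 *\<^sub>C x = x"

instantiation complex :: complex_space
begin
definition scaleC_complex :: "complex \<Rightarrow> complex \<Rightarrow> complex"
  where "scaleC_complex c x = c * x"
instance by standard (simp_all add: scaleC_complex_def algebra_simps)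
end

instantiation "fun" :: (type, complex_space) complex_space
begin
definition scaleC_fun :: "complex \<Rightarrow> ('a \<Rightarrow> 'b) \<Rightarrow> 'a \<Rightarrow> 'b"
  where "scaleC_fun c f = (\<lambda>x. c *\<^sub>C f x)"
instance
  by standard (simp_all add: scaleC_fun_def fun_eq_iff scaleC_add_right scaleC_add_left
      scaleC_scaleC scaleC_one)
end

global_interpretation cvec: vector_space "scaleC :: complex \<Rightarrow> 'a \<Rightarrow> 'a::complex_space"
  by standard (simp_all add: scaleC_add_right scaleC_add_left scaleC_scaleC scaleC_one)

definition clinear_on :: "'a::complex_space set \<Rightarrow> ('a \<Rightarrow> 'b::complex_space) \<Rightarrow> bool"
  where "clinear_on S f \<longleftrightarrow>
    (\<forall>x\<in>S. \<forall>y\<in>S. f (x + y) = f x + f y) \<and> (\<forall>c. \<forall>x\<in>S. f (c *\<^sub>C x) = c *\<^sub>C f x)"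

definition finite_dim :: "'a::complex_space set \<Rightarrow> bool"
  where "finite_dim S \<longleftrightarrow> (\<exists>B. finite B \<and> S \<subseteq> cvec.span B)"


section \<open>Topological vector spaces\<close>

text \<open>A topological vector space is a topology whose underlying set is a linear subspace of
  the ambient type; the topology is unrelated to any topology on the ambient type.\<close>

definition tvs :: "'v::complex_space topology \<Rightarrow> bool"
  where "tvs V \<longleftrightarrow>
    cvec.subspace (topspace V) \<and> Hausdorff_space V \<and>
    continuous_map (prod_topology V V) V (\<lambda>(x, y). x + y) \<and>
    continuous_map (prod_topology euclidean V) V (\<lambda>(c, x). c *\<^sub>C x)"

definition seminorm_on :: "'v::complex_space set \<Rightarrow> ('v \<Rightarrow> real) \<Rightarrow> bool"
  where "seminorm_on C p \<longleftrightarrow>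
    (\<forall>x\<in>C. 0 \<le> p x) \<and> (\<forall>x\<in>C. \<forall>y\<in>C. p (x + y) \<le> p x + p y) \<and>
    (\<forall>c. \<forall>x\<in>C. p (c *\<^sub>C x) = cmod c * p x)"

definition seminorm_open :: "'v::complex_space set \<Rightarrow> ('v \<Rightarrow> real) set \<Rightarrow> 'v set \<Rightarrow> bool"
  where "seminorm_open C Ps U \<longleftrightarrow> U \<subseteq> C \<and>
    (\<forall>x\<in>U. \<exists>F \<epsilon>. finite F \<and> F \<subseteq> Ps \<and> 0 < \<epsilon> \<and> {y\<in>C. \<forall>p\<in>F. p (y - x) < \<epsilon>} \<subseteq> U)"

definition seminorm_topology :: "'v::complex_space set \<Rightarrow> ('v \<Rightarrow> real) set \<Rightarrow> 'v topology"
  where "seminorm_topology C Ps = topology (seminorm_open C Ps)"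

lemma openin_seminorm_topology:
  "openin (seminorm_topology C Ps) U \<longleftrightarrow> seminorm_open C Ps U"
proof -
  have "istopology (seminorm_open C Ps)"
    unfolding istopology_def
  proof (intro conjI allI impI)
    fix S T assume S: "seminorm_open C Ps S" and T: "seminorm_open C Ps T"
    show "seminorm_open C Ps (S \<inter> T)"
      unfolding seminorm_open_def
    proof (intro conjI ballI)
      show "S \<inter> T \<subseteq> C" using S by (auto simp: seminorm_open_def)
      fix x assume x: "x \<in> S \<inter> T"
      obtain F \<epsilon> where F: "finite F" "F \<subseteq> Ps" "0 < \<epsilon>" "{y\<in>C. \<forall>p\<in>F. p (y - x) < \<epsilon>} \<subseteq> S"
        using S x unfolding seminorm_open_def by blast
      obtain F' \<epsilon>' where F': "finite F'" "F' \<subseteq> Ps" "0 < \<epsilon>'" "{y\<in>C. \<forall>p\<in>F'. p (y - x) < \<epsilon>'} \<subseteq> T"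
        using T x unfolding seminorm_open_def by blast
      show "\<exists>F \<epsilon>. finite F \<and> F \<subseteq> Ps \<and> 0 < \<epsilon> \<and> {y\<in>C. \<forall>p\<in>F. p (y - x) < \<epsilon>} \<subseteq> S \<inter> T"
        using F F' by (intro exI[of _ "F \<union> F'"] exI[of _ "min \<epsilon> \<epsilon>'"]) auto
    qed
  next
    fix K assume K: "\<forall>S\<in>K. seminorm_open C Ps S"
    show "seminorm_open C Ps (\<Union>K)"
      unfolding seminorm_open_def
    proof (intro conjI ballI)
      show "\<Union>K \<subseteq> C" using K by (auto simp: seminorm_open_def)
      fix x assume "x \<in> \<Union>K"
      then obtain S where S: "S \<in> K" "x \<in> S" by auto
      have "seminorm_open C Ps S" using K S(1) by (rule bspec)
      then have "\<exists>F \<epsilon>. finite F \<and> F \<subseteq> Ps \<and> 0 < \<epsilon> \<and> {y\<in>C. \<forall>p\<in>F. p (y - x) < \<epsilon>} \<subseteq> S"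
        using S(2) by (simp add: seminorm_open_def)
      then obtain F \<epsilon> where "finite F" "F \<subseteq> Ps" "0 < \<epsilon>" "{y\<in>C. \<forall>p\<in>F. p (y - x) < \<epsilon>} \<subseteq> S"
        by (elim exE conjE)
      then show "\<exists>F \<epsilon>. finite F \<and> F \<subseteq> Ps \<and> 0 < \<epsilon> \<and> {y\<in>C. \<forall>p\<in>F. p (y - x) < \<epsilon>} \<subseteq> \<Union>K"
        using S by (intro exI[of _ F] exI[of _ \<epsilon>]) auto
    qed
  qed
  then show ?thesis
    by (simp add: seminorm_topology_def)
qed

definition continuous_seminorms :: "'v::complex_space topology \<Rightarrow> ('v \<Rightarrow> real) set"
  where "continuous_seminorms V =
    {q. seminorm_on (topspace V) q \<and> continuous_map V euclideanreal q}"

definition frechet_space :: "'v::complex_space topology \<Rightarrow> bool"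
  where "frechet_space V \<longleftrightarrow> cvec.subspace (topspace V) \<and>
    (\<exists>p :: nat \<Rightarrow> 'v \<Rightarrow> real.
       (\<forall>n. seminorm_on (topspace V) (p n)) \<and>
       (\<forall>x\<in>topspace V. (\<forall>n. p n x = 0) \<longrightarrow> x = 0) \<and>
       V = seminorm_topology (topspace V) (range p) \<and>
       (\<forall>s. (\<forall>i. s i \<in> topspace V) \<and>
            (\<forall>n. \<forall>\<epsilon>>0. \<exists>m. \<forall>i\<ge>m. \<forall>j\<ge>m. p n (s i - s j) < \<epsilon>) \<longrightarrow>
            (\<exists>x\<in>topspace V. \<forall>n. (\<lambda>i. p n (s i - x)) \<longlonglongrightarrow> 0)))"

text \<open>Direct sum of finitely many topological vector spaces, realised by families that vanish
  off the index set.\<close>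

definition direct_sum :: "'i set \<Rightarrow> ('i \<Rightarrow> 'v::complex_space topology) \<Rightarrow> ('i \<Rightarrow> 'v) topology"
  where "direct_sum I V =
    pullback_topology {f. (\<forall>i\<in>I. f i \<in> topspace (V i)) \<and> (\<forall>i. i \<notin> I \<longrightarrow> f i = 0)}
      (\<lambda>f. restrict f I) (product_topology V I)"

definition coset :: "'v::complex_space set \<Rightarrow> 'v \<Rightarrow> 'v set"
  where "coset U v = {v + u | u. u \<in> U}"

definition quotient_top :: "'v::complex_space topology \<Rightarrow> 'v set \<Rightarrow> 'v set topology"
  where "quotient_top V U = topology (\<lambda>S. S \<subseteq> coset U ` topspace V \<and>
    openin V {v \<in> topspace V. coset U v \<in> S})"

lemma openin_quotient_top:
  "openin (quotient_top V U) S \<longleftrightarrow>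
    S \<subseteq> coset U ` topspace V \<and> openin V {v \<in> topspace V. coset U v \<in> S}"
proof -
  have "istopology (\<lambda>S. S \<subseteq> coset U ` topspace V \<and> openin V {v \<in> topspace V. coset U v \<in> S})"
    unfolding istopology_def
  proof (rule conjI; intro allI impI)
    fix S T
    assume "S \<subseteq> coset U ` topspace V \<and> openin V {v \<in> topspace V. coset U v \<in> S}"
      and "T \<subseteq> coset U ` topspace V \<and> openin V {v \<in> topspace V. coset U v \<in> T}"
    moreover have "{v \<in> topspace V. coset U v \<in> S \<inter> T} =
        {v \<in> topspace V. coset U v \<in> S} \<inter> {v \<in> topspace V. coset U v \<in> T}" by auto
    ultimately show "S \<inter> T \<subseteq> coset U ` topspace V \<and>
        openin V {v \<in> topspace V. coset U v \<in> S \<inter> T}" by auto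
  next
    fix K
    assume K: "\<forall>S\<in>K. S \<subseteq> coset U ` topspace V \<and> openin V {v \<in> topspace V. coset U v \<in> S}"
    have "{v \<in> topspace V. coset U v \<in> \<Union>K} = (\<Union>S\<in>K. {v \<in> topspace V. coset U v \<in> S})" by auto
    then show "\<Union>K \<subseteq> coset U ` topspace V \<and> openin V {v \<in> topspace V. coset U v \<in> \<Union>K}"
      using K by auto
  qed
  then show ?thesis
    by (simp add: quotient_top_def)
qed


section \<open>Lie groups\<close>

text \<open>Iterated directional differentiability on a relatively open subset of a linear subspace
  \<open>E\<close>.  Lie groups are modelled on subspaces of a Euclidean space so that dimension zero is
  included.\<close>

primrec Ck :: "'a::euclidean_space set \<Rightarrow> nat \<Rightarrow> 'a set \<Rightarrow> ('a \<Rightarrow> 'b::real_normed_vector) \<Rightarrow> bool"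
  where
    "Ck E 0 S f \<longleftrightarrow> continuous_on S f"
  | "Ck E (Suc k) S f \<longleftrightarrow> continuous_on S f \<and>
      (\<exists>D. (\<forall>v\<in>E. \<forall>x\<in>S. ((\<lambda>t. f (x + t *\<^sub>R v)) has_vector_derivative D v x) (at 0)) \<and>
           (\<forall>v\<in>E. Ck E k S (D v)))"

definition smooth_map :: "'a::euclidean_space set \<Rightarrow> 'a set \<Rightarrow> ('a \<Rightarrow> 'b::real_normed_vector) \<Rightarrow> bool"
  where "smooth_map E S f \<longleftrightarrow> (\<forall>k. Ck E k S f)"

record ('g, 'e) lie_data = "'g monoid" +
  gtop :: "'g topology"
  model :: "'e set"
  atlas :: "('g set \<times> ('g \<Rightarrow> 'e)) set"

definition lie_group :: "('g, 'e::euclidean_space, 'z) lie_data_scheme \<Rightarrow> bool"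
  where "lie_group G \<longleftrightarrow>
    group G \<and> topspace (gtop G) = carrier G \<and> Hausdorff_space (gtop G) \<and>
    second_countable (gtop G) \<and>
    continuous_map (prod_topology (gtop G) (gtop G)) (gtop G) (\<lambda>(x, y). x \<otimes>\<^bsub>G\<^esub> y) \<and>
    continuous_map (gtop G) (gtop G) (\<lambda>x. inv\<^bsub>G\<^esub> x) \<and>
    subspace (model G) \<and>
    (\<forall>(U, \<kappa>)\<in>atlas G. openin (gtop G) U \<and>
        openin (top_of_set (model G)) (\<kappa> ` U) \<and>
        homeomorphic_map (subtopology (gtop G) U) (top_of_set (\<kappa> ` U)) \<kappa>) \<and>
    (\<Union>(U, \<kappa>)\<in>atlas G. U) = carrier G \<and>
    (\<forall>(U, \<kappa>)\<in>atlas G. \<forall>(V, \<mu>)\<in>atlas G.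
        smooth_map (model G) (\<kappa> ` (U \<inter> V)) (\<lambda>x. \<mu> (inv_into U \<kappa> x))) \<and>
    (\<forall>(U, \<kappa>)\<in>atlas G. \<forall>(V, \<mu>)\<in>atlas G. \<forall>(W, \<nu>)\<in>atlas G.
        smooth_map (model G \<times> model G)
          {(x, y). x \<in> \<kappa> ` U \<and> y \<in> \<mu> ` V \<and> inv_into U \<kappa> x \<otimes>\<^bsub>G\<^esub> inv_into V \<mu> y \<in> W}
          (\<lambda>(x, y). \<nu> (inv_into U \<kappa> x \<otimes>\<^bsub>G\<^esub> inv_into V \<mu> y))) \<and>
    (\<forall>(U, \<kappa>)\<in>atlas G. \<forall>(V, \<mu>)\<in>atlas G.
        smooth_map (model G) {x \<in> \<kappa> ` U. inv\<^bsub>G\<^esub> (inv_into U \<kappa> x) \<in> V}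
          (\<lambda>x. \<mu> (inv\<^bsub>G\<^esub> (inv_into U \<kappa> x))))"

text \<open>The Lie algebra of \<open>G\<close> is the model space, identified with the tangent space at the
  identity by the differential of a fixed chart.\<close>

definition chart1 :: "('g, 'e::euclidean_space, 'z) lie_data_scheme \<Rightarrow> 'g \<Rightarrow> 'e"
  where "chart1 G = snd (SOME c. c \<in> atlas G \<and> \<one>\<^bsub>G\<^esub> \<in> fst c)"

definition gexp :: "('g, 'e::euclidean_space, 'z) lie_data_scheme \<Rightarrow> 'e \<Rightarrow> 'g"
  where "gexp G X = (THE \<gamma>.
      continuous_map euclideanreal (gtop G) \<gamma> \<and> (\<forall>s t. \<gamma> (s + t) = \<gamma> s \<otimes>\<^bsub>G\<^esub> \<gamma> t) \<and>
      ((\<lambda>t. chart1 G (\<gamma> t)) has_vector_derivative X) (at 0)) (1::real)"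

definition Ad :: "('g, 'e::euclidean_space, 'z) lie_data_scheme \<Rightarrow> 'g \<Rightarrow> 'e \<Rightarrow> 'e"
  where "Ad G x X =
    vector_derivative (\<lambda>t. chart1 G (x \<otimes>\<^bsub>G\<^esub> gexp G (t *\<^sub>R X) \<otimes>\<^bsub>G\<^esub> inv\<^bsub>G\<^esub> x)) (at 0)"

definition bracket :: "('g, 'e::euclidean_space, 'z) lie_data_scheme \<Rightarrow> 'e \<Rightarrow> 'e \<Rightarrow> 'e"
  where "bracket G X Y = vector_derivative (\<lambda>t. Ad G (gexp G (t *\<^sub>R X)) Y) (at 0)"

definition lie :: "('g, 'e::euclidean_space, 'z) lie_data_scheme \<Rightarrow> 'g set \<Rightarrow> 'e set"
  where "lie G H = {X \<in> model G. \<forall>t. gexp G (t *\<^sub>R X) \<in> H}"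

definition derived_algebra :: "('g, 'e::euclidean_space, 'z) lie_data_scheme \<Rightarrow> 'e set"
  where "derived_algebra G = span {bracket G X Y | X Y. X \<in> model G \<and> Y \<in> model G}"

definition trace_on :: "'e::euclidean_space set \<Rightarrow> ('e \<Rightarrow> 'e) \<Rightarrow> real"
  where "trace_on S f =
    (let B = (SOME B. pairwise orthogonal B \<and> (\<forall>b\<in>B. norm b = 1) \<and> span B = S)
     in \<Sum>b\<in>B. b \<bullet> f b)"

definition killing_form :: "('g, 'e::euclidean_space, 'z) lie_data_scheme \<Rightarrow> 'e \<Rightarrow> 'e \<Rightarrow> real"
  where "killing_form G X Y = trace_on (model G) (\<lambda>Z. bracket G X (bracket G Y Z))"


section \<open>The Harish-Chandra class\<close>

definition reductive_algebra :: "('g, 'e::euclidean_space, 'z) lie_data_scheme \<Rightarrow> bool"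
  where "reductive_algebra G \<longleftrightarrow>
    (let ideal_of = (\<lambda>I. subspace I \<and> I \<subseteq> model G \<and>
                        (\<forall>X\<in>model G. \<forall>Y\<in>I. bracket G X Y \<in> I))
     in \<forall>I. ideal_of I \<longrightarrow>
          (\<exists>J. ideal_of J \<and> I \<inter> J = {0} \<and> model G = {X + Y | X Y. X \<in> I \<and> Y \<in> J}))"

text \<open>The complexified Lie algebra consists of the pairs \<open>(X, Y)\<close>, standing for \<open>X + iY\<close>.\<close>

fun cbracket :: "('g, 'e::euclidean_space, 'z) lie_data_scheme \<Rightarrow> 'e \<times> 'e \<Rightarrow> 'e \<times> 'e \<Rightarrow> 'e \<times> 'e"
  where "cbracket G (X, Y) (X', Y') =
    (bracket G X X' - bracket G Y Y', bracket G X Y' + bracket G Y X')"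

text \<open>The adjoint group of the complexified Lie algebra, generated by all
  \<open>exp (ad Z)\<close>; inverses are \<open>exp (ad (-Z))\<close>.\<close>

inductive_set inner_automorphisms ::
    "('g, 'e::euclidean_space, 'z) lie_data_scheme \<Rightarrow> ('e \<times> 'e \<Rightarrow> 'e \<times> 'e) set"
  for G where
    "id \<in> inner_automorphisms G"
  | "h \<in> inner_automorphisms G \<Longrightarrow> Z \<in> model G \<times> model G \<Longrightarrow>
      (\<lambda>W. \<Sum>n. (1 / fact n) *\<^sub>R (cbracket G Z ^^ n) (h W)) \<in> inner_automorphisms G"

definition harish_chandra_class :: "('g, 'e::euclidean_space, 'z) lie_data_scheme \<Rightarrow> bool"
  where "harish_chandra_class G \<longleftrightarrow>
    lie_group G \<and> reductive_algebra G \<and>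
    finite (connected_components_of (gtop G)) \<and>
    (\<forall>x\<in>carrier G. \<exists>h\<in>inner_automorphisms G.
       \<forall>X\<in>model G. \<forall>Y\<in>model G. h (X, Y) = (Ad G x X, Ad G x Y)) \<and>
    (let G1 = generate G (gexp G ` derived_algebra G)
     in finite {z \<in> G1. \<forall>x\<in>G1. z \<otimes>\<^bsub>G\<^esub> x = x \<otimes>\<^bsub>G\<^esub> z})"

text \<open>A group with a maximal compact subgroup \<open>K\<close>, the complement \<open>\<pp>\<close> in the Cartan
  decomposition and a maximal abelian subspace \<open>\<aa>\<close>.\<close>

record ('g, 'e) reductive_data = "('g, 'e) lie_data" +
  Kgrp :: "'g set"
  pp :: "'e set"
  aa :: "'e set"

definition maximal_compact :: "('g, 'e::euclidean_space, 'z) lie_data_scheme \<Rightarrow> 'g set \<Rightarrow> bool"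
  where "maximal_compact G K \<longleftrightarrow>
    subgroup K G \<and> compactin (gtop G) K \<and>
    (\<forall>K'. subgroup K' G \<and> compactin (gtop G) K' \<and> K \<subseteq> K' \<longrightarrow> K' = K)"

definition cartan_decomposition ::
    "('g, 'e::euclidean_space, 'z) lie_data_scheme \<Rightarrow> 'g set \<Rightarrow> 'e set \<Rightarrow> bool"
  where "cartan_decomposition G K \<pp> \<longleftrightarrow>
    subspace \<pp> \<and> lie G K \<inter> \<pp> = {0} \<and>
    model G = {X + Y | X Y. X \<in> lie G K \<and> Y \<in> \<pp>} \<and>
    (\<forall>k\<in>K. Ad G k ` \<pp> \<subseteq> \<pp>) \<and>
    (\<forall>X\<in>lie G K. \<forall>Y\<in>\<pp>. bracket G X Y \<in> \<pp>) \<and>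
    (\<forall>X\<in>\<pp>. \<forall>Y\<in>\<pp>. bracket G X Y \<in> lie G K) \<and>
    (\<forall>X\<in>lie G K \<inter> derived_algebra G. X \<noteq> 0 \<longrightarrow> killing_form G X X < 0) \<and>
    (\<forall>X\<in>\<pp> \<inter> derived_algebra G. X \<noteq> 0 \<longrightarrow> killing_form G X X > 0) \<and>
    homeomorphic_map (prod_topology (subtopology (gtop G) K) (top_of_set \<pp>)) (gtop G)
      (\<lambda>(k, X). k \<otimes>\<^bsub>G\<^esub> gexp G X)"

definition abelian_subspace ::
    "('g, 'e::euclidean_space, 'z) lie_data_scheme \<Rightarrow> 'e set \<Rightarrow> 'e set \<Rightarrow> bool"
  where "abelian_subspace G \<pp> \<aa> \<longleftrightarrow>
    subspace \<aa> \<and> \<aa> \<subseteq> \<pp> \<and> (\<forall>X\<in>\<aa>. \<forall>Y\<in>\<aa>. bracket G X Y = 0)"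

definition real_reductive :: "('g, 'e::euclidean_space) reductive_data \<Rightarrow> bool"
  where "real_reductive G \<longleftrightarrow>
    harish_chandra_class G \<and> maximal_compact G (Kgrp G) \<and>
    cartan_decomposition G (Kgrp G) (pp G) \<and>
    abelian_subspace G (pp G) (aa G) \<and>
    (\<forall>\<bb>. abelian_subspace G (pp G) \<bb> \<and> aa G \<subseteq> \<bb> \<longrightarrow> \<bb> = aa G)"


section \<open>Parabolic subgroups and their Langlands decomposition\<close>

text \<open>Everything below is relative to a closed subgroup \<open>H\<close>, which is either \<open>G\<close> or some
  \<open>M\<^sub>P\<close>; the Cartan decomposition and the maximal compact subgroup of \<open>H\<close> are
  obtained from those of \<open>G\<close> by intersection.\<close>

definition complex_subalgebra ::
    "('g, 'e::euclidean_space, 'z) lie_data_scheme \<Rightarrow> ('e \<times> 'e) set \<Rightarrow> bool"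
  where "complex_subalgebra G S \<longleftrightarrow>
    subspace S \<and> (\<forall>(X, Y)\<in>S. (- Y, X) \<in> S) \<and> (\<forall>Z\<in>S. \<forall>W\<in>S. cbracket G Z W \<in> S)"

definition solvable_algebra ::
    "('g, 'e::euclidean_space, 'z) lie_data_scheme \<Rightarrow> ('e \<times> 'e) set \<Rightarrow> bool"
  where "solvable_algebra G S \<longleftrightarrow>
    (\<exists>n. ((\<lambda>D. span {cbracket G Z W | Z W. Z \<in> D \<and> W \<in> D}) ^^ n) S \<subseteq> {0})"

definition borel_subalgebra ::
    "('g, 'e::euclidean_space, 'z) lie_data_scheme \<Rightarrow> 'e set \<Rightarrow> ('e \<times> 'e) set \<Rightarrow> bool"
  where "borel_subalgebra G \<hh> \<bb> \<longleftrightarrow>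
    (let adm = (\<lambda>S. complex_subalgebra G S \<and> solvable_algebra G S \<and> S \<subseteq> \<hh> \<times> \<hh>)
     in adm \<bb> \<and> (\<forall>S. adm S \<and> \<bb> \<subseteq> S \<longrightarrow> S = \<bb>))"

definition parabolic_subalgebra ::
    "('g, 'e::euclidean_space, 'z) lie_data_scheme \<Rightarrow> 'e set \<Rightarrow> 'e set \<Rightarrow> bool"
  where "parabolic_subalgebra G \<hh> \<qq> \<longleftrightarrow>
    subspace \<qq> \<and> \<qq> \<subseteq> \<hh> \<and> (\<forall>X\<in>\<qq>. \<forall>Y\<in>\<qq>. bracket G X Y \<in> \<qq>) \<and>
    (\<exists>\<bb>. borel_subalgebra G \<hh> \<bb> \<and> \<bb> \<subseteq> \<qq> \<times> \<qq>)"

definition parabolic ::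
    "('g, 'e::euclidean_space, 'z) lie_data_scheme \<Rightarrow> 'g set \<Rightarrow> 'g set \<Rightarrow> bool"
  where "parabolic G H Q \<longleftrightarrow>
    (\<exists>\<qq>. parabolic_subalgebra G (lie G H) \<qq> \<and> Q = {x \<in> H. Ad G x ` \<qq> = \<qq>})"

definition minimal_parabolic ::
    "('g, 'e::euclidean_space, 'z) lie_data_scheme \<Rightarrow> 'g set \<Rightarrow> 'g set \<Rightarrow> bool"
  where "minimal_parabolic G H Q \<longleftrightarrow>
    parabolic G H Q \<and> (\<forall>Q'. parabolic G H Q' \<and> Q' \<subseteq> Q \<longrightarrow> Q' = Q)"

definition parabolics :: "('g, 'e::euclidean_space) reductive_data \<Rightarrow> 'g set set"
  where "parabolics G = {P. parabolic G (carrier G) P \<and> gexp G ` aa G \<subseteq> P}"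

text \<open>The Levi algebra is \<open>\<qq> \<inter> \<theta> \<qq>\<close> with \<open>\<theta>\<close> the Cartan involution.\<close>

definition levi_algebra :: "('g, 'e::euclidean_space) reductive_data \<Rightarrow> 'g set \<Rightarrow> 'e set"
  where "levi_algebra G Q = lie G Q \<inter>
    {X - Y | X Y. X \<in> lie G (Kgrp G) \<and> Y \<in> pp G \<and> X + Y \<in> lie G Q}"

definition a_of :: "('g, 'e::euclidean_space) reductive_data \<Rightarrow> 'g set \<Rightarrow> 'e set"
  where "a_of G Q = {X \<in> levi_algebra G Q \<inter> pp G. \<forall>Y\<in>levi_algebra G Q. bracket G X Y = 0}"

definition n_of :: "('g, 'e::euclidean_space) reductive_data \<Rightarrow> 'g set \<Rightarrow> 'e set"
  where "n_of G Q = span (\<Union>\<alpha>\<in>{\<alpha> :: 'e \<Rightarrow> real. \<exists>X\<in>a_of G Q. \<alpha> X \<noteq> 0}.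
    {Y \<in> lie G Q. \<forall>X\<in>a_of G Q. bracket G X Y = \<alpha> X *\<^sub>R Y})"

definition N_of :: "('g, 'e::euclidean_space) reductive_data \<Rightarrow> 'g set \<Rightarrow> 'g set"
  where "N_of G Q = gexp G ` n_of G Q"

text \<open>\<open>L\<^sub>Q\<close> is the centraliser of \<open>\<aa>\<^sub>Q\<close> in \<open>H\<close>, and \<open>M\<^sub>Q\<close> is the common kernel
  of all continuous characters of \<open>L\<^sub>Q\<close> with positive real values.\<close>

definition L_of :: "('g, 'e::euclidean_space) reductive_data \<Rightarrow> 'g set \<Rightarrow> 'g set \<Rightarrow> 'g set"
  where "L_of G H Q = {x \<in> H. \<forall>X\<in>a_of G Q. Ad G x X = X}"

definition M_of :: "('g, 'e::euclidean_space) reductive_data \<Rightarrow> 'g set \<Rightarrow> 'g set \<Rightarrow> 'g set"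
  where "M_of G H Q = {m \<in> L_of G H Q. \<forall>c :: 'g \<Rightarrow> real.
      continuous_map (subtopology (gtop G) (L_of G H Q)) euclideanreal c \<and>
      (\<forall>x\<in>L_of G H Q. 0 < c x) \<and>
      (\<forall>x\<in>L_of G H Q. \<forall>y\<in>L_of G H Q. c (x \<otimes>\<^bsub>G\<^esub> y) = c x * c y) \<longrightarrow> c m = 1}"

definition rho :: "('g, 'e::euclidean_space) reductive_data \<Rightarrow> 'g set \<Rightarrow> 'e \<Rightarrow> real"
  where "rho G Q X = trace_on (n_of G Q) (bracket G X) / 2"

text \<open>The complexified dual of \<open>\<aa>\<^sub>Q\<close>: real-linear complex-valued functionals on
  \<open>\<aa>\<^sub>Q\<close>, extended by zero off \<open>\<aa>\<^sub>Q\<close>.\<close>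

definition aC_dual :: "('g, 'e::euclidean_space) reductive_data \<Rightarrow> 'g set \<Rightarrow> ('e \<Rightarrow> complex) set"
  where "aC_dual G Q = {\<nu>.
    (\<forall>X\<in>a_of G Q. \<forall>Y\<in>a_of G Q. \<nu> (X + Y) = \<nu> X + \<nu> Y) \<and>
    (\<forall>r. \<forall>X\<in>a_of G Q. \<nu> (r *\<^sub>R X) = of_real r * \<nu> X) \<and>
    (\<forall>X. X \<notin> a_of G Q \<longrightarrow> \<nu> X = 0)}"


section \<open>Representations\<close>

record ('g, 'v) rep =
  rspace :: "'v topology"
  ract :: "'g \<Rightarrow> 'v \<Rightarrow> 'v"

definition representation ::
    "('g, 'e::euclidean_space, 'z) lie_data_scheme \<Rightarrow> 'g set \<Rightarrow> ('g, 'v::complex_space) rep \<Rightarrow> bool"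
  where "representation G H R \<longleftrightarrow>
    tvs (rspace R) \<and>
    (\<forall>x\<in>H. clinear_on (topspace (rspace R)) (ract R x)) \<and>
    (\<forall>v\<in>topspace (rspace R). ract R \<one>\<^bsub>G\<^esub> v = v) \<and>
    (\<forall>x\<in>H. \<forall>y\<in>H. \<forall>v\<in>topspace (rspace R). ract R (x \<otimes>\<^bsub>G\<^esub> y) v = ract R x (ract R y v)) \<and>
    continuous_map (prod_topology (subtopology (gtop G) H) (rspace R)) (rspace R)
      (\<lambda>(x, v). ract R x v)"

definition closed_invariant :: "'g set \<Rightarrow> ('g, 'v::complex_space) rep \<Rightarrow> 'v set \<Rightarrow> bool"
  where "closed_invariant H R U \<longleftrightarrow>
    cvec.subspace U \<and> closedin (rspace R) U \<and> (\<forall>x\<in>H. \<forall>v\<in>U. ract R x v \<in> U)"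

definition irreducible_rep :: "'g set \<Rightarrow> ('g, 'v::complex_space) rep \<Rightarrow> bool"
  where "irreducible_rep H R \<longleftrightarrow> topspace (rspace R) \<noteq> {0} \<and>
    (\<forall>U. closed_invariant H R U \<longrightarrow> U = {0} \<or> U = topspace (rspace R))"

text \<open>Derivatives of vector-valued functions on a closed subgroup \<open>H\<close> along the left invariant
  vector fields, and smoothness on \<open>H\<close>.\<close>

definition has_lderiv ::
    "('g, 'e::euclidean_space, 'z) lie_data_scheme \<Rightarrow> 'v::complex_space topology \<Rightarrow> 'e \<Rightarrow>
     ('g \<Rightarrow> 'v) \<Rightarrow> 'g \<Rightarrow> 'v \<Rightarrow> bool"
  where "has_lderiv G V X f x w \<longleftrightarrow>
    limitin V (\<lambda>t. complex_of_real (1 / t) *\<^sub>C (f (x \<otimes>\<^bsub>G\<^esub> gexp G (t *\<^sub>R X)) - f x)) w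
      (at (0::real))"

definition lderiv ::
    "('g, 'e::euclidean_space, 'z) lie_data_scheme \<Rightarrow> 'g set \<Rightarrow> 'v::complex_space topology \<Rightarrow> 'e \<Rightarrow>
     ('g \<Rightarrow> 'v) \<Rightarrow> 'g \<Rightarrow> 'v"
  where "lderiv G H V X f = (\<lambda>x. if x \<in> H then THE w. has_lderiv G V X f x w else 0)"

primrec Ck_on ::
    "('g, 'e::euclidean_space, 'z) lie_data_scheme \<Rightarrow> 'g set \<Rightarrow> 'v::complex_space topology \<Rightarrow> nat \<Rightarrow>
     ('g \<Rightarrow> 'v) \<Rightarrow> bool"
  where
    "Ck_on G H V 0 f \<longleftrightarrow> continuous_map (subtopology (gtop G) H) V f"
  | "Ck_on G H V (Suc n) f \<longleftrightarrow> continuous_map (subtopology (gtop G) H) V f \<and>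
      (\<forall>X\<in>lie G H. (\<forall>x\<in>H. \<exists>w. has_lderiv G V X f x w) \<and> Ck_on G H V n (lderiv G H V X f))"

definition smooth_on_group ::
    "('g, 'e::euclidean_space, 'z) lie_data_scheme \<Rightarrow> 'g set \<Rightarrow> 'v::complex_space topology \<Rightarrow>
     ('g \<Rightarrow> 'v) \<Rightarrow> bool"
  where "smooth_on_group G H V f \<longleftrightarrow> (\<forall>n. Ck_on G H V n f)"

definition smooth_vectors ::
    "('g, 'e::euclidean_space, 'z) lie_data_scheme \<Rightarrow> 'g set \<Rightarrow> ('g, 'v::complex_space) rep \<Rightarrow> 'v set"
  where "smooth_vectors G H R =
    {v \<in> topspace (rspace R). smooth_on_group G H (rspace R) (\<lambda>x. ract R x v)}"

definition smooth_frechet_rep ::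
    "('g, 'e::euclidean_space, 'z) lie_data_scheme \<Rightarrow> 'g set \<Rightarrow> ('g, 'v::complex_space) rep \<Rightarrow> bool"
  where "smooth_frechet_rep G H R \<longleftrightarrow>
    representation G H R \<and> frechet_space (rspace R) \<and>
    smooth_vectors G H R = topspace (rspace R)"

text \<open>Separable Hilbert spaces and finite-dimensional spaces are realised, up to isomorphism, on
  linear subspaces of \<open>nat \<Rightarrow> complex\<close>.\<close>

definition finite_dim_irreducible ::
    "('g, 'e::euclidean_space, 'z) lie_data_scheme \<Rightarrow> 'g set \<Rightarrow> ('g, nat \<Rightarrow> complex) rep \<Rightarrow> bool"
  where "finite_dim_irreducible G H \<tau> \<longleftrightarrow>
    representation G H \<tau> \<and> finite_dim (topspace (rspace \<tau>)) \<and> irreducible_rep H \<tau>"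

definition admissible ::
    "('g, 'e::euclidean_space) reductive_data \<Rightarrow> 'g set \<Rightarrow> ('g, 'v::complex_space) rep \<Rightarrow> bool"
  where "admissible G H R \<longleftrightarrow>
    (\<forall>\<tau>. finite_dim_irreducible G (Kgrp G \<inter> H) \<tau> \<longrightarrow>
      finite_dim {T w | T w. w \<in> topspace (rspace \<tau>) \<and>
        clinear_on (topspace (rspace \<tau>)) T \<and>
        T ` topspace (rspace \<tau>) \<subseteq> topspace (rspace R) \<and>
        (\<forall>k\<in>Kgrp G \<inter> H. \<forall>u\<in>topspace (rspace \<tau>). T (ract \<tau> k u) = ract R k (T u))})"

text \<open>Unitary representations are pairs of a representation and an inner product, linear in the
  first argument.\<close>

type_synonym 'g unitary = "('g, nat \<Rightarrow> complex) rep \<times> ((nat \<Rightarrow> complex) \<Rightarrow> (nat \<Rightarrow> complex) \<Rightarrow> complex)"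

definition hilbert_space ::
    "(nat \<Rightarrow> complex) topology \<Rightarrow> ((nat \<Rightarrow> complex) \<Rightarrow> (nat \<Rightarrow> complex) \<Rightarrow> complex) \<Rightarrow> bool"
  where "hilbert_space W ip \<longleftrightarrow>
    (\<forall>w\<in>topspace W. clinear_on (topspace W) (\<lambda>v. ip v w)) \<and>
    (\<forall>v\<in>topspace W. \<forall>w\<in>topspace W. ip w v = cnj (ip v w)) \<and>
    (\<forall>v\<in>topspace W. v \<noteq> 0 \<longrightarrow> 0 < Re (ip v v)) \<and>
    (let nrm = (\<lambda>v. sqrt (Re (ip v v)))
     in W = seminorm_topology (topspace W) {nrm} \<and>
        (\<forall>s. (\<forall>i. s i \<in> topspace W) \<and> (\<forall>\<epsilon>>0. \<exists>m. \<forall>i\<ge>m. \<forall>j\<ge>m. nrm (s i - s j) < \<epsilon>) \<longrightarrow>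
             (\<exists>w\<in>topspace W. (\<lambda>i. nrm (s i - w)) \<longlonglongrightarrow> 0)))"

definition irreducible_unitary ::
    "('g, 'e::euclidean_space, 'z) lie_data_scheme \<Rightarrow> 'g set \<Rightarrow> 'g unitary \<Rightarrow> bool"
  where "irreducible_unitary G M \<omega> \<longleftrightarrow>
    (case \<omega> of (R, ip) \<Rightarrow>
      representation G M R \<and> hilbert_space (rspace R) ip \<and>
      (\<forall>x\<in>M. \<forall>v\<in>topspace (rspace R). \<forall>w\<in>topspace (rspace R).
          ip (ract R x v) (ract R x w) = ip v w) \<and>
      irreducible_rep M R)"

definition unitarily_equivalent :: "'g set \<Rightarrow> 'g unitary \<Rightarrow> 'g unitary \<Rightarrow> bool"
  where "unitarily_equivalent M \<omega> \<omega>' \<longleftrightarrow>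
    (case (\<omega>, \<omega>') of ((R, ip), (R', ip')) \<Rightarrow>
      \<exists>T. clinear_on (topspace (rspace R)) T \<and>
          bij_betw T (topspace (rspace R)) (topspace (rspace R')) \<and>
          (\<forall>v\<in>topspace (rspace R). \<forall>w\<in>topspace (rspace R). ip' (T v) (T w) = ip v w) \<and>
          (\<forall>x\<in>M. \<forall>v\<in>topspace (rspace R). T (ract R x v) = ract R' x (T v)))"

definition haar_measure ::
    "('g, 'e::euclidean_space, 'z) lie_data_scheme \<Rightarrow> 'g set \<Rightarrow> 'g measure \<Rightarrow> bool"
  where "haar_measure G M \<mu> \<longleftrightarrow>
    space \<mu> = M \<and> sets \<mu> = sigma_sets M {U. openin (subtopology (gtop G) M) U} \<and>
    (\<forall>C. compactin (subtopology (gtop G) M) C \<longrightarrow> emeasure \<mu> C < \<infinity>) \<and>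
    (\<forall>U. openin (subtopology (gtop G) M) U \<and> U \<noteq> {} \<longrightarrow> 0 < emeasure \<mu> U) \<and>
    (\<forall>x\<in>M. \<forall>B\<in>sets \<mu>. emeasure \<mu> ((\<lambda>y. x \<otimes>\<^bsub>G\<^esub> y) ` B) = emeasure \<mu> B)"

definition discrete_series ::
    "('g, 'e::euclidean_space, 'z) lie_data_scheme \<Rightarrow> 'g set \<Rightarrow> 'g unitary \<Rightarrow> bool"
  where "discrete_series G M \<omega> \<longleftrightarrow> irreducible_unitary G M \<omega> \<and>
    (case \<omega> of (R, ip) \<Rightarrow>
      \<exists>\<mu>. haar_measure G M \<mu> \<and>
        (\<forall>v\<in>topspace (rspace R). \<forall>w\<in>topspace (rspace R).
          (\<integral>\<^sup>+ m. ennreal ((cmod (ip (ract R m v) w))\<^sup>2) \<partial>\<mu>) < \<infinity>))"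

definition harish_chandra_module ::
    "('g, 'e::euclidean_space) reductive_data \<Rightarrow> 'g set \<Rightarrow> ('g, 'v::complex_space) rep \<Rightarrow> 'v set"
  where "harish_chandra_module G M R =
    {v \<in> smooth_vectors G M R. finite_dim {ract R k v | k. k \<in> Kgrp G \<inter> M}}"

definition infinitesimally_equivalent ::
    "('g, 'e::euclidean_space) reductive_data \<Rightarrow> 'g set \<Rightarrow> ('g, 'v::complex_space) rep \<Rightarrow>
     ('g, 'w::complex_space) rep \<Rightarrow> bool"
  where "infinitesimally_equivalent G M R R' \<longleftrightarrow>
    (\<exists>T. clinear_on (harish_chandra_module G M R) T \<and>
       bij_betw T (harish_chandra_module G M R) (harish_chandra_module G M R') \<and>
       (\<forall>v\<in>harish_chandra_module G M R.
          (\<forall>k\<in>Kgrp G \<inter> M. T (ract R k v) = ract R' k (T v)) \<and>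
          (\<forall>X\<in>lie G M.
             T (lderiv G M (rspace R) X (\<lambda>x. ract R x v) \<one>\<^bsub>G\<^esub>) =
             lderiv G M (rspace R') X (\<lambda>x. ract R' x (T v)) \<one>\<^bsub>G\<^esub>)))"


section \<open>Principal series\<close>

text \<open>The space \<open>C\<^sup>\<infinity>(K : \<xi>)\<close> for a parabolic subgroup \<open>Q\<close> of \<open>H\<close>; functions on \<open>K \<inter> H\<close> are
  extended by zero.\<close>

definition K_sections ::
    "('g, 'e::euclidean_space) reductive_data \<Rightarrow> 'g set \<Rightarrow> 'g set \<Rightarrow> ('g, 'v::complex_space) rep \<Rightarrow>
     ('g \<Rightarrow> 'v) set"
  where "K_sections G H Q \<xi> = {\<psi>.
    smooth_on_group G (Kgrp G \<inter> H) (rspace \<xi>) \<psi> \<and>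
    (\<forall>x. x \<notin> Kgrp G \<inter> H \<longrightarrow> \<psi> x = 0) \<and>
    (\<forall>m\<in>Kgrp G \<inter> M_of G H Q. \<forall>k\<in>Kgrp G \<inter> H. \<psi> (m \<otimes>\<^bsub>G\<^esub> k) = ract \<xi> m (\<psi> k))}"

definition K_space ::
    "('g, 'e::euclidean_space) reductive_data \<Rightarrow> 'g set \<Rightarrow> 'g set \<Rightarrow> ('g, 'v::complex_space) rep \<Rightarrow>
     ('g \<Rightarrow> 'v) topology"
  where "K_space G H Q \<xi> = seminorm_topology (K_sections G H Q \<xi>)
    {(\<lambda>\<psi>. SUP k\<in>Kgrp G \<inter> H. q (fold (lderiv G (Kgrp G \<inter> H) (rspace \<xi>)) Xs \<psi> k)) | q Xs.
       q \<in> continuous_seminorms (rspace \<xi>) \<and> set Xs \<subseteq> lie G (Kgrp G \<inter> H)}"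

definition induced_space ::
    "('g, 'e::euclidean_space) reductive_data \<Rightarrow> 'g set \<Rightarrow> 'g set \<Rightarrow> ('g, 'v::complex_space) rep \<Rightarrow>
     ('e \<Rightarrow> complex) \<Rightarrow> ('g \<Rightarrow> 'v) set"
  where "induced_space G H Q \<xi> \<nu> = {\<psi>.
    smooth_on_group G H (rspace \<xi>) \<psi> \<and> (\<forall>x. x \<notin> H \<longrightarrow> \<psi> x = 0) \<and>
    (\<forall>n\<in>N_of G Q. \<forall>m\<in>M_of G H Q. \<forall>X\<in>a_of G Q. \<forall>x\<in>H.
       \<psi> (n \<otimes>\<^bsub>G\<^esub> m \<otimes>\<^bsub>G\<^esub> gexp G X \<otimes>\<^bsub>G\<^esub> x) =
       exp (\<nu> X + of_real (rho G Q X)) *\<^sub>C ract \<xi> m (\<psi> x))}"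

definition ps_act ::
    "('g, 'e::euclidean_space) reductive_data \<Rightarrow> 'g set \<Rightarrow> 'g set \<Rightarrow> ('g, 'v::complex_space) rep \<Rightarrow>
     ('e \<Rightarrow> complex) \<Rightarrow> 'g \<Rightarrow> ('g \<Rightarrow> 'v) \<Rightarrow> 'g \<Rightarrow> 'v"
  where "ps_act G H Q \<xi> \<nu> x f =
    (let \<psi> = (THE \<psi>. \<psi> \<in> induced_space G H Q \<xi> \<nu> \<and> (\<forall>k\<in>Kgrp G \<inter> H. \<psi> k = f k))
     in (\<lambda>k. if k \<in> Kgrp G \<inter> H then \<psi> (k \<otimes>\<^bsub>G\<^esub> x) else 0))"

definition principal_series ::
    "('g, 'e::euclidean_space) reductive_data \<Rightarrow> 'g set \<Rightarrow> 'g set \<Rightarrow> ('g, 'v::complex_space) rep \<Rightarrow>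
     ('e \<Rightarrow> complex) \<Rightarrow> ('g, 'g \<Rightarrow> 'v) rep"
  where "principal_series G H Q \<xi> \<nu> = \<lparr>rspace = K_space G H Q \<xi>, ract = ps_act G H Q \<xi> \<nu>\<rparr>"

definition subrep_of_minimal_principal_series ::
    "('g, 'e::euclidean_space) reductive_data \<Rightarrow> 'g set \<Rightarrow> ('g, 'v::complex_space) rep \<Rightarrow> bool"
  where "subrep_of_minimal_principal_series G H R \<longleftrightarrow>
    (\<exists>Q \<sigma> \<nu> U T. minimal_parabolic G H Q \<and>
       finite_dim_irreducible G (M_of G H Q) \<sigma> \<and> \<nu> \<in> aC_dual G Q \<and>
       closed_invariant H (principal_series G H Q \<sigma> \<nu>) U \<and>
       clinear_on (topspace (rspace R)) T \<and>
       homeomorphic_map (rspace R) (subtopology (rspace (principal_series G H Q \<sigma> \<nu>)) U) T \<and>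
       (\<forall>x\<in>H. \<forall>v\<in>topspace (rspace R).
          T (ract R x v) = ract (principal_series G H Q \<sigma> \<nu>) x (T v)))"

abbreviation MP :: "('g, 'e::euclidean_space) reductive_data \<Rightarrow> 'g set \<Rightarrow> 'g set"
  where "MP G P \<equiv> M_of G (carrier G) P"

text \<open>\<open>\<Xi> M \<omega>\<close> is the smooth representation fixed for the class of the irreducible unitary
  representation \<open>\<omega>\<close> of \<open>M = M\<^sub>P\<close>.\<close>

definition globalization_choice ::
    "('g, 'e::euclidean_space) reductive_data \<Rightarrow>
     ('g set \<Rightarrow> 'g unitary \<Rightarrow> ('g, 'v::complex_space) rep) \<Rightarrow> bool"
  where "globalization_choice G \<Xi> \<longleftrightarrow>
    (\<forall>P\<in>parabolics G. \<forall>\<omega>. irreducible_unitary G (MP G P) \<omega> \<longrightarrow>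
       smooth_frechet_rep G (MP G P) (\<Xi> (MP G P) \<omega>) \<and>
       admissible G (MP G P) (\<Xi> (MP G P) \<omega>) \<and>
       infinitesimally_equivalent G (MP G P) (\<Xi> (MP G P) \<omega>) (fst \<omega>) \<and>
       subrep_of_minimal_principal_series G (MP G P) (\<Xi> (MP G P) \<omega>) \<and>
       (\<forall>\<omega>'. irreducible_unitary G (MP G P) \<omega>' \<and> unitarily_equivalent (MP G P) \<omega> \<omega>' \<longrightarrow>
          \<Xi> (MP G P) \<omega>' = \<Xi> (MP G P) \<omega>))"

definition Mds ::
    "('g, 'e::euclidean_space) reductive_data \<Rightarrow> ('g set \<Rightarrow> 'g unitary \<Rightarrow> ('g, 'v::complex_space) rep) \<Rightarrow>
     'g set \<Rightarrow> ('g, 'v) rep set"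
  where "Mds G \<Xi> P = \<Xi> (MP G P) ` {\<omega>. discrete_series G (MP G P) \<omega>}"

abbreviation CK ::
    "('g, 'e::euclidean_space) reductive_data \<Rightarrow> 'g set \<Rightarrow> ('g, 'v::complex_space) rep \<Rightarrow>
     ('g \<Rightarrow> 'v) topology"
  where "CK G P \<xi> \<equiv> K_space G (carrier G) P \<xi>"


section \<open>The space \<open>\<F>\<close>\<close>

definition K_translate ::
    "('g, 'e::euclidean_space) reductive_data \<Rightarrow> 'g \<Rightarrow> ('g \<Rightarrow> 'v::complex_space) \<Rightarrow> 'g \<Rightarrow> 'v"
  where "K_translate G k \<psi> = (\<lambda>x. if x \<in> Kgrp G then \<psi> (x \<otimes>\<^bsub>G\<^esub> k) else 0)"

definition S_xi ::
    "('g, 'e::euclidean_space) reductive_data \<Rightarrow> 'g set \<Rightarrow> ('g, 'v::complex_space) rep \<Rightarrow>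
     (('g \<Rightarrow> 'v) \<Rightarrow> 'g \<Rightarrow> 'v) set"
  where "S_xi G P \<xi> = {S.
    clinear_on (topspace (CK G P \<xi>)) S \<and> continuous_map (CK G P \<xi>) (CK G P \<xi>) S \<and>
    (\<forall>\<psi>. \<psi> \<notin> topspace (CK G P \<xi>) \<longrightarrow> S \<psi> = 0) \<and>
    finite_dim {(\<lambda>\<psi>. if \<psi> \<in> topspace (CK G P \<xi>)
                     then K_translate G k1 (S (K_translate G (inv\<^bsub>G\<^esub> k2) \<psi>)) else 0) | k1 k2.
                k1 \<in> Kgrp G \<and> k2 \<in> Kgrp G}}"

definition S_P ::
    "('g, 'e::euclidean_space) reductive_data \<Rightarrow> ('g set \<Rightarrow> 'g unitary \<Rightarrow> ('g, 'v::complex_space) rep) \<Rightarrow>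
     'g set \<Rightarrow> (('g, 'v) rep \<Rightarrow> ('g \<Rightarrow> 'v) \<Rightarrow> 'g \<Rightarrow> 'v) set"
  where "S_P G \<Xi> P = {s. (\<forall>\<xi>\<in>Mds G \<Xi> P. s \<xi> \<in> S_xi G P \<xi>) \<and>
    (\<forall>\<xi>. \<xi> \<notin> Mds G \<Xi> P \<longrightarrow> s \<xi> = 0) \<and> finite {\<xi>. s \<xi> \<noteq> 0}}"

text \<open>Complex differentiability on the space \<open>S\<close> of functionals; \<open>onorm\<close> restricts to the
  operator norm on linear functionals on \<open>\<aa>\<^sub>P\<close> extended by zero.\<close>

definition holomorphic_dual :: "('e::euclidean_space \<Rightarrow> complex) set \<Rightarrow> (('e \<Rightarrow> complex) \<Rightarrow> complex) \<Rightarrow> bool"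
  where "holomorphic_dual S f \<longleftrightarrow>
    (\<forall>\<nu>\<in>S. \<exists>L. clinear_on S L \<and>
      (\<forall>\<epsilon>>0. \<exists>\<delta>>0. \<forall>\<mu>\<in>S. onorm \<mu> < \<delta> \<longrightarrow> cmod (f (\<nu> + \<mu>) - f \<nu> - L \<mu>) \<le> \<epsilon> * onorm \<mu>))"

text \<open>Elements of the algebraic tensor product of the holomorphic functions with \<open>\<S>(P)\<close>, as
  functions of the parameter.\<close>

definition F_P ::
    "('g, 'e::euclidean_space) reductive_data \<Rightarrow> ('g set \<Rightarrow> 'g unitary \<Rightarrow> ('g, 'v::complex_space) rep) \<Rightarrow>
     'g set \<Rightarrow> (('g, 'v) rep \<Rightarrow> ('e \<Rightarrow> complex) \<Rightarrow> ('g \<Rightarrow> 'v) \<Rightarrow> 'g \<Rightarrow> 'v) set"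
  where "F_P G \<Xi> P = {\<Phi>. \<exists>n f s.
    (\<forall>i<(n::nat). holomorphic_dual (aC_dual G P) (f i) \<and> s i \<in> S_P G \<Xi> P) \<and>
    \<Phi> = (\<lambda>\<xi> \<nu>. if \<nu> \<in> aC_dual G P then \<Sum>i<n. f i \<nu> *\<^sub>C s i \<xi> else 0)}"

definition F_space ::
    "('g, 'e::euclidean_space) reductive_data \<Rightarrow> ('g set \<Rightarrow> 'g unitary \<Rightarrow> ('g, 'v::complex_space) rep) \<Rightarrow>
     ('g set \<Rightarrow> ('g, 'v) rep \<Rightarrow> ('e \<Rightarrow> complex) \<Rightarrow> ('g \<Rightarrow> 'v) \<Rightarrow> 'g \<Rightarrow> 'v) set"
  where "F_space G \<Xi> = {\<phi>. (\<forall>P\<in>parabolics G. \<phi> P \<in> F_P G \<Xi> P) \<and>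
    (\<forall>P. P \<notin> parabolics G \<longrightarrow> \<phi> P = 0) \<and> finite {P. \<phi> P \<noteq> 0}}"


section \<open>Derived families and the intertwining conditions\<close>

definition line_deriv :: "'w::complex_space topology \<Rightarrow> (complex \<Rightarrow> 'w) \<Rightarrow> 'w"
  where "line_deriv W g = (THE w. limitin W (\<lambda>z. (1 / z) *\<^sub>C (g z - g 0)) w (at 0))"

text \<open>\<open>V\<^sup>(\<^sup>\<eta>\<^sup>)\<close> for a sequence of length \<open>N\<close> is realised on families indexed by boolean
  lists of length \<open>N\<close>.  The first entry of the index corresponds to the outermost doubling, that
  is, to the first element of \<open>\<eta>\<close>; it selects the first (\<open>False\<close>) or second (\<open>True\<close>) copy.\<close>

definition jet_space :: "nat \<Rightarrow> 'w::complex_space topology \<Rightarrow> (bool list \<Rightarrow> 'w) topology"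
  where "jet_space N V = direct_sum {b. length b = N} (\<lambda>_. V)"

primrec jet ::
    "'w::complex_space topology \<Rightarrow> (('e \<Rightarrow> complex) \<Rightarrow> 'w \<Rightarrow> 'w) \<Rightarrow> ('e \<Rightarrow> complex) list \<Rightarrow>
     ('e \<Rightarrow> complex) \<Rightarrow> (bool list \<Rightarrow> 'w) \<Rightarrow> bool list \<Rightarrow> 'w"
  where
    "jet V \<Phi> [] \<nu> v = (\<lambda>b. if b = [] then \<Phi> \<nu> (v []) else 0)"
  | "jet V \<Phi> (\<eta> # \<eta>s) \<nu> v =
      (let v1 = (\<lambda>b. v (False # b)); v2 = (\<lambda>b. v (True # b));
           w1 = jet V \<Phi> \<eta>s \<nu> v1 +
                line_deriv (jet_space (length \<eta>s) V) (\<lambda>z. jet V \<Phi> \<eta>s (\<nu> + z *\<^sub>C \<eta>) v2);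
           w2 = jet V \<Phi> \<eta>s \<nu> v2
       in (\<lambda>b. case b of [] \<Rightarrow> 0 | c # b' \<Rightarrow> if c then w2 b' else w1 b'))"

type_synonym ('g, 'e, 'v) datum =
  "'g set \<times> ('g, 'v) rep \<times> ('e \<Rightarrow> complex) \<times> ('e \<Rightarrow> complex) list"

definition D_data ::
    "('g, 'e::euclidean_space) reductive_data \<Rightarrow> ('g set \<Rightarrow> 'g unitary \<Rightarrow> ('g, 'v::complex_space) rep) \<Rightarrow>
     ('g, 'e, 'v) datum set"
  where "D_data G \<Xi> = {(P, \<xi>, \<nu>, \<eta>s).
    P \<in> parabolics G \<and> \<xi> \<in> Mds G \<Xi> P \<and> \<nu> \<in> aC_dual G P \<and> set \<eta>s \<subseteq> aC_dual G P}"

fun datum_space ::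
    "('g, 'e::euclidean_space) reductive_data \<Rightarrow> ('g, 'e, 'v::complex_space) datum \<Rightarrow>
     (bool list \<Rightarrow> 'g \<Rightarrow> 'v) topology"
  where "datum_space G (P, \<xi>, \<nu>, \<eta>s) = jet_space (length \<eta>s) (CK G P \<xi>)"

fun datum_act ::
    "('g, 'e::euclidean_space) reductive_data \<Rightarrow> ('g, 'e, 'v::complex_space) datum \<Rightarrow> 'g \<Rightarrow>
     (bool list \<Rightarrow> 'g \<Rightarrow> 'v) \<Rightarrow> bool list \<Rightarrow> 'g \<Rightarrow> 'v"
  where "datum_act G (P, \<xi>, \<nu>, \<eta>s) x =
    jet (CK G P \<xi>) (\<lambda>\<mu>. ps_act G (carrier G) P \<xi> \<mu> x) \<eta>s \<nu>"

fun datum_phi ::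
    "('g, 'e::euclidean_space) reductive_data \<Rightarrow>
     ('g set \<Rightarrow> ('g, 'v) rep \<Rightarrow> ('e \<Rightarrow> complex) \<Rightarrow> ('g \<Rightarrow> 'v) \<Rightarrow> 'g \<Rightarrow> 'v) \<Rightarrow>
     ('g, 'e, 'v::complex_space) datum \<Rightarrow> (bool list \<Rightarrow> 'g \<Rightarrow> 'v) \<Rightarrow> bool list \<Rightarrow> 'g \<Rightarrow> 'v"
  where "datum_phi G \<phi> (P, \<xi>, \<nu>, \<eta>s) = jet (CK G P \<xi>) (\<phi> P \<xi>) \<eta>s \<nu>"

definition pi_delta ::
    "('g, 'e::euclidean_space) reductive_data \<Rightarrow> ('g, 'e, 'v::complex_space) datum list \<Rightarrow>
     ('g, nat \<Rightarrow> bool list \<Rightarrow> 'g \<Rightarrow> 'v) rep"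
  where "pi_delta G \<delta> =
    \<lparr>rspace = direct_sum {..<length \<delta>} (\<lambda>i. datum_space G (\<delta> ! i)),
     ract = (\<lambda>x v i. if i < length \<delta> then datum_act G (\<delta> ! i) x (v i) else 0)\<rparr>"

definition phi_delta ::
    "('g, 'e::euclidean_space) reductive_data \<Rightarrow>
     ('g set \<Rightarrow> ('g, 'v) rep \<Rightarrow> ('e \<Rightarrow> complex) \<Rightarrow> ('g \<Rightarrow> 'v) \<Rightarrow> 'g \<Rightarrow> 'v) \<Rightarrow>
     ('g, 'e, 'v::complex_space) datum list \<Rightarrow>
     (nat \<Rightarrow> bool list \<Rightarrow> 'g \<Rightarrow> 'v) \<Rightarrow> nat \<Rightarrow> bool list \<Rightarrow> 'g \<Rightarrow> 'v"
  where "phi_delta G \<phi> \<delta> v = (\<lambda>i. if i < length \<delta> then datum_phi G \<phi> (\<delta> ! i) (v i) else 0)"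

text \<open>\<open>F\<close> is the endomorphism of \<open>V/U\<close> induced by the map \<open>f\<close> of \<open>V\<close>.\<close>

definition induces ::
    "'v::complex_space set \<Rightarrow> 'v set \<Rightarrow> ('v \<Rightarrow> 'v) \<Rightarrow> ('v set \<Rightarrow> 'v set) \<Rightarrow> bool"
  where "induces V U f F \<longleftrightarrow> (\<forall>v\<in>V. f v \<in> V \<and> F (coset U v) = coset U (f v))"

definition intertwines_quotients ::
    "('v::complex_space set \<Rightarrow> 'w::complex_space set) \<Rightarrow> 'v set \<Rightarrow> 'v set \<Rightarrow> 'w set \<Rightarrow> 'w set \<Rightarrow>
     ('v \<Rightarrow> 'v) \<Rightarrow> ('w \<Rightarrow> 'w) \<Rightarrow> bool"
  where "intertwines_quotients T V1 U1 V2 U2 f1 f2 \<longleftrightarrow>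
    (\<exists>F1 F2. induces V1 U1 f1 F1 \<and> induces V2 U2 f2 F2 \<and>
      (\<forall>c\<in>coset U1 ` V1. T (F1 c) = F2 (T c)))"

text \<open>Intertwining operators between the quotient representations \<open>V\<^sub>1/U\<^sub>1\<close> and \<open>V\<^sub>2/U\<^sub>2\<close>.
  The vector space operations on quotients are written out on representatives.\<close>

definition intertwining_operator ::
    "'g set \<Rightarrow> ('g, 'v::complex_space) rep \<Rightarrow> 'v set \<Rightarrow> ('g, 'w::complex_space) rep \<Rightarrow> 'w set \<Rightarrow>
     ('v set \<Rightarrow> 'w set) \<Rightarrow> bool"
  where "intertwining_operator H R1 U1 R2 U2 T \<longleftrightarrow>
    continuous_map (quotient_top (rspace R1) U1) (quotient_top (rspace R2) U2) T \<and>
    (\<forall>c. \<forall>v\<in>topspace (rspace R1). \<forall>v'\<in>topspace (rspace R1).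
     \<forall>w\<in>topspace (rspace R2). \<forall>w'\<in>topspace (rspace R2).
       T (coset U1 v) = coset U2 w \<and> T (coset U1 v') = coset U2 w' \<longrightarrow>
       T (coset U1 (v + v')) = coset U2 (w + w') \<and> T (coset U1 (c *\<^sub>C v)) = coset U2 (c *\<^sub>C w)) \<and>
    (\<forall>x\<in>H. intertwines_quotients T (topspace (rspace R1)) U1 (topspace (rspace R2)) U2
       (ract R1 x) (ract R2 x))"

definition preserves_invariant_subspaces ::
    "('g, 'e::euclidean_space) reductive_data \<Rightarrow> ('g set \<Rightarrow> 'g unitary \<Rightarrow> ('g, 'v::complex_space) rep) \<Rightarrow>
     ('g set \<Rightarrow> ('g, 'v) rep \<Rightarrow> ('e \<Rightarrow> complex) \<Rightarrow> ('g \<Rightarrow> 'v) \<Rightarrow> 'g \<Rightarrow> 'v) \<Rightarrow> bool"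
  where "preserves_invariant_subspaces G \<Xi> \<phi> \<longleftrightarrow>
    (\<forall>N\<ge>1. \<forall>\<delta>. length \<delta> = N \<and> set \<delta> \<subseteq> D_data G \<Xi> \<longrightarrow>
      (\<forall>U. closed_invariant (carrier G) (pi_delta G \<delta>) U \<longrightarrow> phi_delta G \<phi> \<delta> ` U \<subseteq> U))"

definition commutes_with_intertwiners ::
    "('g, 'e::euclidean_space) reductive_data \<Rightarrow> ('g set \<Rightarrow> 'g unitary \<Rightarrow> ('g, 'v::complex_space) rep) \<Rightarrow>
     ('g set \<Rightarrow> ('g, 'v) rep \<Rightarrow> ('e \<Rightarrow> complex) \<Rightarrow> ('g \<Rightarrow> 'v) \<Rightarrow> 'g \<Rightarrow> 'v) \<Rightarrow> bool"
  where "commutes_with_intertwiners G \<Xi> \<phi> \<longleftrightarrow>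
    (\<forall>N1\<ge>1. \<forall>N2\<ge>1. \<forall>\<delta>1 \<delta>2 U1 U2 T.
      length \<delta>1 = N1 \<and> set \<delta>1 \<subseteq> D_data G \<Xi> \<and> length \<delta>2 = N2 \<and> set \<delta>2 \<subseteq> D_data G \<Xi> \<and>
      closed_invariant (carrier G) (pi_delta G \<delta>1) U1 \<and>
      closed_invariant (carrier G) (pi_delta G \<delta>2) U2 \<and>
      intertwining_operator (carrier G) (pi_delta G \<delta>1) U1 (pi_delta G \<delta>2) U2 T \<longrightarrow>
      intertwines_quotients T
        (topspace (rspace (pi_delta G \<delta>1))) U1 (topspace (rspace (pi_delta G \<delta>2))) U2
        (phi_delta G \<phi> \<delta>1) (phi_delta G \<phi> \<delta>2))"

definition delorme_conditions ::
    "('g, 'e::euclidean_space) reductive_data \<Rightarrow> ('g set \<Rightarrow> 'g unitary \<Rightarrow> ('g, 'v::complex_space) rep) \<Rightarrow>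
     ('g set \<Rightarrow> ('g, 'v) rep \<Rightarrow> ('e \<Rightarrow> complex) \<Rightarrow> ('g \<Rightarrow> 'v) \<Rightarrow> 'g \<Rightarrow> 'v) \<Rightarrow> bool"
  where "delorme_conditions G \<Xi> \<phi> \<longleftrightarrow>
    preserves_invariant_subspaces G \<Xi> \<phi> \<and> commutes_with_intertwiners G \<Xi> \<phi>"

end

theory Submission
  imports Defs "HOL-Complex_Analysis.Cauchy_Integral_Formula"
begin

text \<open>Condition (b) for \<open>T : V\<^sub>1/U\<^sub>1 \<rightarrow> V\<^sub>2/U\<^sub>2\<close> is condition (a) for the concatenation of
  \<open>\<delta>\<^sub>1\<close> and \<open>\<delta>\<^sub>2\<close>, applied to the graph
  \<open>{(v\<^sub>1, v\<^sub>2). T [v\<^sub>1] = [v\<^sub>2]}\<close>.  The graph is invariant because \<open>T\<close> is equivariant, and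
  closed because \<open>V\<^sub>2/U\<^sub>2\<close> is Hausdorff.

  The remaining point is that \<open>\<phi>\<^sub>\<delta>\<close> is an additive map of the representation space
  into itself, so that it induces maps of the quotients.  Since \<open>\<phi>\<close> is a finite sum of holomorphic
  functions times operators, \<open>\<nu> \<mapsto> \<phi>\<^sup>(\<^sup>\<eta>\<^sup>)(\<nu>) v\<close> is a finite sum of scalar holomorphic
  functions times fixed vectors, a form which is preserved under directional differentiation.\<close>

subsection \<open>Topological vector spaces\<close>

text \<open>Definitions by description shape the proof. \<open>line_deriv\<close> is a
  \<open>THE\<close> over limits, so even the additivity of \<open>phi_delta\<close> is out of reach
  until the limits are shown to exist and to be unique. Uniqueness is why the topology of
  \<open>K_space\<close> has to be proved Hausdorff, from the separating seminorms of the Frechet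
  space of \<xi> and the compactness of K. Existence for a whole list of directions requires a class
  of scalar functions that is stable under directional derivatives: differentiability in the sense
  of \<open>holomorphic_dual\<close> is traded for \<open>gholomorphic\<close>, that is, holomorphy
  on complex lines together with bounds on finite-dimensional polydiscs, a property to which
  Cauchy's estimates apply directly and which they reproduce. The operators of
  \<open>pi_delta\<close> also contain iterated derivatives, those of the principal series. They are
  never computed: \<open>intertwining_operator\<close> asserts through \<open>induces\<close> that
  the action preserves both spaces, and the coordinatewise action for the concatenated list inherits
  this.\<close>

lemma scaleC_zero_left [simp]: "0 *\<^sub>C (x::'a::complex_space) = 0"
  by (rule cvec.scale_zero_left)

lemma scaleC_zero_right [simp]: "c *\<^sub>C (0::'a::complex_space) = 0"
  by (rule cvec.scale_zero_right)

lemma scaleC_minus1: "(-1) *\<^sub>C (x::'a::complex_space) = - x"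
  using cvec.scale_minus_left[of 1 x] by (simp add: scaleC_one)

lemma continuous_map_tvs_add:
  assumes "tvs V" "continuous_map X V f" "continuous_map X V g"
  shows "continuous_map X V (\<lambda>x. f x + g x)"
proof -
  have "continuous_map X (prod_topology V V) (\<lambda>x. (f x, g x))"
    using assms by (simp add: continuous_map_pairwise o_def)
  moreover have "continuous_map (prod_topology V V) V (\<lambda>(x, y). x + y)"
    using assms(1) by (simp add: tvs_def)
  ultimately have "continuous_map X V ((\<lambda>(x, y). x + y) \<circ> (\<lambda>x. (f x, g x)))"
    by (rule continuous_map_compose)
  then show ?thesis by (simp add: o_def)
qed

lemma continuous_map_tvs_scale:
  assumes "tvs V" "continuous_map X euclidean c" "continuous_map X V f"
  shows "continuous_map X V (\<lambda>x. c x *\<^sub>C f x)"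
proof -
  have "continuous_map X (prod_topology euclidean V) (\<lambda>x. (c x, f x))"
    using assms by (simp add: continuous_map_pairwise o_def)
  moreover have "continuous_map (prod_topology euclidean V) V (\<lambda>(c, x). c *\<^sub>C x)"
    using assms(1) by (simp add: tvs_def)
  ultimately have "continuous_map X V ((\<lambda>(c, x). c *\<^sub>C x) \<circ> (\<lambda>x. (c x, f x)))"
    by (rule continuous_map_compose)
  then show ?thesis by (simp add: o_def)
qed

lemma continuous_map_tvs_diff:
  assumes "tvs V" "continuous_map X V f" "continuous_map X V g"
  shows "continuous_map X V (\<lambda>x. f x - g x)"
proof -
  have "continuous_map X V (\<lambda>x. (-1) *\<^sub>C g x)"
    using assms by (intro continuous_map_tvs_scale) auto
  then have "continuous_map X V (\<lambda>x. f x + (-1) *\<^sub>C g x)"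
    using assms by (intro continuous_map_tvs_add)
  then show ?thesis by (simp add: scaleC_minus1)
qed

lemma tvs_subspace: "tvs V \<Longrightarrow> cvec.subspace (topspace V)"
  by (simp add: tvs_def)

lemma tvs_Hausdorff: "tvs V \<Longrightarrow> Hausdorff_space V"
  by (simp add: tvs_def)

lemma limitin_tvs_add:
  assumes "tvs V" "limitin V f a F" "limitin V g b F"
  shows "limitin V (\<lambda>x. f x + g x) (a + b) F"
proof -
  have "limitin (prod_topology V V) (\<lambda>x. (f x, g x)) (a, b) F"
    using assms by (simp add: limitin_pairwise o_def)
  moreover have "continuous_map (prod_topology V V) V (\<lambda>(x, y). x + y)"
    using assms(1) by (simp add: tvs_def)
  ultimately show ?thesis
    using continuous_map_limit by (fastforce simp: o_def)
qed

lemma limitin_tvs_scale: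
  assumes "tvs V" "(c \<longlongrightarrow> d) F" "limitin V g b F"
  shows "limitin V (\<lambda>x. c x *\<^sub>C g x) (d *\<^sub>C b) F"
proof -
  have "limitin (prod_topology euclidean V) (\<lambda>x. (c x, g x)) (d, b) F"
    using assms by (simp add: limitin_pairwise o_def)
  moreover have "continuous_map (prod_topology euclidean V) V (\<lambda>(c, x). c *\<^sub>C x)"
    using assms(1) by (simp add: tvs_def)
  ultimately show ?thesis
    using continuous_map_limit by (fastforce simp: o_def)
qed

lemma openin_translation:
  assumes V: "tvs V" and A: "openin V A" and u: "u \<in> topspace V"
  shows "openin V {x \<in> topspace V. x - u \<in> A}"
proof -
  have "continuous_map V V (\<lambda>x. x - u)"
    using u by (intro continuous_map_tvs_diff[OF V]) auto
  then show ?thesis using A by (rule openin_continuous_map_preimage)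
qed


subsection \<open>Quotients\<close>

lemma coset_self: "cvec.subspace U \<Longrightarrow> v \<in> coset U v"
  unfolding coset_def using cvec.subspace_0 by force

lemma coset_eq_iff:
  assumes U: "cvec.subspace U"
  shows "coset U v = coset U w \<longleftrightarrow> v - w \<in> U"
proof
  assume "coset U v = coset U w"
  then have "v \<in> coset U w" using coset_self[OF U] by blast
  then show "v - w \<in> U" by (auto simp: coset_def)
next
  have sub: "coset U v \<subseteq> coset U w" if vw: "v - w \<in> U" for v w
  proof
    fix x assume "x \<in> coset U v"
    then obtain u where u: "u \<in> U" "x = v + u" by (auto simp: coset_def)
    then have "x = w + ((v - w) + u)" by simp
    then show "x \<in> coset U w" unfolding coset_def using cvec.subspace_add[OF U vw u(1)] by blast
  qed
  assume vw: "v - w \<in> U"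
  then have "w - v \<in> U" using cvec.subspace_neg[OF U vw] by simp
  with vw sub show "coset U v = coset U w" by blast
qed

lemma topspace_quotient_top: "topspace (quotient_top V U) = coset U ` topspace V"
proof -
  have "{v \<in> topspace V. coset U v \<in> coset U ` topspace V} = topspace V" by auto
  then have "openin (quotient_top V U) (coset U ` topspace V)"
    by (simp add: openin_quotient_top)
  then show ?thesis
    by (metis openin_quotient_top openin_subset openin_topspace subset_antisym)
qed

lemma continuous_map_coset: "continuous_map V (quotient_top V U) (coset U)"
  unfolding continuous_map_def by (auto simp: topspace_quotient_top openin_quotient_top)

text \<open>The saturation of \<open>A\<close> is the union of its translates by elements of
  \<open>U\<close>, each of them open. This openness of the quotient map lets product neighbourhoods
  descend in \<open>Hausdorff_quotient_top\<close>.\<close>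

lemma openin_quotient_coset_image:
  assumes V: "tvs V" and U: "cvec.subspace U" "U \<subseteq> topspace V" and A: "openin V A"
  shows "openin (quotient_top V U) (coset U ` A)"
  unfolding openin_quotient_top
proof (rule conjI)
  show "coset U ` A \<subseteq> coset U ` topspace V" using openin_subset[OF A] by blast
  have "{v \<in> topspace V. coset U v \<in> coset U ` A} = (\<Union>u\<in>U. {x \<in> topspace V. x - u \<in> A})"
  proof (intro equalityI subsetI)
    fix v assume "v \<in> {v \<in> topspace V. coset U v \<in> coset U ` A}"
    then obtain a where "v \<in> topspace V" "a \<in> A" "v - a \<in> U" by (auto simp: coset_eq_iff[OF U(1)])
    then show "v \<in> (\<Union>u\<in>U. {x \<in> topspace V. x - u \<in> A})" by (auto intro!: bexI[of _ "v - a"])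
  next
    fix v assume "v \<in> (\<Union>u\<in>U. {x \<in> topspace V. x - u \<in> A})"
    then obtain u where u: "u \<in> U" "v \<in> topspace V" "v - u \<in> A" by auto
    then have "coset U v = coset U (v - u)" by (simp add: coset_eq_iff[OF U(1)])
    with u show "v \<in> {v \<in> topspace V. coset U v \<in> coset U ` A}" by blast
  qed
  then show "openin V {v \<in> topspace V. coset U v \<in> coset U ` A}"
    using openin_translation[OF V A] U(2) by (simp only:) (blast intro: openin_Union)
qed

text \<open>Distinct cosets have representatives whose difference lies in the open complement of
  \<open>U\<close>. Continuity of subtraction gives a box around the pair on which this persists,
  and the open quotient map carries the two sides of the box to disjoint open sets.\<close>

lemma Hausdorff_quotient_top:
  assumes V: "tvs V" and U: "cvec.subspace U" "closedin V U"
  shows "Hausdorff_space (quotient_top V U)"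
  unfolding Hausdorff_space_def
proof (intro allI impI)
  fix a b assume "a \<in> topspace (quotient_top V U) \<and> b \<in> topspace (quotient_top V U) \<and> a \<noteq> b"
  then obtain v w where vw: "v \<in> topspace V" "w \<in> topspace V" "a = coset U v" "b = coset U w"
      "a \<noteq> b"
    by (auto simp: topspace_quotient_top)
  then have vw': "v - w \<notin> U" by (simp add: coset_eq_iff[OF U(1)])
  have UV: "U \<subseteq> topspace V" using U(2) by (rule closedin_subset)
  have "continuous_map (prod_topology V V) V (\<lambda>p. fst p - snd p)"
    by (intro continuous_map_tvs_diff[OF V] continuous_map_fst continuous_map_snd)
  moreover have "openin V (topspace V - U)" using U(2) by blast
  ultimately have op: "openin (prod_topology V V)
      {p \<in> topspace (prod_topology V V). fst p - snd p \<in> topspace V - U}"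
    by (rule openin_continuous_map_preimage)
  define D where "D = {p \<in> topspace (prod_topology V V). fst p - snd p \<in> topspace V - U}"
  have "openin (prod_topology V V) D"
    unfolding D_def by (rule op)
  moreover have "(v, w) \<in> D"
    using vw vw' cvec.subspace_diff[OF tvs_subspace[OF V]] by (auto simp: D_def)
  ultimately obtain A B where AB: "openin V A" "openin V B" "v \<in> A" "w \<in> B" "A \<times> B \<subseteq> D"
    using openin_prod_topology_alt by metis
  have "a' - b' \<notin> U" if "a' \<in> A" "b' \<in> B" for a' b'
    using AB(5) that by (auto simp: D_def)
  then have "disjnt (coset U ` A) (coset U ` B)"
    by (auto simp: disjnt_def coset_eq_iff[OF U(1)])
  then show "\<exists>A B. openin (quotient_top V U) A \<and> openin (quotient_top V U) B \<and>
      a \<in> A \<and> b \<in> B \<and> disjnt A B"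
    using openin_quotient_coset_image[OF V U(1) UV] AB vw by blast
qed

text \<open>By additivity, replacing a representative changes \<open>f\<close> by a value of
  \<open>f\<close> on \<open>U\<close>, hence by an element of \<open>U\<close>.\<close>

lemma induces_exists:
  assumes U: "cvec.subspace U" "U \<subseteq> V"
    and f: "\<And>v. v \<in> V \<Longrightarrow> f v \<in> V" "\<And>v w. v \<in> V \<Longrightarrow> w \<in> V \<Longrightarrow> f (v + w) = f v + f w"
    and fU: "f ` U \<subseteq> U"
  shows "\<exists>F. induces V U f F"
proof -
  define F where "F = (\<lambda>c. coset U (f (SOME w. w \<in> V \<and> coset U w = c)))"
  have "F (coset U v) = coset U (f v)" if v: "v \<in> V" for v
  proof -
    define w where "w = (SOME w. w \<in> V \<and> coset U w = coset U v)"
    have "w \<in> V \<and> coset U w = coset U v"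
      unfolding w_def by (rule someI[of _ v]) (use v in simp)
    then have w: "w \<in> V" "w - v \<in> U" by (auto simp: coset_eq_iff[OF U(1)])
    have "f w = f (v + (w - v))" by simp
    also have "\<dots> = f v + f (w - v)" using f(2) v w U(2) by blast
    finally have "f w - f v = f (w - v)" by simp
    then have "f w - f v \<in> U" using fU w by auto
    moreover have "F (coset U v) = coset U (f w)" by (simp only: F_def w_def)
    ultimately show ?thesis by (simp add: coset_eq_iff[OF U(1)])
  qed
  then show ?thesis unfolding induces_def using f(1) by blast
qed


subsection \<open>Direct sums\<close>

lemma topspace_direct_sum:
  "topspace (direct_sum I V) = {f. (\<forall>i\<in>I. f i \<in> topspace (V i)) \<and> (\<forall>i. i \<notin> I \<longrightarrow> f i = 0)}"
  unfolding direct_sum_def topspace_pullback_topology by (auto simp: PiE_iff)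

lemma continuous_map_direct_sum_component:
  assumes "i \<in> I" shows "continuous_map (direct_sum I V) (V i) (\<lambda>f. f i)"
proof -
  have "continuous_map (direct_sum I V) (V i) ((\<lambda>f. f i) \<circ> (\<lambda>f. restrict f I))"
    unfolding direct_sum_def
    by (rule continuous_map_pullback[OF continuous_map_product_projection[OF assms]])
  then show ?thesis using assms by (simp add: o_def)
qed

text \<open>\<open>product_topology\<close> lives on families that are \<open>undefined\<close> off
  \<open>I\<close>, \<open>direct_sum\<close> on families that vanish there, and
  \<open>restrict\<close> translates between the two. The separate condition off \<open>I\<close>
  places the values in the underlying set of the direct sum.\<close>

lemma continuous_map_direct_sumI:
  assumes "\<And>x i. x \<in> topspace X \<Longrightarrow> i \<notin> I \<Longrightarrow> f x i = 0"
    and "\<And>i. i \<in> I \<Longrightarrow> continuous_map X (V i) (\<lambda>x. f x i)"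
  shows "continuous_map X (direct_sum I V) f"
  unfolding direct_sum_def
proof (rule continuous_map_pullback')
  show "continuous_map X (product_topology V I) ((\<lambda>f. restrict f I) \<circ> f)"
    using assms(2) by (auto simp: continuous_map_componentwise)
  show "topspace X \<subseteq> f -` {f. (\<forall>i\<in>I. f i \<in> topspace (V i)) \<and> (\<forall>i. i \<notin> I \<longrightarrow> f i = 0)}"
    using assms continuous_map_image_subset_topspace by fastforce
qed

lemma tvs_direct_sum:
  assumes V: "\<And>i. i \<in> I \<Longrightarrow> tvs (V i)"
  shows "tvs (direct_sum I V)"
  unfolding tvs_def
proof (intro conjI)
  show "cvec.subspace (topspace (direct_sum I V))"
    using V tvs_subspace unfolding cvec.subspace_def topspace_direct_sum
    by (fastforce simp: scaleC_fun_def)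
  show "Hausdorff_space (direct_sum I V)"
    unfolding Hausdorff_space_def
  proof (intro allI impI)
    fix f g
    assume fg: "f \<in> topspace (direct_sum I V) \<and> g \<in> topspace (direct_sum I V) \<and> f \<noteq> g"
    \<comment> \<open>This index lies in \<open>I\<close>, since both families vanish off
      \<open>I\<close>.\<close>
    then obtain i where "f i \<noteq> g i" by auto
    with fg have i: "i \<in> I" "f i \<in> topspace (V i)" "g i \<in> topspace (V i)" "f i \<noteq> g i"
      by (auto simp: topspace_direct_sum)
    then obtain A B where AB: "openin (V i) A" "openin (V i) B" "f i \<in> A" "g i \<in> B" "disjnt A B"
      using tvs_Hausdorff[OF V[OF i(1)]] unfolding Hausdorff_space_def by blast
    have op: "openin (direct_sum I V) {h \<in> topspace (direct_sum I V). h i \<in> C}"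
      if "openin (V i) C" for C
      using continuous_map_direct_sum_component[OF i(1)] that by (rule openin_continuous_map_preimage)
    show "\<exists>A B. openin (direct_sum I V) A \<and> openin (direct_sum I V) B \<and> f \<in> A \<and> g \<in> B \<and> disjnt A B"
      using op[OF AB(1)] op[OF AB(2)] AB(3-5) fg unfolding disjnt_iff
      by (intro exI[of _ "{h \<in> topspace (direct_sum I V). h i \<in> A}"]
          exI[of _ "{h \<in> topspace (direct_sum I V). h i \<in> B}"]) auto
  qed
  let ?D = "direct_sum I V"
  show "continuous_map (prod_topology ?D ?D) ?D (\<lambda>(x, y). x + y)"
  proof (rule continuous_map_direct_sumI)
    fix i assume i: "i \<in> I"
    have "continuous_map (prod_topology ?D ?D) (V i) (\<lambda>x. fst x i + snd x i)"
      using i by (intro continuous_map_tvs_add[OF V[OF i]]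
          continuous_map_compose[OF continuous_map_fst continuous_map_direct_sum_component, unfolded o_def]
          continuous_map_compose[OF continuous_map_snd continuous_map_direct_sum_component, unfolded o_def])
    then show "continuous_map (prod_topology ?D ?D) (V i) (\<lambda>x. (case x of (x, y) \<Rightarrow> x + y) i)"
      by (simp add: case_prod_unfold)
  qed (auto simp: topspace_direct_sum)
  show "continuous_map (prod_topology euclidean ?D) ?D (\<lambda>(c, x). c *\<^sub>C x)"
  proof (rule continuous_map_direct_sumI)
    fix i assume i: "i \<in> I"
    have "continuous_map (prod_topology euclidean ?D) (V i) (\<lambda>x. fst x *\<^sub>C snd x i)"
      using i by (intro continuous_map_tvs_scale[OF V[OF i]] continuous_map_fst
          continuous_map_compose[OF continuous_map_snd continuous_map_direct_sum_component, unfolded o_def])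
    then show "continuous_map (prod_topology euclidean ?D) (V i) (\<lambda>x. (case x of (c, x) \<Rightarrow> c *\<^sub>C x) i)"
      by (simp add: case_prod_unfold scaleC_fun_def)
  qed (auto simp: topspace_direct_sum scaleC_fun_def)
qed


subsection \<open>Seminorm topologies\<close>

lemma topspace_seminorm_topology: "topspace (seminorm_topology C Ps) = C"
proof -
  have "seminorm_open C Ps C"
    unfolding seminorm_open_def by (auto intro!: exI[of _ "{}"] exI[of _ "1::real"])
  then show ?thesis
    unfolding topspace_def openin_seminorm_topology by (auto simp: seminorm_open_def)
qed

lemma seminorm_on_zero:
  assumes "seminorm_on C p" "0 \<in> C" shows "p 0 = 0"
proof -
  have "\<forall>c. \<forall>x\<in>C. p (c *\<^sub>C x) = cmod c * p x"
    using assms unfolding seminorm_on_def by blast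
  then have "p (0 *\<^sub>C 0) = cmod 0 * p 0" using assms(2) by blast
  then show ?thesis by simp
qed

lemma openin_seminorm_ball:
  assumes C: "cvec.subspace C" and Ps: "\<And>p. p \<in> Ps \<Longrightarrow> seminorm_on C p"
    and F: "finite F" "F \<subseteq> Ps" and x: "x \<in> C"
  shows "openin (seminorm_topology C Ps) {y\<in>C. \<forall>p\<in>F. p (y - x) < \<epsilon>}"
  unfolding openin_seminorm_topology seminorm_open_def
proof (intro conjI ballI)
  fix y assume y: "y \<in> {y\<in>C. \<forall>p\<in>F. p (y - x) < \<epsilon>}"
  \<comment> \<open>The least room left by the finitely many seminorms of \<open>F\<close>; the
    entry 1 keeps \<open>Min\<close> meaningful when \<open>F\<close> is empty.\<close>
  define d where "d = Min (insert 1 ((\<lambda>p. \<epsilon> - p (y - x)) ` F))"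
  have d: "0 < d" "\<And>p. p \<in> F \<Longrightarrow> d \<le> \<epsilon> - p (y - x)"
    using F y by (auto simp: d_def)
  have "p (z - x) < \<epsilon>" if "z \<in> C" "p \<in> F" "p (z - y) < d" for z p
  proof -
    have "p ((z - y) + (y - x)) \<le> p (z - y) + p (y - x)"
      using Ps[of p] F that y x cvec.subspace_diff[OF C] unfolding seminorm_on_def by blast
    then show ?thesis using d(2)[OF that(2)] that(3) by simp
  qed
  then have "{z\<in>C. \<forall>p\<in>F. p (z - y) < d} \<subseteq> {y\<in>C. \<forall>p\<in>F. p (y - x) < \<epsilon>}" by auto
  then show "\<exists>F' d. finite F' \<and> F' \<subseteq> Ps \<and> 0 < d \<and>
      {z\<in>C. \<forall>p\<in>F'. p (z - y) < d} \<subseteq> {y\<in>C. \<forall>p\<in>F. p (y - x) < \<epsilon>}"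
    using F d(1) by blast
qed auto

lemma tvs_seminorm_topology:
  assumes C: "cvec.subspace C" and Ps: "\<And>p. p \<in> Ps \<Longrightarrow> seminorm_on C p"
    and sep: "\<And>x. x \<in> C \<Longrightarrow> x \<noteq> 0 \<Longrightarrow> \<exists>p\<in>Ps. p x \<noteq> 0"
  shows "tvs (seminorm_topology C Ps)"
proof -
  let ?V = "seminorm_topology C Ps"
  have ball: "openin ?V {y\<in>C. \<forall>p\<in>F. p (y - x) < e}" if "finite F" "F \<subseteq> Ps" "x \<in> C" for F x e
    using openin_seminorm_ball[OF C _ that] Ps by blast
  have zero: "0 \<in> C" by (rule cvec.subspace_0[OF C])
  have p0: "p 0 = 0" if "p \<in> Ps" for p by (rule seminorm_on_zero[OF Ps[OF that] zero])
  have z: "\<forall>p\<in>F. p 0 < r" if "F \<subseteq> Ps" "0 < r" for F r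
  proof
    fix p assume "p \<in> F"
    then have "p 0 = 0" using p0 that(1) by blast
    then show "p 0 < r" using that(2) by (simp only:)
  qed
  have tri: "p (x + y) \<le> p x + p y" if "p \<in> Ps" "x \<in> C" "y \<in> C" for p x y
    using Ps[OF that(1)] that unfolding seminorm_on_def by blast
  have scl: "p (c *\<^sub>C x) = cmod c * p x" if "p \<in> Ps" "x \<in> C" for p c x
    using Ps[OF that(1)] that unfolding seminorm_on_def by blast
  have nn: "0 \<le> p x" if "p \<in> Ps" "x \<in> C" for p x
    using Ps[OF that(1)] that unfolding seminorm_on_def by blast
  note diff = cvec.subspace_diff[OF C] and cadd = cvec.subspace_add[OF C] and csc = cvec.subspace_scale[OF C]
  show ?thesis
    unfolding tvs_def
  proof (intro conjI)
    show "cvec.subspace (topspace ?V)" by (simp add: topspace_seminorm_topology C)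
    show "Hausdorff_space ?V"
      unfolding Hausdorff_space_def
    proof (intro allI impI)
      fix x y assume "x \<in> topspace ?V \<and> y \<in> topspace ?V \<and> x \<noteq> y"
      then have xy: "x \<in> C" "y \<in> C" "x - y \<noteq> 0" by (auto simp: topspace_seminorm_topology)
      then obtain p where p: "p \<in> Ps" "p (x - y) \<noteq> 0" using sep diff by blast
      \<comment> \<open>Half of the distance measured by a separating seminorm: a common point of
        the two balls would violate the triangle inequality.\<close>
      define e where "e = p (x - y) / 2"
      have e: "0 < e" using nn[OF p(1) diff[OF xy(1,2)]] p(2) by (simp add: e_def)
      have "\<not> p (z - y) < e" if "z \<in> C" "p (z - x) < e" for z
      proof
        assume "p (z - y) < e"
        have "p (x - z) = p (z - x)"
          using scl[OF p(1) diff[OF that(1) xy(1)], of "-1"] by (simp add: scaleC_minus1)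
        moreover have "p ((x - z) + (z - y)) \<le> p (x - z) + p (z - y)"
          using tri[OF p(1)] diff xy that by blast
        ultimately show False using \<open>p (z - y) < e\<close> that(2) by (simp add: e_def)
      qed
      then have "disjnt {z\<in>C. \<forall>p\<in>{p}. p (z - x) < e} {z\<in>C. \<forall>p\<in>{p}. p (z - y) < e}"
        by (auto simp: disjnt_iff)
      moreover have "x \<in> {z\<in>C. \<forall>p\<in>{p}. p (z - x) < e}" "y \<in> {z\<in>C. \<forall>p\<in>{p}. p (z - y) < e}"
        using xy e p0[OF p(1)] by auto
      moreover have "openin ?V {z\<in>C. \<forall>p\<in>{p}. p (z - x) < e}" "openin ?V {z\<in>C. \<forall>p\<in>{p}. p (z - y) < e}"
        using p xy by (intro ball; simp)+
      ultimately show "\<exists>A B. openin ?V A \<and> openin ?V B \<and> x \<in> A \<and> y \<in> B \<and> disjnt A B"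
        by blast
    qed
    show "continuous_map (prod_topology ?V ?V) ?V (\<lambda>(x, y). x + y)"
      unfolding continuous_map_def
    proof (intro conjI allI impI)
      show "(\<lambda>(x, y). x + y) \<in> topspace (prod_topology ?V ?V) \<rightarrow> topspace ?V"
        using cadd by (auto simp: topspace_seminorm_topology)
      fix A assume A: "openin ?V A"
      show "openin (prod_topology ?V ?V)
          {z \<in> topspace (prod_topology ?V ?V). (case z of (x, y) \<Rightarrow> x + y) \<in> A}"
        unfolding openin_prod_topology_alt
      proof (intro allI impI)
        fix x y
        assume "(x, y) \<in> {z \<in> topspace (prod_topology ?V ?V). (case z of (x, y) \<Rightarrow> x + y) \<in> A}"
        then have xy: "x \<in> C" "y \<in> C" "x + y \<in> A" by (auto simp: topspace_seminorm_topology)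
        then obtain F e where F: "finite F" "F \<subseteq> Ps" "0 < e" "{z\<in>C. \<forall>p\<in>F. p (z - (x + y)) < e} \<subseteq> A"
          using A unfolding openin_seminorm_topology seminorm_open_def by blast
        let ?A = "\<lambda>x. {z\<in>C. \<forall>p\<in>F. p (z - x) < e / 2}"
        have "x' + y' \<in> A" if "x' \<in> ?A x" "y' \<in> ?A y" for x' y'
        proof -
          have "p ((x' + y') - (x + y)) < e" if p: "p \<in> F" for p
          proof -
            have "p ((x' - x) + (y' - y)) \<le> p (x' - x) + p (y' - y)"
              using tri diff xy \<open>x' \<in> ?A x\<close> \<open>y' \<in> ?A y\<close> F p by blast
            moreover have "p (x' - x) < e / 2" "p (y' - y) < e / 2"
              using \<open>x' \<in> ?A x\<close> \<open>y' \<in> ?A y\<close> p by auto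
            ultimately show ?thesis by (simp add: algebra_simps)
          qed
          then show ?thesis using F(4) that cadd by blast
        qed
        moreover have "openin ?V (?A x)" "openin ?V (?A y)" by (intro ball F xy)+
        moreover have "x \<in> ?A x" "y \<in> ?A y" using xy F(3) z[OF F(2), of "e / 2"] by auto
        ultimately show "\<exists>U W. openin ?V U \<and> openin ?V W \<and> x \<in> U \<and> y \<in> W \<and> U \<times> W \<subseteq>
            {z \<in> topspace (prod_topology ?V ?V). (case z of (x, y) \<Rightarrow> x + y) \<in> A}"
          by (intro exI[of _ "?A x"] exI[of _ "?A y"]) (auto simp: topspace_seminorm_topology)
      qed
    qed
    show "continuous_map (prod_topology euclidean ?V) ?V (\<lambda>(c, x). c *\<^sub>C x)"
      unfolding continuous_map_def
    proof (intro conjI allI impI)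
      show "(\<lambda>(c, x). c *\<^sub>C x) \<in> topspace (prod_topology euclidean ?V) \<rightarrow> topspace ?V"
        using csc by (auto simp: topspace_seminorm_topology)
      fix A assume A: "openin ?V A"
      show "openin (prod_topology euclidean ?V)
          {z \<in> topspace (prod_topology euclidean ?V). (case z of (c, x) \<Rightarrow> c *\<^sub>C x) \<in> A}"
        unfolding openin_prod_topology_alt
      proof (intro allI impI)
        fix c x
        assume "(c, x) \<in> {z \<in> topspace (prod_topology euclidean ?V). (case z of (c, x) \<Rightarrow> c *\<^sub>C x) \<in> A}"
        then have x: "x \<in> C" "c *\<^sub>C x \<in> A" by (auto simp: topspace_seminorm_topology)
        then obtain F e where F: "finite F" "F \<subseteq> Ps" "0 < e" "{z\<in>C. \<forall>p\<in>F. p (z - c *\<^sub>C x) < e} \<subseteq> A"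
          using A unfolding openin_seminorm_topology seminorm_open_def by blast
        \<comment> \<open>Constants for the splitting
          \<open>c' x' - c x = c' (x' - x) + (c' - c) x\<close>: \<open>d\<close> and
          \<open>r\<close> make each term at most \<open>e / 2\<close>, the first one strictly
          smaller. As \<open>r \<le> 1\<close>, \<open>k\<close> bounds \<open>cmod c'\<close>;
          \<open>m = M + 1\<close> avoids a division by zero.\<close>
        define M where "M = Max (insert 0 ((\<lambda>p. p x) ` F))"
        have M: "0 \<le> M" "\<And>p. p \<in> F \<Longrightarrow> p x \<le> M" using F by (auto simp: M_def)
        obtain k where k: "0 < k" "k = cmod c + 1" using norm_ge_zero[of c] by auto
        define d where "d = e / (2 * k)"
        obtain m where m: "0 < m" "m = M + 1" using M(1) by auto
        define r where "r = min 1 (e / (2 * m))"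
        have d: "0 < d" using F(3) k(1) by (simp add: d_def)
        have r: "0 < r" "r \<le> 1" "r \<le> e / (2 * m)" using F(3) m(1) by (auto simp: r_def)
        let ?A = "{z\<in>C. \<forall>p\<in>F. p (z - x) < d}"
        have "c' *\<^sub>C x' \<in> A" if c': "c' \<in> ball c r" and x': "x' \<in> ?A" for c' x'
        proof -
          have cc: "cmod (c' - c) < r" using c' by (simp add: dist_norm norm_minus_commute)
          have cn: "cmod c' \<le> k" using cc r(2) k(2) norm_triangle_sub[of c' c] by linarith
          have xx: "x' - x \<in> C" using x' diff x(1) by blast
          have "p (c' *\<^sub>C x' - c *\<^sub>C x) < e" if p: "p \<in> F" for p
          proof -
            have pP: "p \<in> Ps" and xd: "p (x' - x) < d" using p F(2) x' by auto
            have "c' *\<^sub>C x' - c *\<^sub>C x = c' *\<^sub>C (x' - x) + (c' - c) *\<^sub>C x"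
              by (simp add: cvec.scale_right_diff_distrib cvec.scale_left_diff_distrib)
            then have "p (c' *\<^sub>C x' - c *\<^sub>C x) \<le> p (c' *\<^sub>C (x' - x)) + p ((c' - c) *\<^sub>C x)"
              using tri[OF pP csc[OF xx] csc[OF x(1)]] by simp
            moreover have "p (c' *\<^sub>C (x' - x)) \<le> k * p (x' - x)"
              unfolding scl[OF pP xx] by (rule mult_right_mono[OF cn nn[OF pP xx]])
            moreover have "k * p (x' - x) < k * d"
              by (rule mult_strict_left_mono[OF xd k(1)])
            moreover have "k * d = e / 2" using k(1) by (simp add: d_def)
            moreover have "p ((c' - c) *\<^sub>C x) \<le> r * M"
              unfolding scl[OF pP x(1)]
              by (rule mult_mono[OF less_imp_le[OF cc] M(2)[OF p] less_imp_le[OF r(1)] nn[OF pP x(1)]])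
            moreover have "r * M \<le> e / (2 * m) * m"
              by (rule mult_mono) (use r(1,3) M(1) m in linarith)+
            moreover have "e / (2 * m) * m = e / 2" using m(1) by simp
            ultimately show ?thesis by linarith
          qed
          moreover have "c' *\<^sub>C x' \<in> C" using csc x' by blast
          ultimately show ?thesis using F(4) by blast
        qed
        moreover have "openin ?V ?A" by (intro ball F x)
        moreover have "x \<in> ?A" using x z[OF F(2) d] by auto
        ultimately show "\<exists>U W. openin euclidean U \<and> openin ?V W \<and> c \<in> U \<and> x \<in> W \<and> U \<times> W \<subseteq>
            {z \<in> topspace (prod_topology euclidean ?V). (case z of (c, x) \<Rightarrow> c *\<^sub>C x) \<in> A}"
          using r(1) by (intro exI[of _ "ball c r"] exI[of _ ?A]) (auto simp: topspace_seminorm_topology)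
      qed
    qed
  qed
qed

lemma continuous_map_seminorm:
  assumes C: "cvec.subspace C" and Ps: "\<And>p. p \<in> Ps \<Longrightarrow> seminorm_on C p" and p: "p \<in> Ps"
  shows "continuous_map (seminorm_topology C Ps) euclideanreal p"
  unfolding continuous_map_def
proof (intro conjI allI impI)
  show "p \<in> topspace (seminorm_topology C Ps) \<rightarrow> topspace euclideanreal" by auto
  fix A :: "real set" assume A: "openin euclideanreal A"
  note sn = Ps[OF p, unfolded seminorm_on_def]
  note diff = cvec.subspace_diff[OF C]
  show "openin (seminorm_topology C Ps) {x \<in> topspace (seminorm_topology C Ps). p x \<in> A}"
    unfolding openin_seminorm_topology seminorm_open_def
  proof (intro conjI ballI)
    fix x assume "x \<in> {x \<in> topspace (seminorm_topology C Ps). p x \<in> A}"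
    then have x: "x \<in> C" "p x \<in> A" by (auto simp: topspace_seminorm_topology)
    then obtain e where e: "0 < e" "ball (p x) e \<subseteq> A"
      using A by (auto simp: open_contains_ball)
    have "p y \<in> A" if "y \<in> C" "p (y - x) < e" for y
    proof -
      have "p (x + (y - x)) \<le> p x + p (y - x)" "p (y + (x - y)) \<le> p y + p (x - y)"
        using sn diff x that by blast+
      moreover have "p ((-1) *\<^sub>C (y - x)) = cmod (-1) * p (y - x)" using sn diff x that by blast
      ultimately have "\<bar>p x - p y\<bar> < e" using that by (simp add: scaleC_minus1)
      then show ?thesis using e(2) by (auto simp: dist_real_def)
    qed
    then show "\<exists>F \<epsilon>. finite F \<and> F \<subseteq> Ps \<and> 0 < \<epsilon> \<and> {y\<in>C. \<forall>p\<in>F. p (y - x) < \<epsilon>}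
        \<subseteq> {x \<in> topspace (seminorm_topology C Ps). p x \<in> A}"
      using p e by (intro exI[of _ "{p}"] exI[of _ e]) (auto simp: topspace_seminorm_topology)
  qed (auto simp: topspace_seminorm_topology)
qed


subsection \<open>Holomorphic functions on complex vector spaces\<close>

text \<open>Gateaux holomorphy on \<open>S\<close>, joined with a bound on every polydisc with
  finitely many directions from \<open>S\<close>. The bound covers several directions at once
  because difference quotients along \<open>\<eta>\<close> must converge uniformly while the base
  point moves along another line.\<close>

definition gholomorphic :: "'w::complex_space set \<Rightarrow> ('w \<Rightarrow> complex) \<Rightarrow> bool"
  where "gholomorphic S f \<longleftrightarrow>
    (\<forall>\<nu>\<in>S. \<forall>\<eta>\<in>S. (\<lambda>z. f (\<nu> + z *\<^sub>C \<eta>)) holomorphic_on UNIV) \<and>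
    (\<forall>\<nu>\<in>S. \<forall>B R. finite B \<and> B \<subseteq> S \<longrightarrow>
      (\<exists>M. \<forall>c. (\<forall>b\<in>B. cmod (c b) \<le> R) \<longrightarrow> cmod (f (\<nu> + (\<Sum>b\<in>B. c b *\<^sub>C b))) \<le> M))"

definition dir_deriv :: "('w::complex_space \<Rightarrow> complex) \<Rightarrow> 'w \<Rightarrow> 'w \<Rightarrow> complex"
  where "dir_deriv f \<eta> \<nu> = deriv (\<lambda>z. f (\<nu> + z *\<^sub>C \<eta>)) 0"

lemma gholomorphic_line: "gholomorphic S f \<Longrightarrow> \<nu> \<in> S \<Longrightarrow> \<eta> \<in> S \<Longrightarrow>
    (\<lambda>z. f (\<nu> + z *\<^sub>C \<eta>)) holomorphic_on UNIV"
  unfolding gholomorphic_def by blast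

lemma gholomorphic_bounded:
  assumes "gholomorphic S f" "\<nu> \<in> S" "finite B" "B \<subseteq> S"
  obtains M where "\<And>c. (\<And>b. b \<in> B \<Longrightarrow> cmod (c b) \<le> R) \<Longrightarrow> cmod (f (\<nu> + (\<Sum>b\<in>B. c b *\<^sub>C b))) \<le> M"
  using assms unfolding gholomorphic_def by meson

text \<open>Reserves one further direction, in which Cauchy's estimate is applied while the others
  range over their polydisc.\<close>

lemma gholomorphic_bounded_insert:
  assumes f: "gholomorphic S f" "\<nu> \<in> S" "finite B" "B \<subseteq> S" "\<eta> \<in> S"
  obtains M where "\<And>c z. (\<And>b. b \<in> B \<Longrightarrow> cmod (c b) \<le> R) \<Longrightarrow> cmod z \<le> r \<Longrightarrow>
    cmod (f (\<nu> + (\<Sum>b\<in>B. c b *\<^sub>C b) + z *\<^sub>C \<eta>)) \<le> M"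
proof -
  obtain M where M: "\<And>c. (\<And>b. b \<in> insert \<eta> B \<Longrightarrow> cmod (c b) \<le> \<bar>R\<bar> + \<bar>r\<bar>) \<Longrightarrow>
      cmod (f (\<nu> + (\<Sum>b\<in>insert \<eta> B. c b *\<^sub>C b))) \<le> M"
    by (rule gholomorphic_bounded[OF f(1,2), of "insert \<eta> B" "\<bar>R\<bar> + \<bar>r\<bar>"]) (use f(3-5) in auto)
  have "cmod (f (\<nu> + (\<Sum>b\<in>B. c b *\<^sub>C b) + z *\<^sub>C \<eta>)) \<le> M"
    if c: "\<And>b. b \<in> B \<Longrightarrow> cmod (c b) \<le> R" and z: "cmod z \<le> r" for c z
  proof -
    \<comment> \<open>The direction \<open>\<eta>\<close> may already belong to \<open>B\<close>, so
      the coefficients are added there. The radius is \<open>\<bar>R\<bar> + \<bar>r\<bar>\<close>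
      since \<open>R\<close> and \<open>r\<close> may be negative.\<close>
    define c' where "c' = (\<lambda>b. (if b \<in> B then c b else 0) + (if b = \<eta> then z else 0))"
    have "(\<Sum>b\<in>insert \<eta> B. c' b *\<^sub>C b) =
        (\<Sum>b\<in>insert \<eta> B. (if b \<in> B then c b else 0) *\<^sub>C b) + (\<Sum>b\<in>insert \<eta> B. (if b = \<eta> then z else 0) *\<^sub>C b)"
      by (simp only: c'_def scaleC_add_left sum.distrib)
    also have "(\<Sum>b\<in>insert \<eta> B. (if b \<in> B then c b else 0) *\<^sub>C b) = (\<Sum>b\<in>B. c b *\<^sub>C b)"
      using f(3) by (intro sum.mono_neutral_cong_right) auto
    also have "(\<Sum>b\<in>insert \<eta> B. (if b = \<eta> then z else 0) *\<^sub>C b) = (\<Sum>b\<in>{\<eta>}. z *\<^sub>C b)"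
      using f(3) by (intro sum.mono_neutral_cong_right) auto
    finally have eq: "(\<Sum>b\<in>insert \<eta> B. c' b *\<^sub>C b) = (\<Sum>b\<in>B. c b *\<^sub>C b) + z *\<^sub>C \<eta>" by simp
    have "cmod (c' b) \<le> \<bar>R\<bar> + \<bar>r\<bar>" for b
    proof -
      have "cmod (if b \<in> B then c b else 0) \<le> \<bar>R\<bar>" using c[of b] by auto
      moreover have "cmod (if b = \<eta> then z else 0) \<le> \<bar>r\<bar>" using z by auto
      ultimately show ?thesis unfolding c'_def using norm_triangle_ineq add_mono order_trans by blast
    qed
    then have "cmod (f (\<nu> + (\<Sum>b\<in>insert \<eta> B. c' b *\<^sub>C b))) \<le> M" by (intro M)
    then show ?thesis by (simp only: eq add.assoc)
  qed
  then show thesis by (rule that)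
qed

text \<open>The error is the first-order Taylor remainder divided by \<open>t\<close>. Unit circles
  around points of the unit disc stay inside the disc of radius 2, so Cauchy's inequality bounds the
  second derivative by \<open>fact 2 * M\<close>, which is the constant
  \<open>2 * M\<close>.\<close>

lemma difference_quotient_bound:
  assumes h: "h holomorphic_on UNIV" and M: "\<And>z. cmod z \<le> 2 \<Longrightarrow> cmod (h z) \<le> M"
    and t: "0 < cmod t" "cmod t \<le> 1"
  shows "cmod ((h t - h 0) / t - deriv h 0) \<le> 2 * M * cmod t"
proof -
  have hol: "h holomorphic_on A" for A using h by (rule holomorphic_on_subset) simp
  have bound: "cmod ((deriv ^^ 2) h z) \<le> 2 * M" if z: "z \<in> cball 0 1" for z
  proof -
    have "cmod ((deriv ^^ 2) h z) \<le> fact 2 * M / 1 ^ 2"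
    proof (rule Cauchy_inequality)
      fix x assume "cmod (z - x) = 1"
      then have "cmod x \<le> 2" using z norm_triangle_sub[of x z] by (simp add: norm_minus_commute)
      then show "cmod (h x) \<le> M" by (rule M)
    qed (auto intro: hol holomorphic_on_imp_continuous_on)
    then show ?thesis by (simp add: fact_numeral)
  qed
  have "cmod ((deriv ^^ 0) h t - (\<Sum>i\<le>1. (deriv ^^ i) h 0 * (t - 0) ^ i / fact i))
      \<le> 2 * M * cmod (t - 0) ^ Suc 1 / fact 1"
  proof (rule complex_Taylor[where S = "cball 0 1" and f = "\<lambda>i. (deriv ^^ i) h"])
    fix i x
    have "(deriv ^^ i) h holomorphic_on UNIV" by (rule holomorphic_higher_deriv[OF h]) simp
    then show "((deriv ^^ i) h has_field_derivative (deriv ^^ Suc i) h x) (at x within cball 0 1)"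
      using holomorphic_derivI[of _ UNIV x] by (simp add: has_field_derivative_at_within)
  next
    fix x :: complex assume "x \<in> cball 0 1"
    then show "cmod ((deriv ^^ Suc 1) h x) \<le> 2 * M" using bound[of x] by (simp add: numeral_2_eq_2)
  qed (use t in auto)
  then have "cmod (h t - h 0 - deriv h 0 * t) \<le> 2 * M * cmod t ^ 2"
    by (simp add: power2_eq_square algebra_simps)
  moreover have "(h t - h 0) / t - deriv h 0 = (h t - h 0 - deriv h 0 * t) / t"
    using t by (simp add: field_simps)
  ultimately show ?thesis
    using t by (simp add: norm_divide divide_le_eq power2_eq_square mult.assoc)
qed

text \<open>Difference quotients converge locally uniformly by Cauchy's estimates, so no joint continuity
  is needed: boundedness on finite-dimensional polydiscs is enough.\<close>

lemma gholomorphic_dir_deriv: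
  assumes S: "cvec.subspace S" and f: "gholomorphic S f" and \<eta>: "\<eta> \<in> S"
  shows "gholomorphic S (dir_deriv f \<eta>)"
  unfolding gholomorphic_def
proof (intro conjI ballI allI impI)
  note add = cvec.subspace_add[OF S] and sc = cvec.subspace_scale[OF S]
  fix \<nu> \<mu> assume \<nu>: "\<nu> \<in> S" and \<mu>: "\<mu> \<in> S"
  define t where "t = (\<lambda>n. complex_of_real (inverse (real (Suc n))))"
  have t: "0 < cmod (t n)" "cmod (t n) \<le> 1" "cmod (t n) = inverse (real (Suc n))" for n
    unfolding t_def norm_of_real by (auto simp: inverse_le_1_iff)
  \<comment> \<open>\<open>w\<close> runs along the line on which holomorphy is claimed,
    \<open>t n\<close> along the direction of differentiation; for fixed \<open>n\<close> the
    quotient is holomorphic in \<open>w\<close>.\<close>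
  define q where "q = (\<lambda>n w. (f ((\<nu> + t n *\<^sub>C \<eta>) + w *\<^sub>C \<mu>) - f (\<nu> + w *\<^sub>C \<mu>)) / t n)"
  show "(\<lambda>w. dir_deriv f \<eta> (\<nu> + w *\<^sub>C \<mu>)) holomorphic_on UNIV"
  proof (rule holomorphic_uniform_sequence[where f = q])
    fix n
    have "\<nu> + t n *\<^sub>C \<eta> \<in> S" using add sc \<nu> \<eta> by blast
    then show "q n holomorphic_on UNIV"
      unfolding q_def using t(1)[of n]
      by (intro holomorphic_intros gholomorphic_line[OF f] \<nu> \<mu>) auto
  next
    fix x :: complex
    \<comment> \<open>The radius \<open>cmod x + 1\<close> covers \<open>cball x 1\<close>, and 2 is
      the radius required by \<open>difference_quotient_bound\<close>. \<open>M\<close> is the same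
      for all these \<open>w\<close>, which makes the convergence uniform.\<close>
    obtain M where M: "\<And>c z. (\<And>b. b \<in> {\<mu>} \<Longrightarrow> cmod (c b) \<le> cmod x + 1) \<Longrightarrow> cmod z \<le> 2 \<Longrightarrow>
        cmod (f (\<nu> + (\<Sum>b\<in>{\<mu>}. c b *\<^sub>C b) + z *\<^sub>C \<eta>)) \<le> M"
      by (rule gholomorphic_bounded_insert[OF f \<nu> _ _ \<eta>, of "{\<mu>}" "cmod x + 1" 2]) (use \<mu> in auto)
    have *: "cmod (q n w - dir_deriv f \<eta> (\<nu> + w *\<^sub>C \<mu>)) \<le> 2 * M * inverse (real (Suc n))"
      if w: "w \<in> cball x 1" for n w
    proof -
      have w': "cmod w \<le> cmod x + 1"
        using w norm_triangle_sub[of w x] by (simp add: dist_norm norm_minus_commute)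
      define h where "h = (\<lambda>z. f ((\<nu> + w *\<^sub>C \<mu>) + z *\<^sub>C \<eta>))"
      have "h holomorphic_on UNIV"
        unfolding h_def using add sc \<nu> \<mu> by (intro gholomorphic_line[OF f _ \<eta>]) blast
      moreover have "cmod (h z) \<le> M" if "cmod z \<le> 2" for z
        using M[of "\<lambda>_. w" z] w' that by (simp add: h_def)
      ultimately have "cmod ((h (t n) - h 0) / t n - deriv h 0) \<le> 2 * M * cmod (t n)"
        using t(1,2)[of n] by (rule difference_quotient_bound)
      moreover have "(h (t n) - h 0) / t n = q n w"
        by (simp add: h_def q_def add_ac)
      ultimately show ?thesis by (simp add: t(3) dir_deriv_def h_def)
    qed
    have lim: "(\<lambda>n. 2 * M * inverse (real (Suc n))) \<longlonglongrightarrow> 0"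
      using tendsto_mult_right_zero[OF LIMSEQ_inverse_real_of_nat] by blast
    have "uniform_limit (cball x 1) q (\<lambda>w. dir_deriv f \<eta> (\<nu> + w *\<^sub>C \<mu>)) sequentially"
    proof (rule uniform_limitI)
      fix e :: real assume "0 < e"
      then have "\<forall>\<^sub>F n in sequentially. 2 * M * inverse (real (Suc n)) < e"
        using lim order_tendstoD(2) by blast
      then show "\<forall>\<^sub>F n in sequentially. \<forall>w\<in>cball x 1. dist (q n w) (dir_deriv f \<eta> (\<nu> + w *\<^sub>C \<mu>)) < e"
        by eventually_elim (auto simp: dist_norm intro: le_less_trans[OF *])
    qed
    then show "\<exists>d. 0 < d \<and> cball x d \<subseteq> UNIV \<and>
        uniform_limit (cball x d) q (\<lambda>w. dir_deriv f \<eta> (\<nu> + w *\<^sub>C \<mu>)) sequentially"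
      by (intro exI[of _ 1]) auto
  qed simp
next
  note add = cvec.subspace_add[OF S] and sc = cvec.subspace_scale[OF S]
  fix \<nu> and B :: "'a set" and R :: real
  assume \<nu>: "\<nu> \<in> S" and B: "finite B \<and> B \<subseteq> S"
  obtain M where M: "\<And>c z. (\<And>b. b \<in> B \<Longrightarrow> cmod (c b) \<le> R) \<Longrightarrow> cmod z \<le> 1 \<Longrightarrow>
      cmod (f (\<nu> + (\<Sum>b\<in>B. c b *\<^sub>C b) + z *\<^sub>C \<eta>)) \<le> M"
    by (rule gholomorphic_bounded_insert[OF f \<nu> _ _ \<eta>, of B R 1]) (use B in auto)
  have "cmod (dir_deriv f \<eta> (\<nu> + (\<Sum>b\<in>B. c b *\<^sub>C b))) \<le> M" if c: "\<forall>b\<in>B. cmod (c b) \<le> R" for c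
  proof -
    define h where "h = (\<lambda>z. f ((\<nu> + (\<Sum>b\<in>B. c b *\<^sub>C b)) + z *\<^sub>C \<eta>))"
    have "(\<Sum>b\<in>B. c b *\<^sub>C b) \<in> S" using B sc by (intro cvec.subspace_sum[OF S]) auto
    then have "h holomorphic_on UNIV"
      unfolding h_def using add \<nu> by (intro gholomorphic_line[OF f _ \<eta>]) blast
    then have hol: "h holomorphic_on A" for A by (rule holomorphic_on_subset) simp
    \<comment> \<open>Cauchy's estimate on the unit circle in the direction \<open>\<eta>\<close>
      hands the bound of \<open>f\<close> on to its derivative; hence the radius 1 in the choice of
      \<open>M\<close>.\<close>
    have "cmod ((deriv ^^ 1) h 0) \<le> fact 1 * M / 1 ^ 1"
    proof (rule Cauchy_inequality)
      fix x assume "cmod (0 - x) = 1"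
      then show "cmod (h x) \<le> M" using M[of c x] c by (simp add: h_def)
    qed (auto intro: hol holomorphic_on_imp_continuous_on)
    then show ?thesis by (simp add: dir_deriv_def h_def)
  qed
  then show "\<exists>M. \<forall>c. (\<forall>b\<in>B. cmod (c b) \<le> R) \<longrightarrow>
      cmod (dir_deriv f \<eta> (\<nu> + (\<Sum>b\<in>B. c b *\<^sub>C b))) \<le> M"
    by blast
qed

lemma dir_deriv_limit:
  assumes "gholomorphic S f" "\<nu> \<in> S" "\<eta> \<in> S"
  shows "((\<lambda>z. (f (\<nu> + z *\<^sub>C \<eta>) - f \<nu>) / z) \<longlongrightarrow> dir_deriv f \<eta> \<nu>) (at 0)"
proof -
  have "((\<lambda>z. f (\<nu> + z *\<^sub>C \<eta>)) has_field_derivative dir_deriv f \<eta> \<nu>) (at 0)"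
    unfolding dir_deriv_def by (rule holomorphic_derivI[OF gholomorphic_line[OF assms]]) auto
  then show ?thesis by (simp add: DERIV_def)
qed


subsection \<open>The complexified dual\<close>

lemma aC_dual_subspace: "cvec.subspace (aC_dual G P)"
  unfolding cvec.subspace_def aC_dual_def
  by (auto simp: scaleC_fun_def scaleC_complex_def algebra_simps)

text \<open>Since \<open>a_of G P\<close> is not known to be a subspace, linearity of \<open>\<nu>\<close> is extracted from its
  support: among three vectors with non-zero values, two have values with non-zero sum, hence
  their sum is in the support again.\<close>

lemma aC_dual_sum:
  assumes \<nu>: "\<nu> \<in> aC_dual G P" and "\<And>i. i < (n::nat) \<Longrightarrow> \<nu> (x i) \<noteq> 0"
  shows "\<nu> (\<Sum>i<n. x i) = (\<Sum>i<n. \<nu> (x i))"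
proof -
  have add: "\<nu> (X + Y) = \<nu> X + \<nu> Y" if "\<nu> X \<noteq> 0" "\<nu> Y \<noteq> 0" for X Y
    using \<nu> that unfolding aC_dual_def by blast
  have "\<nu> (0 *\<^sub>R 0) = of_real 0 * \<nu> 0" if "0 \<in> a_of G P"
    using \<nu> that unfolding aC_dual_def by blast
  moreover have "\<nu> 0 = 0" if "0 \<notin> a_of G P"
    using \<nu> that unfolding aC_dual_def by blast
  ultimately have zero: "\<nu> 0 = 0" by fastforce
  have "\<nu> (sum_list xs) = sum_list (map \<nu> xs)" if "\<forall>x\<in>set xs. \<nu> x \<noteq> 0" for xs
    using that
  proof (induction "length xs" arbitrary: xs rule: less_induct)
    case less
    consider "xs = []" | a where "xs = [a]" | a b where "xs = [a, b]" | a b c ys where "xs = a # b # c # ys"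
      by (metis neq_Nil_conv)
    then show ?case
    proof cases
      case 4
      have nz: "\<nu> a \<noteq> 0" "\<nu> b \<noteq> 0" "\<nu> c \<noteq> 0" "\<forall>x\<in>set ys. \<nu> x \<noteq> 0" using less.prems 4 by auto
      \<comment> \<open>Two entries \<open>u\<close>, \<open>v\<close> are replaced by their sum,
        which shortens the list by one while all values stay non-zero; \<open>w\<close> is the
        remaining one of the three. This is then used for whichever pair has values with non-zero
        sum.\<close>
      have merge: ?thesis if "\<nu> (u + v) \<noteq> 0" "\<nu> (u + v) = \<nu> u + \<nu> v" "\<nu> w \<noteq> 0"
          "u + v + w = a + b + c" "\<nu> u + \<nu> v + \<nu> w = \<nu> a + \<nu> b + \<nu> c" for u v w
      proof -
        have "\<nu> (sum_list ((u + v) # w # ys)) = sum_list (map \<nu> ((u + v) # w # ys))"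
          using nz that 4 by (intro less.hyps) auto
        then have "\<nu> (u + v + w + sum_list ys) = \<nu> u + \<nu> v + \<nu> w + sum_list (map \<nu> ys)"
          using that(2) by (simp add: add.assoc)
        moreover have "sum_list xs = u + v + w + sum_list ys"
          unfolding that(4) 4 by (simp add: add.assoc)
        moreover have "sum_list (map \<nu> xs) = \<nu> u + \<nu> v + \<nu> w + sum_list (map \<nu> ys)"
          unfolding that(5) 4 by (simp add: add.assoc)
        ultimately show ?thesis by simp
      qed
      have "\<nu> a + \<nu> b \<noteq> 0 \<or> \<nu> a + \<nu> c \<noteq> 0 \<or> \<nu> b + \<nu> c \<noteq> 0"
      proof (rule ccontr)
        assume "\<not> ?thesis"
        then have e: "\<nu> a + \<nu> b = 0" "\<nu> a + \<nu> c = 0" "\<nu> b + \<nu> c = 0" by auto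
        have "2 * \<nu> a = (\<nu> a + \<nu> b) + (\<nu> a + \<nu> c) - (\<nu> b + \<nu> c)" by simp
        then show False using nz e by simp
      qed
      then show ?thesis
        using merge[of a b c] merge[of a c b] merge[of b c a] add nz by (auto simp: add_ac)
    qed (use zero add less.prems in auto)
  qed
  from this[of "map x [0..<n]"] assms(2) show ?thesis
    by (simp add: interv_sum_list_conv_sum_set_nat atLeast0LessThan o_def)
qed

text \<open>A linear map \<open>g\<close> is fitted to \<nu> on a maximal independent subset of the
  support. It agrees with \<nu> on the whole support by \<open>aC_dual_sum\<close>, and elsewhere
  \<nu> vanishes, so the operator norm of \<open>g\<close> dominates \<nu>.\<close>

lemma aC_dual_bounded:
  fixes \<nu> :: "'e::euclidean_space \<Rightarrow> complex"
  assumes \<nu>: "\<nu> \<in> aC_dual G P"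
  obtains C where "0 \<le> C" "\<And>x. cmod (\<nu> x) \<le> C * norm x"
proof -
  define A where "A = {x. \<nu> x \<noteq> 0}"
  have scale: "\<nu> (r *\<^sub>R x) = of_real r * \<nu> x" if "x \<in> A" for r x
    using \<nu> that unfolding aC_dual_def A_def by blast
  obtain B where B: "B \<subseteq> A" "independent B" "A \<subseteq> span B"
    using maximal_independent_subset by blast
  have fin: "finite B" using B(2) by (rule independent_imp_finite)
  obtain g where g: "linear g" "\<And>b. b \<in> B \<Longrightarrow> g b = \<nu> b"
    using linear_independent_extend[OF B(2), of \<nu>] by blast
  have eq: "\<nu> x = g x" if xA: "x \<in> A" for x
  proof -
    obtain u where u: "x = (\<Sum>b\<in>B. u b *\<^sub>R b)"
      using xA B(3) by (auto simp: span_finite[OF fin] subset_iff image_iff)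
    \<comment> \<open>Zero coefficients are dropped because \<open>aC_dual_sum\<close> asks every
      summand to have a non-zero value.\<close>
    define B' where "B' = {b\<in>B. u b \<noteq> 0}"
    have x: "x = (\<Sum>b\<in>B'. u b *\<^sub>R b)"
      unfolding u B'_def using fin by (intro sum.mono_neutral_right) auto
    have "finite B'" using fin by (simp add: B'_def)
    then obtain e where e: "bij_betw e {..<card B'} B'"
      using ex_bij_betw_nat_finite[of B'] by (auto simp: atLeast0LessThan)
    have eB: "e i \<in> B'" if "i < card B'" for i using e that by (auto simp: bij_betw_def)
    have "\<nu> (u (e i) *\<^sub>R e i) = of_real (u (e i)) * \<nu> (e i)" if "i < card B'" for i
      using eB[OF that] B(1) by (intro scale) (auto simp: B'_def)
    moreover have "u (e i) \<noteq> 0 \<and> \<nu> (e i) \<noteq> 0" if "i < card B'" for i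
      using eB[OF that] B(1) by (auto simp: B'_def A_def)
    ultimately have "\<nu> (\<Sum>i<card B'. u (e i) *\<^sub>R e i) = (\<Sum>i<card B'. \<nu> (u (e i) *\<^sub>R e i))"
      by (intro aC_dual_sum[OF \<nu>]) simp
    also have "(\<Sum>i<card B'. u (e i) *\<^sub>R e i) = x"
      unfolding x by (rule sum.reindex_bij_betw[OF e])
    also have "(\<Sum>i<card B'. \<nu> (u (e i) *\<^sub>R e i)) = (\<Sum>b\<in>B'. \<nu> (u b *\<^sub>R b))"
      by (rule sum.reindex_bij_betw[OF e])
    also have "\<dots> = (\<Sum>b\<in>B'. u b *\<^sub>R g b)"
    proof (rule sum.cong)
      fix b assume "b \<in> B'"
      then have "b \<in> B" "b \<in> A" using B(1) by (auto simp: B'_def)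
      then show "\<nu> (u b *\<^sub>R b) = u b *\<^sub>R g b" by (simp add: scale g(2) scaleR_conv_of_real)
    qed simp
    also have "\<dots> = g x" unfolding x by (simp add: linear_sum[OF g(1)] linear_scale[OF g(1)])
    finally show ?thesis .
  qed
  have bl: "bounded_linear g" using g(1) by (rule linear_conv_bounded_linear[THEN iffD1])
  have "cmod (\<nu> x) \<le> onorm g * norm x" for x
  proof (cases "x \<in> A")
    case True then show ?thesis using onorm[OF bl, of x] by (simp add: eq)
  next
    case False then show ?thesis using onorm_pos_le[OF bl] by (simp add: A_def)
  qed
  with onorm_pos_le[OF bl] show thesis by (rule that)
qed

text \<open>Compares \<open>onorm\<close>, in which \<open>holomorphic_dual\<close> measures
  increments, with the size of coordinates. The supremum defining \<open>onorm\<close> can be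
  estimated because each \<open>b i\<close> is bounded by \<open>aC_dual_bounded\<close>.\<close>

lemma onorm_combination:
  fixes b :: "nat \<Rightarrow> 'e::euclidean_space \<Rightarrow> complex"
  assumes "\<And>i. i < n \<Longrightarrow> b i \<in> aC_dual G P"
  obtains C where "0 < C" "\<And>c. onorm (\<Sum>i<n. c i *\<^sub>C b i) \<le> C * (\<Sum>i<n. cmod (c i))"
proof -
  have "\<exists>C\<ge>0. \<forall>x. cmod (b i x) \<le> C * norm x" if "i < n" for i
    using aC_dual_bounded[OF assms[OF that]] by metis
  then obtain D where D: "\<And>i. i < n \<Longrightarrow> 0 \<le> D i" "\<And>i x. i < n \<Longrightarrow> cmod (b i x) \<le> D i * norm x"
    by metis
  \<comment> \<open>The summand 1 keeps \<open>C\<close> positive, also for \<open>n = 0\<close>; it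
    becomes a denominator in \<open>holomorphic_dual_plane\<close>.\<close>
  define C where "C = 1 + (\<Sum>i<n. D i)"
  have C0: "0 < C" using D(1) by (auto simp: C_def intro!: add_pos_nonneg sum_nonneg)
  have DC: "D i \<le> C" if "i < n" for i
  proof -
    have "D i \<le> (\<Sum>i<n. D i)" using that D(1) by (intro member_le_sum) auto
    then show ?thesis by (simp add: C_def)
  qed
  have "onorm (\<Sum>i<n. c i *\<^sub>C b i) \<le> C * (\<Sum>i<n. cmod (c i))" for c
  proof (rule onorm_bound)
    show "0 \<le> C * (\<Sum>i<n. cmod (c i))" using C0 by (auto intro!: mult_nonneg_nonneg sum_nonneg)
    fix x
    have "(\<Sum>i<n. c i *\<^sub>C b i) x = (\<Sum>i<n. c i * b i x)"
      by (induction n) (auto simp: scaleC_fun_def scaleC_complex_def)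
    then have "cmod ((\<Sum>i<n. c i *\<^sub>C b i) x) \<le> (\<Sum>i<n. cmod (c i * b i x))"
      by (simp add: norm_sum)
    also have "\<dots> \<le> (\<Sum>i<n. cmod (c i) * (C * norm x))"
    proof (rule sum_mono)
      fix i assume "i \<in> {..<n}"
      then have "cmod (b i x) \<le> C * norm x"
        using D(2)[of i x] DC[of i] mult_right_mono[of "D i" C "norm x"] by force
      then show "cmod (c i * b i x) \<le> cmod (c i) * (C * norm x)"
        by (simp add: norm_mult mult_left_mono)
    qed
    also have "\<dots> = C * (\<Sum>i<n. cmod (c i)) * norm x"
      by (simp add: sum_distrib_left sum_distrib_right mult_ac)
    finally show "cmod ((\<Sum>i<n. c i *\<^sub>C b i) x) \<le> C * (\<Sum>i<n. cmod (c i)) * norm x" .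
  qed
  with C0 show thesis by (rule that)
qed


section \<open>From differentiability in \<open>onorm\<close> to holomorphy on lines and bounds on
  polydiscs\<close>

lemma holomorphic_dual_plane:
  fixes f :: "('e::euclidean_space \<Rightarrow> complex) \<Rightarrow> complex"
  assumes f: "holomorphic_dual (aC_dual G P) f" and \<nu>: "\<nu> \<in> aC_dual G P"
    and b: "\<And>i. i < (n::nat) \<Longrightarrow> b i \<in> aC_dual G P"
  shows "\<exists>l. \<forall>\<epsilon>>0. \<exists>\<delta>>0. \<forall>c. (\<Sum>i<n. cmod (c i)) < \<delta> \<longrightarrow>
    cmod (f (\<nu> + (\<Sum>i<n. c i *\<^sub>C b i)) - f \<nu> - (\<Sum>i<n. c i * l i)) \<le> \<epsilon> * (\<Sum>i<n. cmod (c i))"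
proof -
  note S = aC_dual_subspace[of G P]
  obtain L where L: "clinear_on (aC_dual G P) L"
    and d: "\<forall>\<epsilon>>0. \<exists>\<delta>>0. \<forall>\<mu>\<in>aC_dual G P. onorm \<mu> < \<delta> \<longrightarrow>
      cmod (f (\<nu> + \<mu>) - f \<nu> - L \<mu>) \<le> \<epsilon> * onorm \<mu>"
    using bspec[OF f[unfolded holomorphic_dual_def] \<nu>] by (elim exE conjE)
  obtain C where C: "0 < C" "\<And>c. onorm (\<Sum>i<n. c i *\<^sub>C b i) \<le> C * (\<Sum>i<n. cmod (c i))"
    using onorm_combination[of n b, OF b] by blast
  have mem: "(\<Sum>i<m. c i *\<^sub>C b i) \<in> aC_dual G P" if "m \<le> n" for c m
    using that b by (intro cvec.subspace_sum[OF S] cvec.subspace_scale[OF S]) auto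
  have Lsum: "L (\<Sum>i<m. c i *\<^sub>C b i) = (\<Sum>i<m. c i * L (b i))" if "m \<le> n" for c m
    using that
  proof (induction m)
    case 0
    have "L (0 *\<^sub>C 0) = 0 *\<^sub>C L 0"
      using L cvec.subspace_0[OF S] unfolding clinear_on_def by blast
    then show ?case by (simp add: zero_fun_def)
  next
    case (Suc m)
    have "L ((\<Sum>i<m. c i *\<^sub>C b i) + c m *\<^sub>C b m) = L (\<Sum>i<m. c i *\<^sub>C b i) + L (c m *\<^sub>C b m)"
      using L mem[of m c] b[of m] cvec.subspace_scale[OF S] Suc.prems unfolding clinear_on_def by auto
    moreover have "L (c m *\<^sub>C b m) = c m * L (b m)"
      using L b[of m] Suc.prems unfolding clinear_on_def by (simp add: scaleC_complex_def)
    moreover have "L (\<Sum>i<m. c i *\<^sub>C b i) = (\<Sum>i<m. c i * L (b i))" using Suc by simp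
    ultimately show ?case by (simp only: sum.lessThan_Suc)
  qed
  \<comment> \<open>The differential \<open>L\<close> is restricted to the span of the
    \<open>b i\<close>, with coefficients \<open>L (b i)\<close>. Dividing \<epsilon> and \<delta>
    by \<open>C\<close> pays for passing from \<open>onorm\<close> to the sum of the
    \<open>cmod (c i)\<close>.\<close>
  show ?thesis
  proof (intro exI[of _ "\<lambda>i. L (b i)"] allI impI)
    fix \<epsilon> :: real assume \<epsilon>: "0 < \<epsilon>"
    then have "0 < \<epsilon> / C" using C(1) by simp
    then obtain \<delta> where \<delta>: "0 < \<delta>" "\<forall>\<mu>\<in>aC_dual G P. onorm \<mu> < \<delta> \<longrightarrow>
        cmod (f (\<nu> + \<mu>) - f \<nu> - L \<mu>) \<le> \<epsilon> / C * onorm \<mu>"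
      using d[rule_format, of "\<epsilon> / C"] by blast
    have "cmod (f (\<nu> + (\<Sum>i<n. c i *\<^sub>C b i)) - f \<nu> - (\<Sum>i<n. c i * L (b i))) \<le> \<epsilon> * (\<Sum>i<n. cmod (c i))"
      if c: "(\<Sum>i<n. cmod (c i)) < \<delta> / C" for c
    proof -
      have "C * (\<Sum>i<n. cmod (c i)) < \<delta>" using c C(1) by (simp add: field_simps)
      then have "onorm (\<Sum>i<n. c i *\<^sub>C b i) < \<delta>" using C(2)[of c] by linarith
      then have "cmod (f (\<nu> + (\<Sum>i<n. c i *\<^sub>C b i)) - f \<nu> - (\<Sum>i<n. c i * L (b i)))
          \<le> \<epsilon> / C * onorm (\<Sum>i<n. c i *\<^sub>C b i)"
        using bspec[OF \<delta>(2) mem[OF order_refl]] Lsum[OF order_refl] by simp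
      also have "\<dots> \<le> \<epsilon> / C * (C * (\<Sum>i<n. cmod (c i)))"
        using \<epsilon> C by (intro mult_left_mono) auto
      also have "\<dots> = \<epsilon> * (\<Sum>i<n. cmod (c i))" using C(1) by simp
      finally show ?thesis .
    qed
    then show "\<exists>\<delta>>0. \<forall>c. (\<Sum>i<n. cmod (c i)) < \<delta> \<longrightarrow>
        cmod (f (\<nu> + (\<Sum>i<n. c i *\<^sub>C b i)) - f \<nu> - (\<Sum>i<n. c i * L (b i))) \<le> \<epsilon> * (\<Sum>i<n. cmod (c i))"
      using \<delta>(1) C(1) by (intro exI[of _ "\<delta> / C"]) auto
  qed
qed

text \<open>Differentiability at one point with error constant 1 suffices: the affine part is
  bounded on a small polydisc, and the error is bounded by the size of the increment.\<close>

lemma holomorphic_dual_locally_bounded: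
  fixes f :: "('e::euclidean_space \<Rightarrow> complex) \<Rightarrow> complex"
  assumes f: "holomorphic_dual (aC_dual G P) f" and \<nu>: "\<nu> \<in> aC_dual G P"
    and b: "\<And>i. i < (n::nat) \<Longrightarrow> b i \<in> aC_dual G P"
  obtains \<delta> M where "0 < \<delta>"
    "\<And>c. (\<And>i. i < n \<Longrightarrow> cmod (c i) < \<delta>) \<Longrightarrow> cmod (f (\<nu> + (\<Sum>i<n. c i *\<^sub>C b i))) \<le> M"
proof -
  obtain l where l: "\<forall>\<epsilon>>0. \<exists>\<delta>>0. \<forall>c. (\<Sum>i<n. cmod (c i)) < \<delta> \<longrightarrow>
      cmod (f (\<nu> + (\<Sum>i<n. c i *\<^sub>C b i)) - f \<nu> - (\<Sum>i<n. c i * l i)) \<le> \<epsilon> * (\<Sum>i<n. cmod (c i))"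
    using holomorphic_dual_plane[OF f \<nu> b] by (rule exE)
  obtain \<delta> where \<delta>: "0 < \<delta>" "\<And>c. (\<Sum>i<n. cmod (c i)) < \<delta> \<Longrightarrow>
      cmod (f (\<nu> + (\<Sum>i<n. c i *\<^sub>C b i)) - f \<nu> - (\<Sum>i<n. c i * l i)) \<le> 1 * (\<Sum>i<n. cmod (c i))"
    using l[rule_format, OF zero_less_one] by blast
  \<comment> \<open>Chosen so that \<open>n\<close> coordinates below \<open>r\<close> have sum
    below \<open>\<delta>\<close>; the extra 1 makes this strict and covers
    \<open>n = 0\<close>.\<close>
  define r where "r = \<delta> / (real n + 1)"
  have r: "0 < r" "real n * r < \<delta>"
    using \<delta>(1) by (auto simp: r_def divide_less_eq field_simps)
  define M where "M = cmod (f \<nu>) + (\<Sum>i<n. r * cmod (l i)) + \<delta>"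
  show thesis
  proof (rule that[OF r(1), of M])
    fix c :: "nat \<Rightarrow> complex"
    assume c: "\<And>i. i < n \<Longrightarrow> cmod (c i) < r"
    have "(\<Sum>i<n. cmod (c i)) \<le> (\<Sum>i<n. r)" using c by (intro sum_mono) (auto intro: less_imp_le)
    then have s: "(\<Sum>i<n. cmod (c i)) < \<delta>" using r(2) by simp
    have "cmod (\<Sum>i<n. c i * l i) \<le> (\<Sum>i<n. cmod (c i * l i))" by (rule norm_sum)
    also have "\<dots> \<le> (\<Sum>i<n. r * cmod (l i))"
      using c by (intro sum_mono) (simp add: norm_mult mult_right_mono less_imp_le)
    finally have "cmod (\<Sum>i<n. c i * l i) \<le> (\<Sum>i<n. r * cmod (l i))" .
    moreover have "cmod (f (\<nu> + (\<Sum>i<n. c i *\<^sub>C b i)) - f \<nu> - (\<Sum>i<n. c i * l i)) < \<delta>"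
      using \<delta>(2)[OF s] s by linarith
    moreover have "cmod (x + y + z) \<le> cmod x + cmod y + cmod z" for x y z
      by (meson add_mono norm_triangle_ineq norm_triangle_le order_refl order_trans)
    from this[of "f \<nu>" "\<Sum>i<n. c i * l i" "f (\<nu> + (\<Sum>i<n. c i *\<^sub>C b i)) - f \<nu> - (\<Sum>i<n. c i * l i)"]
    have "cmod (f (\<nu> + (\<Sum>i<n. c i *\<^sub>C b i))) \<le> cmod (f \<nu>) + cmod (\<Sum>i<n. c i * l i) +
        cmod (f (\<nu> + (\<Sum>i<n. c i *\<^sub>C b i)) - f \<nu> - (\<Sum>i<n. c i * l i))" by simp
    ultimately show "cmod (f (\<nu> + (\<Sum>i<n. c i *\<^sub>C b i))) \<le> M" unfolding M_def by linarith
  qed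
qed

text \<open>Holomorphy on a line is the plane statement with a single direction. For a large
  polydisc, the local bounds are patched together by compactness of a finite product of closed
  discs.\<close>

lemma gholomorphic_holomorphic_dual:
  fixes f :: "('e::euclidean_space \<Rightarrow> complex) \<Rightarrow> complex"
  assumes f: "holomorphic_dual (aC_dual G P) f"
  shows "gholomorphic (aC_dual G P) f"
  unfolding gholomorphic_def
proof (intro conjI ballI allI impI)
  note S = aC_dual_subspace[of G P]
  note add = cvec.subspace_add[OF S] and sc = cvec.subspace_scale[OF S]
  fix \<nu> \<eta> assume \<nu>: "\<nu> \<in> aC_dual G P" and \<eta>: "\<eta> \<in> aC_dual G P"
  have "(\<lambda>z. f (\<nu> + z *\<^sub>C \<eta>)) field_differentiable (at x)" for x
  proof -
    have \<nu>': "\<nu> + x *\<^sub>C \<eta> \<in> aC_dual G P" using add sc \<nu> \<eta> by blast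
    have "\<exists>l. \<forall>\<epsilon>>0. \<exists>\<delta>>0. \<forall>c. (\<Sum>i<1::nat. cmod (c i)) < \<delta> \<longrightarrow>
        cmod (f (\<nu> + x *\<^sub>C \<eta> + (\<Sum>i<1. c i *\<^sub>C \<eta>)) - f (\<nu> + x *\<^sub>C \<eta>) - (\<Sum>i<1. c i * l i))
          \<le> \<epsilon> * (\<Sum>i<1. cmod (c i))"
      by (rule holomorphic_dual_plane[OF f \<nu>', of 1 "\<lambda>_. \<eta>"]) (rule \<eta>)
    then obtain l where l: "\<forall>\<epsilon>>0. \<exists>\<delta>>0. \<forall>c. (\<Sum>i<1::nat. cmod (c i)) < \<delta> \<longrightarrow>
        cmod (f (\<nu> + x *\<^sub>C \<eta> + (\<Sum>i<1. c i *\<^sub>C \<eta>)) - f (\<nu> + x *\<^sub>C \<eta>) - (\<Sum>i<1. c i * l i))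
          \<le> \<epsilon> * (\<Sum>i<1. cmod (c i))" by (rule exE)
    have "((\<lambda>z. f (\<nu> + z *\<^sub>C \<eta>)) has_derivative (\<lambda>h. l 0 * h)) (at x)"
      unfolding has_derivative_at_alt
    proof (intro conjI allI impI)
      show "bounded_linear (\<lambda>h. l 0 * h)" by (rule bounded_linear_mult_right)
      fix e :: real assume "0 < e"
      then obtain \<delta> where \<delta>: "0 < \<delta>" "\<And>c. (\<Sum>i<1::nat. cmod (c i)) < \<delta> \<Longrightarrow>
          cmod (f (\<nu> + x *\<^sub>C \<eta> + (\<Sum>i<1. c i *\<^sub>C \<eta>)) - f (\<nu> + x *\<^sub>C \<eta>) - (\<Sum>i<1. c i * l i))
            \<le> e * (\<Sum>i<1. cmod (c i))"
        using l[rule_format, of e] by blast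
      have "cmod (f (\<nu> + y *\<^sub>C \<eta>) - f (\<nu> + x *\<^sub>C \<eta>) - l 0 * (y - x)) \<le> e * cmod (y - x)"
        if "cmod (y - x) < \<delta>" for y
      proof -
        have eq: "\<nu> + x *\<^sub>C \<eta> + (y - x) *\<^sub>C \<eta> = \<nu> + y *\<^sub>C \<eta>"
          unfolding add.assoc scaleC_add_left[symmetric] by simp
        have "cmod (f (\<nu> + x *\<^sub>C \<eta> + (y - x) *\<^sub>C \<eta>) - f (\<nu> + x *\<^sub>C \<eta>) - l 0 * (y - x))
            \<le> e * cmod (y - x)"
          using \<delta>(2)[of "\<lambda>_. y - x"] that by (simp add: mult.commute)
        then show ?thesis unfolding eq .
      qed
      then show "\<exists>d>0. \<forall>y. cmod (y - x) < d \<longrightarrow>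
          cmod (f (\<nu> + y *\<^sub>C \<eta>) - f (\<nu> + x *\<^sub>C \<eta>) - l 0 * (y - x)) \<le> e * cmod (y - x)"
        using \<delta>(1) by blast
    qed
    then have "((\<lambda>z. f (\<nu> + z *\<^sub>C \<eta>)) has_field_derivative l 0) (at x)"
      by (simp add: has_field_derivative_def)
    then show ?thesis by (auto simp: field_differentiable_def)
  qed
  then show "(\<lambda>z. f (\<nu> + z *\<^sub>C \<eta>)) holomorphic_on UNIV"
    by (auto simp: holomorphic_on_def field_differentiable_at_within)
next
  note S = aC_dual_subspace[of G P]
  note add = cvec.subspace_add[OF S] and sc = cvec.subspace_scale[OF S]
  fix \<nu> and B :: "('e \<Rightarrow> complex) set" and R :: real
  assume \<nu>: "\<nu> \<in> aC_dual G P" and B: "finite B \<and> B \<subseteq> aC_dual G P"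
  define n where "n = card B"
  obtain e where e: "bij_betw e {..<n} B"
    using ex_bij_betw_nat_finite[of B] B by (auto simp: atLeast0LessThan n_def)
  have eB: "e i \<in> aC_dual G P" if "i < n" for i using e that B by (auto simp: bij_betw_def)
  \<comment> \<open>\<open>B\<close> is enumerated so that its polydisc becomes the image of a
    compact set \<open>K\<close> of coefficient tuples. Since \<open>T\<close> is affine, a small
    change of the tuple \<open>c\<close> is a small increment at \<open>T c\<close>, where the local
    bound applies.\<close>
  define T where "T = (\<lambda>c. \<nu> + (\<Sum>i<n. c i *\<^sub>C e i))"
  define K where "K = PiE {..<n} (\<lambda>_. cball (0::complex) R)"
  have K: "compactin (product_topology (\<lambda>_. euclidean) {..<n}) K"
    unfolding K_def by (subst compactin_PiE) auto
  have TS: "T c \<in> aC_dual G P" for c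
    unfolding T_def using \<nu> eB by (intro add cvec.subspace_sum[OF S] sc) auto
  have "\<exists>U M. openin (product_topology (\<lambda>_. euclidean) {..<n}) U \<and> c \<in> U \<and> (\<forall>c'\<in>U. cmod (f (T c')) \<le> M)"
    if c: "c \<in> K" for c
  proof -
    obtain \<delta> M where \<delta>: "0 < \<delta>" "\<And>a. (\<And>i. i < n \<Longrightarrow> cmod (a i) < \<delta>) \<Longrightarrow>
        cmod (f (T c + (\<Sum>i<n. a i *\<^sub>C e i))) \<le> M"
      using holomorphic_dual_locally_bounded[OF f TS[of c], of n e] eB by metis
    let ?U = "PiE {..<n} (\<lambda>i. ball (c i) \<delta>)"
    have "openin (product_topology (\<lambda>_. euclidean) {..<n}) ?U"
      by (simp add: openin_PiE_gen)
    moreover have "c \<in> ?U" using c \<delta>(1) by (auto simp: K_def PiE_iff)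
    moreover have "cmod (f (T c')) \<le> M" if c': "c' \<in> ?U" for c'
    proof -
      have "T c' = T c + (\<Sum>i<n. (c' i - c i) *\<^sub>C e i)"
        by (simp add: T_def cvec.scale_left_diff_distrib sum_subtractf)
      moreover have "cmod (c' i - c i) < \<delta>" if "i < n" for i
        using c' that by (auto simp: PiE_iff dist_norm norm_minus_commute)
      ultimately show ?thesis using \<delta>(2)[of "\<lambda>i. c' i - c i"] by simp
    qed
    ultimately show ?thesis by blast
  qed
  then obtain U M where U: "\<And>c. c \<in> K \<Longrightarrow> openin (product_topology (\<lambda>_. euclidean) {..<n}) (U c)"
      "\<And>c. c \<in> K \<Longrightarrow> c \<in> U c" "\<And>c c'. c \<in> K \<Longrightarrow> c' \<in> U c \<Longrightarrow> cmod (f (T c')) \<le> M c"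
    by metis
  have "\<exists>\<F>. finite \<F> \<and> \<F> \<subseteq> U ` K \<and> K \<subseteq> \<Union>\<F>"
    using U(1,2) by (intro compactinD[OF K]) auto
  then obtain F where F: "finite F" "F \<subseteq> K" "K \<subseteq> \<Union>(U ` F)"
    by (metis finite_subset_image)
  \<comment> \<open>\<open>K\<close>, and with it \<open>F\<close>, may be empty when
    \<open>R\<close> is negative; the inserted 0 keeps \<open>Max\<close> meaningful.\<close>
  have "cmod (f (\<nu> + (\<Sum>b\<in>B. c b *\<^sub>C b))) \<le> Max (insert 0 (M ` F))"
    if c: "\<forall>b\<in>B. cmod (c b) \<le> R" for c
  proof -
    \<comment> \<open>Tuples in \<open>PiE\<close> are \<open>undefined\<close> outside the index
      range, and \<open>c'\<close> has to match this.\<close>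
    define c' where "c' = (\<lambda>i. if i < n then c (e i) else undefined)"
    have "c' \<in> K"
      using c bij_betwE[OF e] by (auto simp: K_def c'_def PiE_iff extensional_def)
    then obtain a where a: "a \<in> F" "c' \<in> U a" using F(3) by blast
    have "(\<Sum>b\<in>B. c b *\<^sub>C b) = (\<Sum>i<n. c (e i) *\<^sub>C e i)"
      by (rule sum.reindex_bij_betw[OF e, symmetric])
    then have "\<nu> + (\<Sum>b\<in>B. c b *\<^sub>C b) = T c'" by (simp add: T_def c'_def)
    moreover have "cmod (f (T c')) \<le> M a" using U(3) a F(2) by blast
    moreover have "M a \<le> Max (insert 0 (M ` F))" using F(1) a(1) by (intro Max_ge) auto
    ultimately show ?thesis by simp
  qed
  then show "\<exists>M. \<forall>c. (\<forall>b\<in>B. cmod (c b) \<le> R) \<longrightarrow> cmod (f (\<nu> + (\<Sum>b\<in>B. c b *\<^sub>C b))) \<le> M"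
    by blast
qed


subsection \<open>Derived families\<close>

text \<open>Every computation of a \<open>line_deriv\<close> goes through a limit exhibited
  beforehand; the Hausdorff property excludes any other value of the description.\<close>

lemma line_deriv_eq:
  assumes "tvs W" "limitin W (\<lambda>z. (1 / z) *\<^sub>C (g z - g 0)) w (at 0)"
  shows "line_deriv W g = w"
  unfolding line_deriv_def
proof (rule the_equality)
  show "limitin W (\<lambda>z. (1 / z) *\<^sub>C (g z - g 0)) w (at 0)" by fact
  show "w' = w" if "limitin W (\<lambda>z. (1 / z) *\<^sub>C (g z - g 0)) w' (at 0)" for w'
    using that assms tvs_Hausdorff by (intro limitin_Hausdorff_unique) auto
qed

text \<open>Generated inductively so that later claims are checked on the generators. The rule
  \<open>cong\<close> makes the class depend only on values on \<open>S\<close>: elements of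
  \<open>F_P\<close> are cut off to 0 outside, and \<open>line_deriv\<close> is identified only for
  parameters in \<open>S\<close>.\<close>

inductive hol_family :: "'u::complex_space set \<Rightarrow> 'w::complex_space topology \<Rightarrow> ('u \<Rightarrow> 'w) \<Rightarrow> bool"
  for S W where
    zero: "hol_family S W (\<lambda>_. 0)"
  | scale: "gholomorphic S F \<Longrightarrow> w \<in> topspace W \<Longrightarrow> hol_family S W (\<lambda>\<nu>. F \<nu> *\<^sub>C w)"
  | add: "hol_family S W g \<Longrightarrow> hol_family S W h \<Longrightarrow> hol_family S W (\<lambda>\<nu>. g \<nu> + h \<nu>)"
  | cong: "hol_family S W g \<Longrightarrow> (\<And>\<nu>. \<nu> \<in> S \<Longrightarrow> h \<nu> = g \<nu>) \<Longrightarrow> hol_family S W h"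

lemma hol_family_topspace:
  assumes "hol_family S W g" "tvs W" "\<nu> \<in> S"
  shows "g \<nu> \<in> topspace W"
  using assms(1,3)
proof induction
  case (add g h)
  then show ?case using cvec.subspace_add[OF tvs_subspace[OF assms(2)]] by blast
qed (use cvec.subspace_0[OF tvs_subspace[OF assms(2)]]
      cvec.subspace_scale[OF tvs_subspace[OF assms(2)]] in auto)

text \<open>The sums are finite and their vectors fixed, so a linear map is applied term by term. It
  serves to embed families into the components of jet spaces.\<close>

lemma hol_family_compose:
  assumes "hol_family S W g"
    and "\<And>x y. \<iota> (x + y) = \<iota> x + \<iota> y" "\<And>c x. \<iota> (c *\<^sub>C x) = c *\<^sub>C \<iota> x"
    and "\<And>x. x \<in> topspace W \<Longrightarrow> \<iota> x \<in> topspace W'"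
  shows "hol_family S W' (\<lambda>\<nu>. \<iota> (g \<nu>))"
  using assms(1)
proof induction
  case zero
  have "\<iota> 0 = 0" using assms(3)[of 0 0] by simp
  then show ?case by (simp only: hol_family.zero)
next
  case (scale F w)
  then show ?case unfolding assms(3) using assms(4) by (intro hol_family.scale)
next
  case (add g h)
  then show ?case unfolding assms(2) by (intro hol_family.add)
next
  case (cong g h)
  show ?case by (rule hol_family.cong[OF cong.IH]) (simp add: cong.hyps)
qed

lemma hol_family_sum:
  assumes "\<And>i. i < (n::nat) \<Longrightarrow> hol_family S W (g i)"
  shows "hol_family S W (\<lambda>\<nu>. \<Sum>i<n. g i \<nu>)"
  using assms
proof (induction n)
  case (Suc n)
  have "hol_family S W (\<lambda>\<nu>. (\<Sum>i<n. g i \<nu>) + g n \<nu>)"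
    by (intro hol_family.add Suc) auto
  then show ?case by (simp only: sum.lessThan_Suc)
qed (simp add: hol_family.zero)

text \<open>The derivative falls on the scalar factors alone. \<open>g'\<close> is produced with its
  limits at all points of \<open>S\<close>, because the next differentiation needs a whole family
  and not a value at one point.\<close>

lemma hol_family_deriv:
  assumes W: "tvs W" and S: "cvec.subspace S" and \<eta>: "\<eta> \<in> S" and g: "hol_family S W g"
  shows "\<exists>g'. hol_family S W g' \<and>
    (\<forall>\<nu>\<in>S. limitin W (\<lambda>z. (1 / z) *\<^sub>C (g (\<nu> + z *\<^sub>C \<eta>) - g \<nu>)) (g' \<nu>) (at 0))"
  using g
proof induction
  case zero
  have "limitin W (\<lambda>z. (1 / z) *\<^sub>C (0 - 0)) 0 (at (0::complex))"
    using cvec.subspace_0[OF tvs_subspace[OF W]] by simp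
  then show ?case by (intro exI[of _ "\<lambda>_. 0"] conjI ballI hol_family.zero)
next
  case (scale F w)
  have "limitin W (\<lambda>z. (1 / z) *\<^sub>C (F (\<nu> + z *\<^sub>C \<eta>) *\<^sub>C w - F \<nu> *\<^sub>C w)) (dir_deriv F \<eta> \<nu> *\<^sub>C w) (at 0)"
    if \<nu>: "\<nu> \<in> S" for \<nu>
  proof -
    have "limitin W (\<lambda>z. ((F (\<nu> + z *\<^sub>C \<eta>) - F \<nu>) / z) *\<^sub>C w) (dir_deriv F \<eta> \<nu> *\<^sub>C w) (at 0)"
      using scale.hyps by (intro limitin_tvs_scale[OF W dir_deriv_limit[OF _ \<nu> \<eta>]]) auto
    moreover have "((F (\<nu> + z *\<^sub>C \<eta>) - F \<nu>) / z) *\<^sub>C w =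
        (1 / z) *\<^sub>C (F (\<nu> + z *\<^sub>C \<eta>) *\<^sub>C w - F \<nu> *\<^sub>C w)" for z
      by (simp add: scaleC_scaleC flip: cvec.scale_left_diff_distrib)
    ultimately show ?thesis by (simp only:)
  qed
  with scale.hyps show ?case
    by (intro exI[of _ "\<lambda>\<nu>. dir_deriv F \<eta> \<nu> *\<^sub>C w"] conjI ballI hol_family.scale
        gholomorphic_dir_deriv[OF S _ \<eta>])
next
  case (add g h)
  then obtain g' h' where g': "hol_family S W g'"
      "\<forall>\<nu>\<in>S. limitin W (\<lambda>z. (1 / z) *\<^sub>C (g (\<nu> + z *\<^sub>C \<eta>) - g \<nu>)) (g' \<nu>) (at 0)"
    and h': "hol_family S W h'"
      "\<forall>\<nu>\<in>S. limitin W (\<lambda>z. (1 / z) *\<^sub>C (h (\<nu> + z *\<^sub>C \<eta>) - h \<nu>)) (h' \<nu>) (at 0)"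
    by (elim exE conjE)
  have "limitin W (\<lambda>z. (1 / z) *\<^sub>C ((g (\<nu> + z *\<^sub>C \<eta>) + h (\<nu> + z *\<^sub>C \<eta>)) - (g \<nu> + h \<nu>)))
      (g' \<nu> + h' \<nu>) (at 0)" if \<nu>: "\<nu> \<in> S" for \<nu>
    using limitin_tvs_add[OF W bspec[OF g'(2) \<nu>] bspec[OF h'(2) \<nu>]]
    by (simp only: scaleC_add_right[symmetric] add_diff_add)
  then show ?case
    by (intro exI[of _ "\<lambda>\<nu>. g' \<nu> + h' \<nu>"] conjI ballI hol_family.add g'(1) h'(1))
next
  case (cong g h)
  obtain g' where g': "hol_family S W g'"
      "\<forall>\<nu>\<in>S. limitin W (\<lambda>z. (1 / z) *\<^sub>C (g (\<nu> + z *\<^sub>C \<eta>) - g \<nu>)) (g' \<nu>) (at 0)"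
    using cong.IH by (elim exE conjE)
  have "limitin W (\<lambda>z. (1 / z) *\<^sub>C (h (\<nu> + z *\<^sub>C \<eta>) - h \<nu>)) (g' \<nu>) (at 0)" if \<nu>: "\<nu> \<in> S" for \<nu>
  proof -
    \<comment> \<open>The whole line stays in \<open>S\<close>, so the difference quotients of
      \<open>g\<close> and \<open>h\<close> agree for every \<open>z\<close>.\<close>
    have "\<nu> + z *\<^sub>C \<eta> \<in> S" for z
      using \<nu> \<eta> cvec.subspace_add[OF S] cvec.subspace_scale[OF S] by blast
    then have "h (\<nu> + z *\<^sub>C \<eta>) = g (\<nu> + z *\<^sub>C \<eta>)" for z by (rule cong.hyps)
    moreover have "h \<nu> = g \<nu>" using \<nu> by (rule cong.hyps)
    ultimately show ?thesis using bspec[OF g'(2) \<nu>] by (simp only:)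
  qed
  then show ?case using g'(1) by (intro exI[of _ g'] conjI ballI)
qed

lemma tvs_jet_space: "tvs V \<Longrightarrow> tvs (jet_space n V)"
  unfolding jet_space_def by (rule tvs_direct_sum)

lemma topspace_jet_space:
  "topspace (jet_space n V) = {f. (\<forall>b. length b = n \<longrightarrow> f b \<in> topspace V) \<and> (\<forall>b. length b \<noteq> n \<longrightarrow> f b = 0)}"
  unfolding jet_space_def topspace_direct_sum by auto

text \<open>Induction on the list of directions: the inner jet of the second component is a
  \<open>hol_family\<close>, hence differentiable along the next direction with a derivative of the
  same kind.\<close>

lemma jet_hol_family:
  fixes V :: "'w::complex_space topology"
  assumes V: "tvs V" and S: "cvec.subspace S"
    and \<Phi>: "\<And>v. v \<in> topspace V \<Longrightarrow> hol_family S V (\<lambda>\<nu>. \<Phi> \<nu> v)"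
    and "set \<eta>s \<subseteq> S" and "v \<in> topspace (jet_space (length \<eta>s) V)"
  shows "hol_family S (jet_space (length \<eta>s) V) (\<lambda>\<nu>. jet V \<Phi> \<eta>s \<nu> v)"
  using assms(4,5)
proof (induction \<eta>s arbitrary: v)
  case Nil
  have "hol_family S V (\<lambda>\<nu>. \<Phi> \<nu> (v []))"
    using Nil by (intro \<Phi>) (simp add: topspace_jet_space)
  then show ?case
    unfolding jet.simps
    by (rule hol_family_compose) (auto simp: fun_eq_iff scaleC_fun_def topspace_jet_space)
next
  case (Cons \<eta> \<eta>s)
  let ?W = "jet_space (length \<eta>s) V" and ?W' = "jet_space (length (\<eta> # \<eta>s)) V"
  note W = tvs_jet_space[OF V, of "length \<eta>s"]
  have \<eta>: "\<eta> \<in> S" and \<eta>s: "set \<eta>s \<subseteq> S" using Cons.prems by auto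
  define v1 where "v1 = (\<lambda>b. v (False # b))"
  define v2 where "v2 = (\<lambda>b. v (True # b))"
  have "v1 \<in> topspace ?W" "v2 \<in> topspace ?W"
    using Cons.prems(2) by (auto simp: v1_def v2_def topspace_jet_space)
  then have g1: "hol_family S ?W (\<lambda>\<nu>. jet V \<Phi> \<eta>s \<nu> v1)" and g2: "hol_family S ?W (\<lambda>\<nu>. jet V \<Phi> \<eta>s \<nu> v2)"
    using Cons.IH[OF \<eta>s] by blast+
  obtain g' where g': "hol_family S ?W g'"
      "\<forall>\<nu>\<in>S. limitin ?W (\<lambda>z. (1 / z) *\<^sub>C (jet V \<Phi> \<eta>s (\<nu> + z *\<^sub>C \<eta>) v2 - jet V \<Phi> \<eta>s \<nu> v2)) (g' \<nu>) (at 0)"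
    using hol_family_deriv[OF W S \<eta> g2] by (elim exE conjE)
  have ld: "line_deriv ?W (\<lambda>z. jet V \<Phi> \<eta>s (\<nu> + z *\<^sub>C \<eta>) v2) = g' \<nu>" if "\<nu> \<in> S" for \<nu>
    using bspec[OF g'(2) that] by (intro line_deriv_eq[OF W]) simp
  \<comment> \<open>\<open>\<iota> c\<close> places a vector in the copy selected by
    \<open>c\<close>, so the doubled family is a sum of two embedded ones.\<close>
  define \<iota> where "\<iota> = (\<lambda>(c::bool) w (b::bool list). case b of [] \<Rightarrow> 0 | d # b' \<Rightarrow> if d = c then w b' else (0::'w))"
  have \<iota>: "\<iota> c (x + y) = \<iota> c x + \<iota> c y" "\<iota> c (a *\<^sub>C x) = a *\<^sub>C \<iota> c x"
      "x \<in> topspace ?W \<Longrightarrow> \<iota> c x \<in> topspace ?W'" for c x y a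
    using cvec.subspace_0[OF tvs_subspace[OF V]]
    by (auto simp: \<iota>_def fun_eq_iff scaleC_fun_def topspace_jet_space split: list.split)
  have "hol_family S ?W' (\<lambda>\<nu>. \<iota> False (jet V \<Phi> \<eta>s \<nu> v1 + g' \<nu>) + \<iota> True (jet V \<Phi> \<eta>s \<nu> v2))"
    by (intro hol_family.add hol_family_compose[OF hol_family.add[OF g1 g'(1)]]
        hol_family_compose[OF g2] \<iota>)
  then show ?case
  proof (rule hol_family.cong)
    fix \<nu> assume "\<nu> \<in> S"
    then show "jet V \<Phi> (\<eta> # \<eta>s) \<nu> v =
        \<iota> False (jet V \<Phi> \<eta>s \<nu> v1 + g' \<nu>) + \<iota> True (jet V \<Phi> \<eta>s \<nu> v2)"
      unfolding jet.simps Let_def v1_def[symmetric] v2_def[symmetric]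
      by (auto simp: ld \<iota>_def fun_eq_iff split: list.split)
  qed
qed

text \<open>A \<open>line_deriv\<close> respects sums because both derivatives exist, by
  \<open>jet_hol_family\<close>. The induction keeps the parameter general, since additivity of the
  inner jet is used along the whole line through \<nu>.\<close>

lemma jet_add:
  assumes V: "tvs V" and S: "cvec.subspace S"
    and \<Phi>: "\<And>v. v \<in> topspace V \<Longrightarrow> hol_family S V (\<lambda>\<nu>. \<Phi> \<nu> v)"
    and \<Phi>_add: "\<And>\<nu> v w. \<nu> \<in> S \<Longrightarrow> v \<in> topspace V \<Longrightarrow> w \<in> topspace V \<Longrightarrow> \<Phi> \<nu> (v + w) = \<Phi> \<nu> v + \<Phi> \<nu> w"
    and "set \<eta>s \<subseteq> S" "\<nu> \<in> S"
    and "v \<in> topspace (jet_space (length \<eta>s) V)" "w \<in> topspace (jet_space (length \<eta>s) V)"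
  shows "jet V \<Phi> \<eta>s \<nu> (v + w) = jet V \<Phi> \<eta>s \<nu> v + jet V \<Phi> \<eta>s \<nu> w"
  using assms(5-)
proof (induction \<eta>s arbitrary: v w \<nu>)
  case Nil
  then show ?case by (auto simp: fun_eq_iff topspace_jet_space \<Phi>_add)
next
  case (Cons \<eta> \<eta>s)
  let ?W = "jet_space (length \<eta>s) V"
  note W = tvs_jet_space[OF V, of "length \<eta>s"]
  have \<eta>: "\<eta> \<in> S" and \<eta>s: "set \<eta>s \<subseteq> S" using Cons.prems by auto
  have mem: "(\<lambda>b. u (c # b)) \<in> topspace ?W" if "u \<in> topspace (jet_space (length (\<eta> # \<eta>s)) V)" for u c
    using that by (auto simp: topspace_jet_space)
  define v2 where "v2 = (\<lambda>b. v (True # b))"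
  define w2 where "w2 = (\<lambda>b. w (True # b))"
  have vw: "v2 \<in> topspace ?W" "w2 \<in> topspace ?W"
    using mem Cons.prems by (auto simp: v2_def w2_def)
  have line: "\<nu> + z *\<^sub>C \<eta> \<in> S" for z
    using Cons.prems(2) \<eta> cvec.subspace_add[OF S] cvec.subspace_scale[OF S] by blast
  have lim: "\<exists>d. limitin ?W (\<lambda>z. (1 / z) *\<^sub>C (jet V \<Phi> \<eta>s (\<nu> + z *\<^sub>C \<eta>) u - jet V \<Phi> \<eta>s \<nu> u)) d (at 0)"
    if "u \<in> topspace ?W" for u
  proof -
    have "hol_family S ?W (\<lambda>\<nu>. jet V \<Phi> \<eta>s \<nu> u)"
      by (rule jet_hol_family[OF V S _ \<eta>s that]) (rule \<Phi>)
    from hol_family_deriv[OF W S \<eta> this] show ?thesis using Cons.prems(2) by blast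
  qed
  obtain d where d: "limitin ?W (\<lambda>z. (1 / z) *\<^sub>C (jet V \<Phi> \<eta>s (\<nu> + z *\<^sub>C \<eta>) v2 - jet V \<Phi> \<eta>s \<nu> v2)) d (at 0)"
    using lim[OF vw(1)] by (elim exE)
  obtain e where e: "limitin ?W (\<lambda>z. (1 / z) *\<^sub>C (jet V \<Phi> \<eta>s (\<nu> + z *\<^sub>C \<eta>) w2 - jet V \<Phi> \<eta>s \<nu> w2)) e (at 0)"
    using lim[OF vw(2)] by (elim exE)
  have IH: "jet V \<Phi> \<eta>s \<mu> (a + b) = jet V \<Phi> \<eta>s \<mu> a + jet V \<Phi> \<eta>s \<mu> b"
    if "\<mu> \<in> S" "a \<in> topspace ?W" "b \<in> topspace ?W" for \<mu> a b
    by (rule Cons.IH[OF \<eta>s that])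
  have "limitin ?W (\<lambda>z. (1 / z) *\<^sub>C (jet V \<Phi> \<eta>s (\<nu> + z *\<^sub>C \<eta>) (v2 + w2) - jet V \<Phi> \<eta>s \<nu> (v2 + w2))) (d + e) (at 0)"
    using limitin_tvs_add[OF W d e]
    unfolding IH[OF line vw] IH[OF Cons.prems(2) vw] by (simp only: scaleC_add_right[symmetric] add_diff_add)
  then have "line_deriv ?W (\<lambda>z. jet V \<Phi> \<eta>s (\<nu> + z *\<^sub>C \<eta>) (v2 + w2)) = d + e"
    by (intro line_deriv_eq[OF W]) simp
  moreover have "line_deriv ?W (\<lambda>z. jet V \<Phi> \<eta>s (\<nu> + z *\<^sub>C \<eta>) v2) = d"
    using d by (intro line_deriv_eq[OF W]) simp
  moreover have "line_deriv ?W (\<lambda>z. jet V \<Phi> \<eta>s (\<nu> + z *\<^sub>C \<eta>) w2) = e"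
    using e by (intro line_deriv_eq[OF W]) simp
  ultimately have ld: "line_deriv ?W (\<lambda>z. jet V \<Phi> \<eta>s (\<nu> + z *\<^sub>C \<eta>) (v2 + w2)) =
      line_deriv ?W (\<lambda>z. jet V \<Phi> \<eta>s (\<nu> + z *\<^sub>C \<eta>) v2) + line_deriv ?W (\<lambda>z. jet V \<Phi> \<eta>s (\<nu> + z *\<^sub>C \<eta>) w2)"
    by (simp only:)
  have slice: "(\<lambda>b. (v + w) (c # b)) = (\<lambda>b. v (c # b)) + (\<lambda>b. w (c # b))" for c
    by (simp add: fun_eq_iff)
  show ?case
    unfolding jet.simps Let_def slice v2_def[symmetric] w2_def[symmetric] ld
      IH[OF Cons.prems(2) vw] IH[OF Cons.prems(2) mem[OF Cons.prems(3)] mem[OF Cons.prems(4)]]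
    by (auto simp: fun_eq_iff split: list.split)
qed


subsection \<open>The space of smooth sections\<close>

lemma has_lderiv_add:
  assumes "tvs V" "has_lderiv G V X f x a" "has_lderiv G V X g x b"
  shows "has_lderiv G V X (f + g) x (a + b)"
  using limitin_tvs_add[OF assms(1) assms(2,3)[unfolded has_lderiv_def]]
  unfolding has_lderiv_def plus_fun_apply add_diff_add scaleC_add_right .

lemma has_lderiv_scale:
  assumes "tvs V" "has_lderiv G V X f x a"
  shows "has_lderiv G V X (c *\<^sub>C f) x (c *\<^sub>C a)"
proof -
  have "limitin V (\<lambda>t. c *\<^sub>C complex_of_real (1 / t) *\<^sub>C (f (x \<otimes>\<^bsub>G\<^esub> gexp G (t *\<^sub>R X)) - f x))
      (c *\<^sub>C a) (at 0)"
    using assms(2) unfolding has_lderiv_def by (intro limitin_tvs_scale[OF assms(1)]) auto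
  then show ?thesis
    unfolding has_lderiv_def scaleC_fun_def
    by (simp add: cvec.scale_right_diff_distrib mult.commute)
qed

lemma has_lderiv_zero:
  assumes "tvs V" shows "has_lderiv G V X 0 x 0"
  using cvec.subspace_0[OF tvs_subspace[OF assms]] by (simp add: has_lderiv_def)

lemma lderiv_eq:
  assumes "tvs V" "has_lderiv G V X f x w" "x \<in> H"
  shows "lderiv G H V X f x = w"
proof -
  have "(THE w. has_lderiv G V X f x w) = w"
  proof (rule the_equality)
    show "w' = w" if "has_lderiv G V X f x w'" for w'
      using that assms(2) tvs_Hausdorff[OF assms(1)] unfolding has_lderiv_def
      by (intro limitin_Hausdorff_unique) auto
  qed (rule assms(2))
  then show ?thesis using assms(3) by (simp add: lderiv_def)
qed

text \<open>\<open>lderiv\<close> is a description, so the sum rule for limits becomes an equation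
  of functions once the derivatives exist at every point of \<open>H\<close>; off \<open>H\<close>
  both sides are 0 by definition.\<close>

lemma lderiv_add:
  assumes V: "tvs V" and f: "\<forall>x\<in>H. \<exists>w. has_lderiv G V X f x w" and g: "\<forall>x\<in>H. \<exists>w. has_lderiv G V X g x w"
  shows "lderiv G H V X (f + g) = lderiv G H V X f + lderiv G H V X g"
proof
  fix x
  show "lderiv G H V X (f + g) x = (lderiv G H V X f + lderiv G H V X g) x"
  proof (cases "x \<in> H")
    case True
    then obtain a b where ab: "has_lderiv G V X f x a" "has_lderiv G V X g x b" using f g by blast
    show ?thesis
      using lderiv_eq[OF V has_lderiv_add[OF V ab] True] lderiv_eq[OF V ab(1) True] lderiv_eq[OF V ab(2) True]
      by simp
  qed (simp add: lderiv_def)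
qed

lemma lderiv_scale:
  assumes V: "tvs V" and f: "\<forall>x\<in>H. \<exists>w. has_lderiv G V X f x w"
  shows "lderiv G H V X (c *\<^sub>C f) = c *\<^sub>C lderiv G H V X f"
proof
  fix x
  show "lderiv G H V X (c *\<^sub>C f) x = (c *\<^sub>C lderiv G H V X f) x"
  proof (cases "x \<in> H")
    case True
    then obtain a where a: "has_lderiv G V X f x a" using f by blast
    show ?thesis
      using lderiv_eq[OF V has_lderiv_scale[OF V a] True] lderiv_eq[OF V a True]
      by (simp add: scaleC_fun_def)
  qed (simp add: lderiv_def scaleC_fun_def)
qed

lemma lderiv_zero:
  assumes "tvs V" shows "lderiv G H V X 0 = 0"
proof
  fix x show "lderiv G H V X 0 x = 0 x"
    using lderiv_eq[OF assms has_lderiv_zero[OF assms], of x H G X]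
    by (cases "x \<in> H") (simp, simp add: lderiv_def)
qed

lemma Ck_on_continuous: "Ck_on G H V n f \<Longrightarrow> continuous_map (subtopology (gtop G) H) V f"
  by (cases n) auto

lemma Ck_on_add:
  assumes V: "tvs V"
  shows "Ck_on G H V n f \<Longrightarrow> Ck_on G H V n g \<Longrightarrow> Ck_on G H V n (f + g)"
proof (induction n arbitrary: f g)
  case 0
  then show ?case using continuous_map_tvs_add[OF V] by (simp add: plus_fun_def)
next
  case (Suc n)
  have "continuous_map (subtopology (gtop G) H) V (f + g)"
    unfolding plus_fun_def
    by (rule continuous_map_tvs_add[OF V Ck_on_continuous[OF Suc.prems(1)] Ck_on_continuous[OF Suc.prems(2)]])
  moreover have "(\<forall>x\<in>H. \<exists>w. has_lderiv G V X (f + g) x w) \<and> Ck_on G H V n (lderiv G H V X (f + g))"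
    if X: "X \<in> lie G H" for X
  proof -
    have fg: "\<forall>x\<in>H. \<exists>w. has_lderiv G V X f x w" "\<forall>x\<in>H. \<exists>w. has_lderiv G V X g x w"
      "Ck_on G H V n (lderiv G H V X f)" "Ck_on G H V n (lderiv G H V X g)"
      using Suc.prems X by auto
    show ?thesis
      unfolding lderiv_add[OF V fg(1,2)]
    proof (intro conjI ballI)
      fix x assume "x \<in> H"
      then obtain a b where "has_lderiv G V X f x a" "has_lderiv G V X g x b" using fg(1,2) by blast
      from has_lderiv_add[OF V this] show "\<exists>w. has_lderiv G V X (f + g) x w" by (rule exI)
    qed (rule Suc.IH[OF fg(3,4)])
  qed
  ultimately show ?case unfolding Ck_on.simps by blast
qed

lemma Ck_on_scale:
  assumes V: "tvs V"
  shows "Ck_on G H V n f \<Longrightarrow> Ck_on G H V n (c *\<^sub>C f)"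
proof (induction n arbitrary: f)
  case 0
  then show ?case
    unfolding Ck_on.simps scaleC_fun_def by (intro continuous_map_tvs_scale[OF V]) auto
next
  case (Suc n)
  have "continuous_map (subtopology (gtop G) H) V (c *\<^sub>C f)"
    unfolding scaleC_fun_def
    by (intro continuous_map_tvs_scale[OF V _ Ck_on_continuous[OF Suc.prems]]) auto
  moreover have "(\<forall>x\<in>H. \<exists>w. has_lderiv G V X (c *\<^sub>C f) x w) \<and> Ck_on G H V n (lderiv G H V X (c *\<^sub>C f))"
    if X: "X \<in> lie G H" for X
  proof -
    have f: "\<forall>x\<in>H. \<exists>w. has_lderiv G V X f x w" "Ck_on G H V n (lderiv G H V X f)"
      using Suc.prems X by auto
    show ?thesis
      unfolding lderiv_scale[OF V f(1)]
    proof (intro conjI ballI)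
      fix x assume "x \<in> H"
      then obtain a where "has_lderiv G V X f x a" using f(1) by blast
      from has_lderiv_scale[OF V this] show "\<exists>w. has_lderiv G V X (c *\<^sub>C f) x w" by (rule exI)
    qed (rule Suc.IH[OF f(2)])
  qed
  ultimately show ?case by simp
qed

lemma Ck_on_zero:
  assumes V: "tvs V" shows "Ck_on G H V n 0"
proof (induction n)
  have c: "continuous_map (subtopology (gtop G) H) V 0"
    unfolding zero_fun_def using cvec.subspace_0[OF tvs_subspace[OF V]]
    by (simp only: continuous_map_const) simp
  case 0
  show ?case unfolding Ck_on.simps by (rule c)
  case (Suc n)
  show ?case
    unfolding Ck_on.simps lderiv_zero[OF V] using c Suc has_lderiv_zero[OF V, of G _ _] by (intro conjI ballI exI)
qed

lemma smooth_on_group_lderiv: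
  assumes "smooth_on_group G H V f" "X \<in> lie G H"
  shows "smooth_on_group G H V (lderiv G H V X f)" "\<forall>x\<in>H. \<exists>w. has_lderiv G V X f x w"
proof -
  have "Ck_on G H V (Suc n) f" for n using assms(1) unfolding smooth_on_group_def by blast
  then show "smooth_on_group G H V (lderiv G H V X f)" "\<forall>x\<in>H. \<exists>w. has_lderiv G V X f x w"
    using assms(2) by (auto simp: smooth_on_group_def)
qed

lemma smooth_on_group_fold:
  "smooth_on_group G H V f \<Longrightarrow> set Xs \<subseteq> lie G H \<Longrightarrow> smooth_on_group G H V (fold (lderiv G H V) Xs f)"
  by (induction Xs arbitrary: f) (auto intro: smooth_on_group_lderiv)

lemma smooth_on_group_add:
  "tvs V \<Longrightarrow> smooth_on_group G H V f \<Longrightarrow> smooth_on_group G H V g \<Longrightarrow> smooth_on_group G H V (f + g)"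
  by (simp add: smooth_on_group_def Ck_on_add)

lemma smooth_on_group_scale:
  "tvs V \<Longrightarrow> smooth_on_group G H V f \<Longrightarrow> smooth_on_group G H V (c *\<^sub>C f)"
  by (simp add: smooth_on_group_def Ck_on_scale)

text \<open>Smoothness provides the existence of each derivative in the word \<open>Xs\<close>, and
  it persists after every step.\<close>

lemma fold_lderiv_add:
  assumes V: "tvs V" and "smooth_on_group G H V f" "smooth_on_group G H V g" "set Xs \<subseteq> lie G H"
  shows "fold (lderiv G H V) Xs (f + g) = fold (lderiv G H V) Xs f + fold (lderiv G H V) Xs g"
  using assms(2-)
proof (induction Xs arbitrary: f g)
  case (Cons X Xs)
  then have X: "X \<in> lie G H" by simp
  note sm = smooth_on_group_lderiv[OF Cons.prems(1) X] smooth_on_group_lderiv[OF Cons.prems(2) X]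
  show ?case
    unfolding fold_Cons o_apply lderiv_add[OF V sm(2,4)]
    by (rule Cons.IH[OF sm(1,3)]) (use Cons.prems(3) in simp)
qed simp

lemma fold_lderiv_scale:
  assumes V: "tvs V" and "smooth_on_group G H V f" "set Xs \<subseteq> lie G H"
  shows "fold (lderiv G H V) Xs (c *\<^sub>C f) = c *\<^sub>C fold (lderiv G H V) Xs f"
  using assms(2-)
proof (induction Xs arbitrary: f)
  case (Cons X Xs)
  then have X: "X \<in> lie G H" by simp
  note sm = smooth_on_group_lderiv[OF Cons.prems(1) X]
  show ?case
    unfolding fold_Cons o_apply lderiv_scale[OF V sm(2)]
    by (rule Cons.IH[OF sm(1)]) (use Cons.prems(2) in simp)
qed simp

section \<open>The topology of \<open>K_space\<close>: its seminorms and the Hausdorff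
  property\<close>

lemma seminorm_onI:
  assumes C: "cvec.subspace C" and "\<And>x. x \<in> C \<Longrightarrow> 0 \<le> p x"
    and "\<And>x y. x \<in> C \<Longrightarrow> y \<in> C \<Longrightarrow> p (x + y) \<le> p x + p y"
    and le: "\<And>c x. x \<in> C \<Longrightarrow> p (c *\<^sub>C x) \<le> cmod c * p x"
  shows "seminorm_on C p"
proof -
  have "p (c *\<^sub>C x) = cmod c * p x" if x: "x \<in> C" for c x
  proof (rule antisym[OF le[OF x]])
    have cx: "c *\<^sub>C x \<in> C" using cvec.subspace_scale[OF C x] .
    show "cmod c * p x \<le> p (c *\<^sub>C x)"
    proof (cases "c = 0")
      case True then show ?thesis using assms(2)[OF cx] by simp
    next
      case False
      \<comment> \<open>Suprema yield the upper estimate directly; the lower one is extracted by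
        applying it to the inverse scalar.\<close>
      have "p (inverse c *\<^sub>C c *\<^sub>C x) \<le> cmod (inverse c) * p (c *\<^sub>C x)" by (rule le[OF cx])
      then have "p x \<le> inverse (cmod c) * p (c *\<^sub>C x)"
        using False by (simp add: scaleC_scaleC scaleC_one norm_inverse)
      then show ?thesis using False by (simp add: field_simps)
    qed
  qed
  then show ?thesis unfolding seminorm_on_def using assms(2,3) by blast
qed

text \<open>Compactness of \<open>K\<close> makes the suprema finite: iterated derivatives are
  continuous, hence \<open>q\<close> of them is bounded on \<open>K\<close>. The second claim, that
  values lie below the supremum, later detects non-zero sections.\<close>

lemma seminorm_on_SUP_fold:
  assumes V: "tvs V" and C: "cvec.subspace C" "\<And>f. f \<in> C \<Longrightarrow> smooth_on_group G K V f"
    and K: "compactin (gtop G) K" "K \<noteq> {}"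
    and q: "q \<in> continuous_seminorms V" and Xs: "set Xs \<subseteq> lie G K"
  shows "seminorm_on C (\<lambda>f. SUP k\<in>K. q (fold (lderiv G K V) Xs f k))"
    and "f \<in> C \<Longrightarrow> k \<in> K \<Longrightarrow> q (fold (lderiv G K V) Xs f k) \<le> (SUP k\<in>K. q (fold (lderiv G K V) Xs f k))"
proof -
  let ?D = "fold (lderiv G K V) Xs"
  have q': "seminorm_on (topspace V) q" "continuous_map V euclideanreal q"
    using q by (auto simp: continuous_seminorms_def)
  have cont: "continuous_map (subtopology (gtop G) K) V (?D f)" if "f \<in> C" for f
    using smooth_on_group_fold[OF C(2)[OF that] Xs] unfolding smooth_on_group_def
    by (blast intro: Ck_on_continuous)
  have top: "?D f k \<in> topspace V" if "f \<in> C" "k \<in> K" for f k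
  proof -
    have "k \<in> topspace (subtopology (gtop G) K)"
      using that(2) compactin_subset_topspace[OF K(1)] by auto
    then show ?thesis using cont[OF that(1)] by (auto simp: continuous_map_def)
  qed
  have bdd: "bdd_above ((\<lambda>k. q (?D f k)) ` K)" if "f \<in> C" for f
  proof -
    have "continuous_map (subtopology (gtop G) K) euclideanreal (q \<circ> ?D f)"
      by (rule continuous_map_compose[OF cont[OF that] q'(2)])
    moreover have "compactin (subtopology (gtop G) K) K" using K(1) by (simp add: compactin_subtopology)
    ultimately have "compactin euclideanreal ((q \<circ> ?D f) ` K)" by (rule image_compactin[rotated])
    then have "compact ((\<lambda>k. q (?D f k)) ` K)" by (simp add: o_def)
    then show ?thesis by (intro bounded_imp_bdd_above compact_imp_bounded)
  qed
  have le: "q (?D f k) \<le> (SUP k\<in>K. q (?D f k))" if "f \<in> C" "k \<in> K" for f k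
    using bdd[OF that(1)] that(2) by (intro cSUP_upper)
  show "f \<in> C \<Longrightarrow> k \<in> K \<Longrightarrow> q (?D f k) \<le> (SUP k\<in>K. q (?D f k))" by (rule le)
  show "seminorm_on C (\<lambda>f. SUP k\<in>K. q (?D f k))"
  proof (rule seminorm_onI[OF C(1)])
    fix f assume f: "f \<in> C"
    obtain k where k: "k \<in> K" using K(2) by blast
    have "0 \<le> q (?D f k)" using q'(1) top[OF f k] unfolding seminorm_on_def by blast
    also have "\<dots> \<le> (SUP k\<in>K. q (?D f k))" by (rule le[OF f k])
    finally show "0 \<le> (SUP k\<in>K. q (?D f k))" .
  next
    fix f g assume f: "f \<in> C" and g: "g \<in> C"
    show "(SUP k\<in>K. q (?D (f + g) k)) \<le> (SUP k\<in>K. q (?D f k)) + (SUP k\<in>K. q (?D g k))"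
    proof (rule cSUP_least[OF K(2)])
      fix k assume k: "k \<in> K"
      have "q (?D f k + ?D g k) \<le> q (?D f k) + q (?D g k)"
        using q'(1) top[OF f k] top[OF g k] unfolding seminorm_on_def by blast
      also have "\<dots> \<le> (SUP k\<in>K. q (?D f k)) + (SUP k\<in>K. q (?D g k))"
        by (rule add_mono[OF le[OF f k] le[OF g k]])
      finally show "q (?D (f + g) k) \<le> (SUP k\<in>K. q (?D f k)) + (SUP k\<in>K. q (?D g k))"
        unfolding fold_lderiv_add[OF V C(2)[OF f] C(2)[OF g] Xs] plus_fun_apply .
    qed
  next
    fix c f assume f: "f \<in> C"
    show "(SUP k\<in>K. q (?D (c *\<^sub>C f) k)) \<le> cmod c * (SUP k\<in>K. q (?D f k))"
    proof (rule cSUP_least[OF K(2)])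
      fix k assume k: "k \<in> K"
      have "q (c *\<^sub>C ?D f k) = cmod c * q (?D f k)"
        using q'(1) top[OF f k] unfolding seminorm_on_def by blast
      also have "\<dots> \<le> cmod c * (SUP k\<in>K. q (?D f k))"
        by (rule mult_left_mono[OF le[OF f k]]) simp
      finally show "q (?D (c *\<^sub>C f) k) \<le> cmod c * (SUP k\<in>K. q (?D f k))"
        unfolding fold_lderiv_scale[OF V C(2)[OF f] Xs] by (simp only: scaleC_fun_def)
    qed
  qed
qed

text \<open>\<open>K_space\<close> is built from all continuous seminorms, whereas the Frechet
  structure provides a defining sequence; each of its members is continuous for the topology that it
  helps to generate.\<close>

lemma frechet_space_separating:
  assumes "frechet_space V" "x \<in> topspace V" "x \<noteq> 0"
  shows "\<exists>q\<in>continuous_seminorms V. q x \<noteq> 0"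
proof -
  have "cvec.subspace (topspace V)" using assms(1) unfolding frechet_space_def by (rule conjunct1)
  moreover obtain p :: "nat \<Rightarrow> 'a \<Rightarrow> real" where p: "\<forall>n. seminorm_on (topspace V) (p n)"
      "\<forall>x\<in>topspace V. (\<forall>n. p n x = 0) \<longrightarrow> x = 0"
      "V = seminorm_topology (topspace V) (range p)"
    using assms(1) unfolding frechet_space_def by (elim conjE exE)
  ultimately have "continuous_map (seminorm_topology (topspace V) (range p)) euclideanreal (p n)" for n
    by (intro continuous_map_seminorm) auto
  then have "p n \<in> continuous_seminorms V" for n
    unfolding p(3)[symmetric] continuous_seminorms_def using p(1) by blast
  moreover obtain n where "p n x \<noteq> 0" using p(2) assms(2,3) by blast
  ultimately show ?thesis by blast
qed

lemma K_sections_subspace: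
  assumes R: "representation G M \<xi>" and M: "Kgrp G \<inter> M_of G H Q \<subseteq> M"
    and K: "Kgrp G \<inter> H \<subseteq> topspace (gtop G)"
  shows "cvec.subspace (K_sections G H Q \<xi>)"
proof -
  let ?K = "Kgrp G \<inter> H" and ?M = "Kgrp G \<inter> M_of G H Q"
  have lin: "clinear_on (topspace (rspace \<xi>)) (ract \<xi> m)" if "m \<in> ?M" for m
    using R M that unfolding representation_def by blast
  have V: "tvs (rspace \<xi>)" using R unfolding representation_def by blast
  have top: "\<psi> k \<in> topspace (rspace \<xi>)" if "smooth_on_group G ?K (rspace \<xi>) \<psi>" "k \<in> ?K" for \<psi> k
  proof -
    have "Ck_on G ?K (rspace \<xi>) 0 \<psi>" using that(1) unfolding smooth_on_group_def by blast
    then show ?thesis using that(2) K by (auto simp: continuous_map_def)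
  qed
  have add: "ract \<xi> m (x + y) = ract \<xi> m x + ract \<xi> m y"
    if "m \<in> ?M" "x \<in> topspace (rspace \<xi>)" "y \<in> topspace (rspace \<xi>)" for m x y
    using lin[OF that(1)] that(2,3) unfolding clinear_on_def by blast
  have scale: "ract \<xi> m (c *\<^sub>C x) = c *\<^sub>C ract \<xi> m x"
    if "m \<in> ?M" "x \<in> topspace (rspace \<xi>)" for m x c
    using lin[OF that(1)] that(2) unfolding clinear_on_def by blast
  show ?thesis
    unfolding cvec.subspace_def
  proof (intro conjI ballI allI)
    have "ract \<xi> m 0 = 0" if "m \<in> ?M" for m
      using scale[OF that cvec.subspace_0[OF tvs_subspace[OF V]], of 0] by simp
    then show "0 \<in> K_sections G H Q \<xi>"
      using Ck_on_zero[OF V] by (auto simp: K_sections_def smooth_on_group_def)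
  next
    fix f g assume "f \<in> K_sections G H Q \<xi>" and "g \<in> K_sections G H Q \<xi>"
    then show "f + g \<in> K_sections G H Q \<xi>"
      using top add smooth_on_group_add[OF V] unfolding K_sections_def by auto
  next
    fix c f assume "f \<in> K_sections G H Q \<xi>"
    then show "c *\<^sub>C f \<in> K_sections G H Q \<xi>"
      using top scale smooth_on_group_scale[OF V] unfolding K_sections_def by (auto simp: scaleC_fun_def)
  qed
qed

text \<open>For the Hausdorff property, a non-zero section is non-zero at some \<open>k\<close>, a
  continuous seminorm of \<open>\<xi>\<close> sees that value, and the supremum seminorm for the
  empty word of derivatives inherits it.\<close>

lemma tvs_K_space:
  assumes R: "representation G M \<xi>" "frechet_space (rspace \<xi>)" and M: "Kgrp G \<inter> M_of G H Q \<subseteq> M"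
    and K: "compactin (gtop G) (Kgrp G \<inter> H)" "Kgrp G \<inter> H \<noteq> {}"
  shows "tvs (K_space G H Q \<xi>)"
  unfolding K_space_def
proof (rule tvs_seminorm_topology)
  let ?K = "Kgrp G \<inter> H" and ?C = "K_sections G H Q \<xi>"
  have V: "tvs (rspace \<xi>)" using R(1) unfolding representation_def by blast
  note KX = compactin_subset_topspace[OF K(1)]
  show C: "cvec.subspace ?C" by (rule K_sections_subspace[OF R(1) M KX])
  have smooth: "smooth_on_group G ?K (rspace \<xi>) f" if "f \<in> ?C" for f
    using that by (simp add: K_sections_def)
  note sn = seminorm_on_SUP_fold[OF V C smooth K]
  show "seminorm_on ?C p" if "p \<in> {(\<lambda>\<psi>. SUP k\<in>?K. q (fold (lderiv G ?K (rspace \<xi>)) Xs \<psi> k)) | q Xs.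
      q \<in> continuous_seminorms (rspace \<xi>) \<and> set Xs \<subseteq> lie G ?K}" for p
    using that sn(1) by blast
  fix f assume f: "f \<in> ?C" "f \<noteq> 0"
  then obtain k where fk: "f k \<noteq> 0" by (auto simp: fun_eq_iff)
  then have k: "k \<in> ?K" using f(1) by (auto simp: K_sections_def)
  have "Ck_on G ?K (rspace \<xi>) 0 f" using smooth[OF f(1)] unfolding smooth_on_group_def by blast
  then have "f k \<in> topspace (rspace \<xi>)" using k KX by (auto simp: continuous_map_def)
  then obtain q where q: "q \<in> continuous_seminorms (rspace \<xi>)" "q (f k) \<noteq> 0" "0 \<le> q (f k)"
    using frechet_space_separating[OF R(2) _ fk]
    unfolding continuous_seminorms_def seminorm_on_def by blast
  let ?p = "\<lambda>\<psi>. SUP k\<in>?K. q (fold (lderiv G ?K (rspace \<xi>)) [] \<psi> k)"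
  have "q (f k) \<le> ?p f" using sn(2)[OF _ q(1) _ f(1) k, of "[]"] by simp
  then have "?p f \<noteq> 0" using q by linarith
  moreover have "?p \<in> {(\<lambda>\<psi>. SUP k\<in>?K. q (fold (lderiv G ?K (rspace \<xi>)) Xs \<psi> k)) | q Xs.
      q \<in> continuous_seminorms (rspace \<xi>) \<and> set Xs \<subseteq> lie G ?K}"
    using q(1) by (intro CollectI exI[of _ q] exI[of _ "[]"]) auto
  ultimately show "\<exists>p\<in>{(\<lambda>\<psi>. SUP k\<in>?K. q (fold (lderiv G ?K (rspace \<xi>)) Xs \<psi> k)) | q Xs.
      q \<in> continuous_seminorms (rspace \<xi>) \<and> set Xs \<subseteq> lie G ?K}. p f \<noteq> 0"
    by (rule bexI)
qed


subsection \<open>The operators attached to data\<close>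

lemma Kgrp_compact:
  assumes "real_reductive G"
  shows "compactin (gtop G) (Kgrp G \<inter> carrier G)" "Kgrp G \<inter> carrier G \<noteq> {}"
proof -
  have K: "subgroup (Kgrp G) G" "compactin (gtop G) (Kgrp G)"
    using assms by (auto simp: real_reductive_def maximal_compact_def)
  have "Kgrp G \<inter> carrier G = Kgrp G" using subgroup.subset[OF K(1)] by blast
  then show "compactin (gtop G) (Kgrp G \<inter> carrier G)" "Kgrp G \<inter> carrier G \<noteq> {}"
    using K subgroup.one_closed[OF K(1)] by auto
qed

lemma tvs_CK:
  assumes G: "real_reductive G" and \<Xi>: "globalization_choice G \<Xi>"
    and P: "P \<in> parabolics G" and \<xi>: "\<xi> \<in> Mds G \<Xi> P"
  shows "tvs (CK G P \<xi>)"
proof -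
  obtain \<omega> where \<omega>: "\<xi> = \<Xi> (MP G P) \<omega>" "discrete_series G (MP G P) \<omega>"
    using \<xi> unfolding Mds_def by blast
  then have "irreducible_unitary G (MP G P) \<omega>" by (simp add: discrete_series_def)
  then have "smooth_frechet_rep G (MP G P) \<xi>"
    using \<Xi> P unfolding \<omega>(1) globalization_choice_def by blast
  then show ?thesis
    by (intro tvs_K_space[OF _ _ _ Kgrp_compact[OF G], of "MP G P"])
      (auto simp: smooth_frechet_rep_def)
qed

lemma S_xi_topspace: "S \<in> S_xi G P \<xi> \<Longrightarrow> v \<in> topspace (CK G P \<xi>) \<Longrightarrow> S v \<in> topspace (CK G P \<xi>)"
  unfolding S_xi_def continuous_map_def by blast

lemma S_xi_add:
  "S \<in> S_xi G P \<xi> \<Longrightarrow> v \<in> topspace (CK G P \<xi>) \<Longrightarrow> w \<in> topspace (CK G P \<xi>) \<Longrightarrow> S (v + w) = S v + S w"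
  unfolding S_xi_def clinear_on_def by blast

text \<open>Evaluated at \<open>v\<close>, a finite sum of scalar functions times operators becomes
  a sum with the fixed vectors \<open>s i \<xi> v\<close>, which stay in the space because elements
  of \<open>S_xi\<close> are endomorphisms.\<close>

lemma F_P_family:
  assumes "\<Phi> \<in> F_P G \<Xi> P" "\<xi> \<in> Mds G \<Xi> P"
  shows "v \<in> topspace (CK G P \<xi>) \<Longrightarrow> hol_family (aC_dual G P) (CK G P \<xi>) (\<lambda>\<nu>. \<Phi> \<xi> \<nu> v)"
    and "\<nu> \<in> aC_dual G P \<Longrightarrow> v \<in> topspace (CK G P \<xi>) \<Longrightarrow> w \<in> topspace (CK G P \<xi>) \<Longrightarrow>
      \<Phi> \<xi> \<nu> (v + w) = \<Phi> \<xi> \<nu> v + \<Phi> \<xi> \<nu> w"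
proof -
  obtain n f s where fs: "\<forall>i<(n::nat). holomorphic_dual (aC_dual G P) (f i) \<and> s i \<in> S_P G \<Xi> P"
      "\<Phi> = (\<lambda>\<xi> \<nu>. if \<nu> \<in> aC_dual G P then \<Sum>i<n. f i \<nu> *\<^sub>C s i \<xi> else 0)"
    using assms(1) unfolding F_P_def mem_Collect_eq by (elim exE conjE)
  have S: "s i \<xi> \<in> S_xi G P \<xi>" if "i < n" for i
    using fs(1) that assms(2) unfolding S_P_def by blast
  have sum_apply: "(\<Sum>i<m. f i \<nu> *\<^sub>C s i \<xi>) v = (\<Sum>i<m. f i \<nu> *\<^sub>C s i \<xi> v)" for m v \<nu>
  proof (induction m)
    case (Suc m)
    then show ?case by (simp only: sum.lessThan_Suc plus_fun_apply) (simp add: scaleC_fun_def)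
  qed simp
  have eq: "\<Phi> \<xi> \<nu> v = (\<Sum>i<n. f i \<nu> *\<^sub>C s i \<xi> v)" if "\<nu> \<in> aC_dual G P" for \<nu> v
    using that by (simp only: fs(2) if_True sum_apply)
  show "hol_family (aC_dual G P) (CK G P \<xi>) (\<lambda>\<nu>. \<Phi> \<xi> \<nu> v)" if v: "v \<in> topspace (CK G P \<xi>)"
  proof (rule hol_family.cong)
    show "hol_family (aC_dual G P) (CK G P \<xi>) (\<lambda>\<nu>. \<Sum>i<n. f i \<nu> *\<^sub>C s i \<xi> v)"
    proof (rule hol_family_sum)
      fix i assume i: "i < n"
      then have "holomorphic_dual (aC_dual G P) (f i)" using fs(1) by blast
      then show "hol_family (aC_dual G P) (CK G P \<xi>) (\<lambda>\<nu>. f i \<nu> *\<^sub>C s i \<xi> v)"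
        by (intro hol_family.scale gholomorphic_holomorphic_dual S_xi_topspace[OF S[OF i] v])
    qed
  qed (rule eq)
  show "\<Phi> \<xi> \<nu> (v + w) = \<Phi> \<xi> \<nu> v + \<Phi> \<xi> \<nu> w"
    if "\<nu> \<in> aC_dual G P" "v \<in> topspace (CK G P \<xi>)" "w \<in> topspace (CK G P \<xi>)"
  proof -
    have "(\<Sum>i<n. f i \<nu> *\<^sub>C s i \<xi> (v + w)) = (\<Sum>i<n. f i \<nu> *\<^sub>C s i \<xi> v + f i \<nu> *\<^sub>C s i \<xi> w)"
      by (intro sum.cong refl) (simp only: lessThan_iff S_xi_add[OF S that(2,3)] scaleC_add_right)
    then show ?thesis unfolding eq[OF that(1)] sum.distrib .
  qed
qed

context
  fixes G :: "('g, 'e::euclidean_space) reductive_data"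
    and \<Xi> :: "'g set \<Rightarrow> 'g unitary \<Rightarrow> ('g, 'v::complex_space) rep"
    and \<phi> :: "'g set \<Rightarrow> ('g, 'v) rep \<Rightarrow> ('e \<Rightarrow> complex) \<Rightarrow> ('g \<Rightarrow> 'v) \<Rightarrow> 'g \<Rightarrow> 'v"
  assumes G: "real_reductive G" and \<Xi>: "globalization_choice G \<Xi>" and \<phi>: "\<phi> \<in> F_space G \<Xi>"
begin

lemma datum_properties:
  assumes "d \<in> D_data G \<Xi>"
  shows "tvs (datum_space G d)"
    and "v \<in> topspace (datum_space G d) \<Longrightarrow> datum_phi G \<phi> d v \<in> topspace (datum_space G d)"
    and "v \<in> topspace (datum_space G d) \<Longrightarrow> w \<in> topspace (datum_space G d) \<Longrightarrow>
      datum_phi G \<phi> d (v + w) = datum_phi G \<phi> d v + datum_phi G \<phi> d w"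
proof -
  obtain P \<xi> \<nu> \<eta>s where d: "d = (P, \<xi>, \<nu>, \<eta>s)" "P \<in> parabolics G" "\<xi> \<in> Mds G \<Xi> P"
      "\<nu> \<in> aC_dual G P" "set \<eta>s \<subseteq> aC_dual G P"
    using assms unfolding D_data_def by blast
  have F: "\<phi> P \<in> F_P G \<Xi> P" using \<phi> d(2) unfolding F_space_def by blast
  note V = tvs_CK[OF G \<Xi> d(2,3)]
  show "tvs (datum_space G d)" unfolding d(1) datum_space.simps by (rule tvs_jet_space[OF V])
  show "datum_phi G \<phi> d v \<in> topspace (datum_space G d)" if "v \<in> topspace (datum_space G d)"
    using that unfolding d(1) datum_space.simps datum_phi.simps
    by (intro hol_family_topspace[OF jet_hol_family[OF V aC_dual_subspace _ d(5)] tvs_jet_space[OF V] d(4)]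
        F_P_family(1)[OF F d(3)])
  show "datum_phi G \<phi> d (v + w) = datum_phi G \<phi> d v + datum_phi G \<phi> d w"
    if "v \<in> topspace (datum_space G d)" "w \<in> topspace (datum_space G d)"
    using that unfolding d(1) datum_space.simps datum_phi.simps
    by (intro jet_add[OF V aC_dual_subspace _ _ d(5,4)] F_P_family[OF F d(3)])
qed

lemma delta_properties:
  assumes \<delta>: "set \<delta> \<subseteq> D_data G \<Xi>"
  shows "tvs (rspace (pi_delta G \<delta>))"
    and "v \<in> topspace (rspace (pi_delta G \<delta>)) \<Longrightarrow> phi_delta G \<phi> \<delta> v \<in> topspace (rspace (pi_delta G \<delta>))"
    and "v \<in> topspace (rspace (pi_delta G \<delta>)) \<Longrightarrow> w \<in> topspace (rspace (pi_delta G \<delta>)) \<Longrightarrow>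
      phi_delta G \<phi> \<delta> (v + w) = phi_delta G \<phi> \<delta> v + phi_delta G \<phi> \<delta> w"
proof -
  have d: "\<delta> ! i \<in> D_data G \<Xi>" if "i < length \<delta>" for i using \<delta> that by (meson nth_mem subsetD)
  show "tvs (rspace (pi_delta G \<delta>))"
    using datum_properties(1)[OF d] by (auto simp: pi_delta_def intro!: tvs_direct_sum)
  show "phi_delta G \<phi> \<delta> v \<in> topspace (rspace (pi_delta G \<delta>))" if "v \<in> topspace (rspace (pi_delta G \<delta>))"
    using that datum_properties(2)[OF d] by (auto simp: pi_delta_def phi_delta_def topspace_direct_sum)
  show "phi_delta G \<phi> \<delta> (v + w) = phi_delta G \<phi> \<delta> v + phi_delta G \<phi> \<delta> w"
    if v: "v \<in> topspace (rspace (pi_delta G \<delta>))" and w: "w \<in> topspace (rspace (pi_delta G \<delta>))"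
  proof
    fix i
    show "phi_delta G \<phi> \<delta> (v + w) i = (phi_delta G \<phi> \<delta> v + phi_delta G \<phi> \<delta> w) i"
    proof (cases "i < length \<delta>")
      case True
      then have "v i \<in> topspace (datum_space G (\<delta> ! i))" "w i \<in> topspace (datum_space G (\<delta> ! i))"
        using v w by (auto simp: pi_delta_def topspace_direct_sum)
      from datum_properties(3)[OF d[OF True] this] True show ?thesis by (simp add: phi_delta_def)
    qed (simp add: phi_delta_def)
  qed
qed

end


subsection \<open>Graphs of intertwining operators\<close>

text \<open>With \<open>n = length \<delta>1\<close>, \<open>left_part\<close>,
  \<open>right_part\<close> and \<open>join_parts\<close> are the projections and the pairing that
  identify the space of \<open>\<delta>1 @ \<delta>2\<close> with a product.
  \<open>left_part\<close> cuts off explicitly; \<open>right_part\<close> relies on families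
  vanishing beyond the total length.\<close>

definition left_part :: "nat \<Rightarrow> (nat \<Rightarrow> 'a::zero) \<Rightarrow> nat \<Rightarrow> 'a"
  where "left_part n v = (\<lambda>i. if i < n then v i else 0)"

definition right_part :: "nat \<Rightarrow> (nat \<Rightarrow> 'a::zero) \<Rightarrow> nat \<Rightarrow> 'a"
  where "right_part n v = (\<lambda>i. v (n + i))"

definition join_parts :: "nat \<Rightarrow> (nat \<Rightarrow> 'a::zero) \<Rightarrow> (nat \<Rightarrow> 'a) \<Rightarrow> nat \<Rightarrow> 'a"
  where "join_parts n v w = (\<lambda>i. if i < n then v i else w (i - n))"

lemma left_part_add: "left_part n (v + w) = left_part n v + (left_part n w :: nat \<Rightarrow> 'a::monoid_add)"
  by (auto simp: left_part_def fun_eq_iff)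

lemma right_part_add: "right_part n (v + w) = right_part n v + (right_part n w :: nat \<Rightarrow> 'a::monoid_add)"
  by (auto simp: right_part_def fun_eq_iff)

lemma left_part_scale: "left_part n (c *\<^sub>C v) = c *\<^sub>C (left_part n v :: nat \<Rightarrow> 'a::complex_space)"
  by (auto simp: left_part_def fun_eq_iff scaleC_fun_def)

lemma right_part_scale: "right_part n (c *\<^sub>C v) = c *\<^sub>C (right_part n v :: nat \<Rightarrow> 'a::complex_space)"
  by (auto simp: right_part_def fun_eq_iff scaleC_fun_def)

lemma continuous_map_left_part:
  "continuous_map (rspace (pi_delta G (\<delta>1 @ \<delta>2))) (rspace (pi_delta G \<delta>1)) (left_part (length \<delta>1))"
  unfolding pi_delta_def rep.simps
proof (rule continuous_map_direct_sumI)
  fix i assume "i \<in> {..<length \<delta>1}"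
  then show "continuous_map (direct_sum {..<length (\<delta>1 @ \<delta>2)} (\<lambda>i. datum_space G ((\<delta>1 @ \<delta>2) ! i)))
      (datum_space G (\<delta>1 ! i)) (\<lambda>v. left_part (length \<delta>1) v i)"
    using continuous_map_direct_sum_component[of i "{..<length (\<delta>1 @ \<delta>2)}" "\<lambda>i. datum_space G ((\<delta>1 @ \<delta>2) ! i)"]
    by (simp add: left_part_def nth_append)
qed (simp add: left_part_def)

lemma continuous_map_right_part:
  "continuous_map (rspace (pi_delta G (\<delta>1 @ \<delta>2))) (rspace (pi_delta G \<delta>2)) (right_part (length \<delta>1))"
  unfolding pi_delta_def rep.simps
proof (rule continuous_map_direct_sumI)
  fix i assume "i \<in> {..<length \<delta>2}"
  then show "continuous_map (direct_sum {..<length (\<delta>1 @ \<delta>2)} (\<lambda>i. datum_space G ((\<delta>1 @ \<delta>2) ! i)))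
      (datum_space G (\<delta>2 ! i)) (\<lambda>v. right_part (length \<delta>1) v i)"
    using continuous_map_direct_sum_component[of "length \<delta>1 + i" "{..<length (\<delta>1 @ \<delta>2)}" "\<lambda>i. datum_space G ((\<delta>1 @ \<delta>2) ! i)"]
    by (simp add: right_part_def nth_append)
qed (auto simp: right_part_def topspace_direct_sum)

lemma join_parts_pi_delta:
  assumes "v \<in> topspace (rspace (pi_delta G \<delta>1))" "w \<in> topspace (rspace (pi_delta G \<delta>2))"
  shows "join_parts (length \<delta>1) v w \<in> topspace (rspace (pi_delta G (\<delta>1 @ \<delta>2)))"
    and "left_part (length \<delta>1) (join_parts (length \<delta>1) v w) = v"
    and "right_part (length \<delta>1) (join_parts (length \<delta>1) v w) = w"
proof -
  have "left_part (length \<delta>1) (join_parts (length \<delta>1) v w) i = v i" for i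
    using assms(1) by (auto simp: left_part_def join_parts_def pi_delta_def topspace_direct_sum)
  then show "left_part (length \<delta>1) (join_parts (length \<delta>1) v w) = v" by (rule ext)
  have "right_part (length \<delta>1) (join_parts (length \<delta>1) v w) i = w i" for i
    by (auto simp: right_part_def join_parts_def)
  then show "right_part (length \<delta>1) (join_parts (length \<delta>1) v w) = w" by (rule ext)
  show "join_parts (length \<delta>1) v w \<in> topspace (rspace (pi_delta G (\<delta>1 @ \<delta>2)))"
    using assms by (auto simp: join_parts_def pi_delta_def topspace_direct_sum nth_append)
qed

lemma act_parts:
  shows "left_part (length \<delta>1) (ract (pi_delta G (\<delta>1 @ \<delta>2)) x v) =
      ract (pi_delta G \<delta>1) x (left_part (length \<delta>1) v)"
    and "right_part (length \<delta>1) (ract (pi_delta G (\<delta>1 @ \<delta>2)) x v) =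
      ract (pi_delta G \<delta>2) x (right_part (length \<delta>1) v)"
  by (auto simp: left_part_def right_part_def pi_delta_def fun_eq_iff nth_append)

lemma phi_parts:
  shows "left_part (length \<delta>1) (phi_delta G \<phi> (\<delta>1 @ \<delta>2) v) =
      phi_delta G \<phi> \<delta>1 (left_part (length \<delta>1) v)"
    and "right_part (length \<delta>1) (phi_delta G \<phi> (\<delta>1 @ \<delta>2) v) =
      phi_delta G \<phi> \<delta>2 (right_part (length \<delta>1) v)"
  by (auto simp: left_part_def right_part_def phi_delta_def fun_eq_iff nth_append)

lemma pi_delta_append_topspaceI:
  assumes "left_part (length \<delta>1) u \<in> topspace (rspace (pi_delta G \<delta>1))"
    and "right_part (length \<delta>1) u \<in> topspace (rspace (pi_delta G \<delta>2))"
  shows "u \<in> topspace (rspace (pi_delta G (\<delta>1 @ \<delta>2)))"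
proof -
  have "join_parts (length \<delta>1) (left_part (length \<delta>1) u) (right_part (length \<delta>1) u) = u"
    by (auto simp: join_parts_def left_part_def right_part_def fun_eq_iff)
  then show ?thesis using join_parts_pi_delta(1)[OF assms] by simp
qed

definition intertwiner_graph ::
    "('g, 'e::euclidean_space) reductive_data \<Rightarrow> ('g, 'e, 'v::complex_space) datum list \<Rightarrow> _ set \<Rightarrow>
     ('g, 'e, 'v) datum list \<Rightarrow> _ set \<Rightarrow> (_ set \<Rightarrow> _ set) \<Rightarrow> (nat \<Rightarrow> bool list \<Rightarrow> 'g \<Rightarrow> 'v) set"
  where "intertwiner_graph G \<delta>1 U1 \<delta>2 U2 T = {v \<in> topspace (rspace (pi_delta G (\<delta>1 @ \<delta>2))).
    T (coset U1 (left_part (length \<delta>1) v)) = coset U2 (right_part (length \<delta>1) v)}"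

lemma intertwiner_graph_closed_invariant:
  fixes G :: "('g, 'e::euclidean_space) reductive_data"
    and \<delta>1 \<delta>2 :: "('g, 'e, 'v::complex_space) datum list"
  assumes V1: "tvs (rspace (pi_delta G \<delta>1))" and V2: "tvs (rspace (pi_delta G \<delta>2))"
    and V: "tvs (rspace (pi_delta G (\<delta>1 @ \<delta>2)))"
    and U1: "closed_invariant (carrier G) (pi_delta G \<delta>1) U1"
    and U2: "closed_invariant (carrier G) (pi_delta G \<delta>2) U2"
    and T: "intertwining_operator (carrier G) (pi_delta G \<delta>1) U1 (pi_delta G \<delta>2) U2 T"
  shows "closed_invariant (carrier G) (pi_delta G (\<delta>1 @ \<delta>2)) (intertwiner_graph G \<delta>1 U1 \<delta>2 U2 T)"
proof -
  let ?X1 = "rspace (pi_delta G \<delta>1)" and ?X2 = "rspace (pi_delta G \<delta>2)" and ?X = "rspace (pi_delta G (\<delta>1 @ \<delta>2))"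
  let ?l = "left_part (length \<delta>1)" and ?r = "right_part (length \<delta>1)"
  let ?\<Gamma> = "intertwiner_graph G \<delta>1 U1 \<delta>2 U2 T"
  have sub2: "cvec.subspace U2" "closedin ?X2 U2" using U2 by (auto simp: closed_invariant_def)
  note T' = T[unfolded intertwining_operator_def]
  have contT: "continuous_map (quotient_top ?X1 U1) (quotient_top ?X2 U2) T"
    by (rule conjunct1[OF T'])
  have lin: "\<forall>c. \<forall>v\<in>topspace ?X1. \<forall>v'\<in>topspace ?X1. \<forall>w\<in>topspace ?X2. \<forall>w'\<in>topspace ?X2.
       T (coset U1 v) = coset U2 w \<and> T (coset U1 v') = coset U2 w' \<longrightarrow>
       T (coset U1 (v + v')) = coset U2 (w + w') \<and> T (coset U1 (c *\<^sub>C v)) = coset U2 (c *\<^sub>C w)"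
    by (rule conjunct1[OF conjunct2[OF T']])
  have inter: "\<forall>x\<in>carrier G. intertwines_quotients T (topspace ?X1) U1 (topspace ?X2) U2
       (ract (pi_delta G \<delta>1) x) (ract (pi_delta G \<delta>2) x)"
    by (rule conjunct2[OF conjunct2[OF T']])
  have l: "?l v \<in> topspace ?X1" and r: "?r v \<in> topspace ?X2" if "v \<in> topspace ?X" for v
    using that continuous_map_left_part[of G \<delta>1 \<delta>2] continuous_map_right_part[of G \<delta>1 \<delta>2]
    by (auto simp: continuous_map_def)
  note sub = tvs_subspace[OF V] and sub1 = tvs_subspace[OF V1]
  have "cvec.subspace ?\<Gamma>"
    unfolding cvec.subspace_def
  proof (intro conjI ballI allI)
    \<comment> \<open>Linearity of \<open>T\<close> is stated on representatives, so
      \<open>T\<close> of the zero coset is first written as some \<open>coset U2 w\<close> and then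
      scaled by 0.\<close>
    have "coset U1 0 \<in> topspace (quotient_top ?X1 U1)"
      using cvec.subspace_0[OF sub1] by (simp add: topspace_quotient_top)
    then have "T (coset U1 0) \<in> topspace (quotient_top ?X2 U2)"
      using contT by (auto simp: continuous_map_def)
    then obtain w where w: "w \<in> topspace ?X2" "T (coset U1 0) = coset U2 w"
      by (auto simp: topspace_quotient_top)
    have "T (coset U1 (0 *\<^sub>C 0)) = coset U2 (0 *\<^sub>C w)"
      using lin cvec.subspace_0[OF sub1] w by blast
    moreover have "?l 0 = (0::nat \<Rightarrow> bool list \<Rightarrow> 'g \<Rightarrow> 'v)" "?r 0 = (0::nat \<Rightarrow> bool list \<Rightarrow> 'g \<Rightarrow> 'v)"
      by (auto simp: left_part_def right_part_def fun_eq_iff)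
    ultimately show "0 \<in> ?\<Gamma>"
      unfolding intertwiner_graph_def using cvec.subspace_0[OF sub] by (simp only: mem_Collect_eq scaleC_zero_left)
  next
    fix v w assume "v \<in> ?\<Gamma>" "w \<in> ?\<Gamma>"
    then have vw: "v \<in> topspace ?X" "w \<in> topspace ?X"
        "T (coset U1 (?l v)) = coset U2 (?r v)" "T (coset U1 (?l w)) = coset U2 (?r w)"
      by (auto simp: intertwiner_graph_def)
    have "T (coset U1 (?l v + ?l w)) = coset U2 (?r v + ?r w)"
      using lin[rule_format, OF l[OF vw(1)] l[OF vw(2)] r[OF vw(1)] r[OF vw(2)]] vw(3,4) by blast
    then show "v + w \<in> ?\<Gamma>"
      unfolding intertwiner_graph_def mem_Collect_eq left_part_add right_part_add
      using cvec.subspace_add[OF sub vw(1,2)] by (rule conjI[rotated])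
  next
    fix c v assume "v \<in> ?\<Gamma>"
    then have v: "v \<in> topspace ?X" "T (coset U1 (?l v)) = coset U2 (?r v)"
      by (auto simp: intertwiner_graph_def)
    have "T (coset U1 (c *\<^sub>C ?l v)) = coset U2 (c *\<^sub>C ?r v)"
      using lin[rule_format, OF l[OF v(1)] l[OF v(1)] r[OF v(1)] r[OF v(1)]] v(2) by blast
    then show "c *\<^sub>C v \<in> ?\<Gamma>"
      unfolding intertwiner_graph_def mem_Collect_eq left_part_scale right_part_scale
      using cvec.subspace_scale[OF sub v(1)] by (rule conjI[rotated])
  qed
  moreover have "closedin ?X ?\<Gamma>"
    unfolding intertwiner_graph_def
  proof (rule closedin_continuous_maps_eq[OF Hausdorff_quotient_top[OF V2 sub2]])
    show "continuous_map ?X (quotient_top ?X2 U2) (\<lambda>v. T (coset U1 (?l v)))"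
      using continuous_map_compose[OF continuous_map_compose[OF continuous_map_left_part continuous_map_coset] contT]
      by (simp add: o_def)
    show "continuous_map ?X (quotient_top ?X2 U2) (\<lambda>v. coset U2 (?r v))"
      using continuous_map_compose[OF continuous_map_right_part continuous_map_coset] by (simp add: o_def)
  qed
  moreover have "ract (pi_delta G (\<delta>1 @ \<delta>2)) x v \<in> ?\<Gamma>" if x: "x \<in> carrier G" and v: "v \<in> ?\<Gamma>" for x v
  proof -
    let ?a = "ract (pi_delta G (\<delta>1 @ \<delta>2)) x v"
    have v': "v \<in> topspace ?X" "T (coset U1 (?l v)) = coset U2 (?r v)"
      using v by (auto simp: intertwiner_graph_def)
    obtain F1 F2 where F: "induces (topspace ?X1) U1 (ract (pi_delta G \<delta>1) x) F1"
        "induces (topspace ?X2) U2 (ract (pi_delta G \<delta>2) x) F2"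
        "\<forall>c\<in>coset U1 ` topspace ?X1. T (F1 c) = F2 (T c)"
      using bspec[OF inter x] unfolding intertwines_quotients_def by (elim exE conjE)
    \<comment> \<open>\<open>induces\<close> provides not only the formula on cosets but also that
      the action keeps the representative in the space.\<close>
    have 1: "ract (pi_delta G \<delta>1) x (?l v) \<in> topspace ?X1"
        "F1 (coset U1 (?l v)) = coset U1 (ract (pi_delta G \<delta>1) x (?l v))"
      using F(1) l[OF v'(1)] unfolding induces_def by auto
    have 2: "ract (pi_delta G \<delta>2) x (?r v) \<in> topspace ?X2"
        "F2 (coset U2 (?r v)) = coset U2 (ract (pi_delta G \<delta>2) x (?r v))"
      using F(2) r[OF v'(1)] unfolding induces_def by auto
    have "T (F1 (coset U1 (?l v))) = F2 (T (coset U1 (?l v)))" using F(3) l[OF v'(1)] by blast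
    then have "T (coset U1 (?l ?a)) = coset U2 (?r ?a)"
      unfolding act_parts using 1(2) 2(2) v'(2) by simp
    moreover have "?a \<in> topspace ?X"
      by (rule pi_delta_append_topspaceI; unfold act_parts; rule 1 2)
    ultimately show ?thesis unfolding intertwiner_graph_def by blast
  qed
  ultimately show ?thesis unfolding closed_invariant_def by blast
qed


subsection \<open>Delorme's intertwining conditions\<close>

theorem lemma4p2:
  fixes G :: "('g, 'e::euclidean_space) reductive_data"
    and \<Xi> :: "'g set \<Rightarrow> 'g unitary \<Rightarrow> ('g, 'v::complex_space) rep"
    and \<phi> :: "'g set \<Rightarrow> ('g, 'v) rep \<Rightarrow> ('e \<Rightarrow> complex) \<Rightarrow> ('g \<Rightarrow> 'v) \<Rightarrow> 'g \<Rightarrow> 'v"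
  assumes "real_reductive G"
    and "globalization_choice G \<Xi>"
    and "\<phi> \<in> F_space G \<Xi>"
  shows "delorme_conditions G \<Xi> \<phi> \<longleftrightarrow> preserves_invariant_subspaces G \<Xi> \<phi>"
proof
  assume "delorme_conditions G \<Xi> \<phi>"
  then show "preserves_invariant_subspaces G \<Xi> \<phi>" by (simp add: delorme_conditions_def)
next
  assume pres: "preserves_invariant_subspaces G \<Xi> \<phi>"
  note props = delta_properties[OF assms]
  have stable: "phi_delta G \<phi> \<delta> ` U \<subseteq> U"
    if "\<delta> \<noteq> []" "set \<delta> \<subseteq> D_data G \<Xi>" "closed_invariant (carrier G) (pi_delta G \<delta>) U" for \<delta> U
  proof -
    have "1 \<le> length \<delta>" using that(1) by (simp add: Suc_le_eq)
    then show ?thesis using pres that(2,3) unfolding preserves_invariant_subspaces_def by blast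
  qed
  have induced: "\<exists>F. induces (topspace (rspace (pi_delta G \<delta>))) U (phi_delta G \<phi> \<delta>) F"
    if \<delta>: "\<delta> \<noteq> []" "set \<delta> \<subseteq> D_data G \<Xi>" and U: "closed_invariant (carrier G) (pi_delta G \<delta>) U" for \<delta> U
  proof (rule induces_exists)
    show "cvec.subspace U" "U \<subseteq> topspace (rspace (pi_delta G \<delta>))"
      using U closedin_subset by (auto simp: closed_invariant_def)
  qed (use props[OF \<delta>(2)] stable[OF \<delta> U] in blast)+
  have "intertwines_quotients T (topspace (rspace (pi_delta G \<delta>1))) U1 (topspace (rspace (pi_delta G \<delta>2))) U2
      (phi_delta G \<phi> \<delta>1) (phi_delta G \<phi> \<delta>2)"
    if \<delta>1: "\<delta>1 \<noteq> []" "set \<delta>1 \<subseteq> D_data G \<Xi>" and \<delta>2: "\<delta>2 \<noteq> []" "set \<delta>2 \<subseteq> D_data G \<Xi>"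
      and U1: "closed_invariant (carrier G) (pi_delta G \<delta>1) U1"
      and U2: "closed_invariant (carrier G) (pi_delta G \<delta>2) U2"
      and T: "intertwining_operator (carrier G) (pi_delta G \<delta>1) U1 (pi_delta G \<delta>2) U2 T"
    for \<delta>1 \<delta>2 U1 U2 T
  proof -
    let ?X1 = "rspace (pi_delta G \<delta>1)" and ?X2 = "rspace (pi_delta G \<delta>2)"
    let ?\<Gamma> = "intertwiner_graph G \<delta>1 U1 \<delta>2 U2 T"
    have \<delta>: "\<delta>1 @ \<delta>2 \<noteq> []" "set (\<delta>1 @ \<delta>2) \<subseteq> D_data G \<Xi>" using \<delta>1 \<delta>2 by auto
    have \<Gamma>: "phi_delta G \<phi> (\<delta>1 @ \<delta>2) ` ?\<Gamma> \<subseteq> ?\<Gamma>"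
      by (intro stable[OF \<delta>] intertwiner_graph_closed_invariant props(1) \<delta>1(2) \<delta>2(2) \<delta>(2) U1 U2 T)
    obtain F1 where F1: "induces (topspace ?X1) U1 (phi_delta G \<phi> \<delta>1) F1"
      using induced[OF \<delta>1 U1] by (elim exE)
    obtain F2 where F2: "induces (topspace ?X2) U2 (phi_delta G \<phi> \<delta>2) F2"
      using induced[OF \<delta>2 U2] by (elim exE)
    \<comment> \<open>Representatives of \<open>c\<close> and of \<open>T c\<close> form a point of
      the graph. Its image under \<open>phi_delta\<close> is again in the graph and, as
      \<open>phi_delta\<close> acts coordinatewise, the equation of the graph at that image is the
      claimed commutation.\<close>
    have "T (F1 c) = F2 (T c)" if c: "c \<in> coset U1 ` topspace ?X1" for c
    proof -
      obtain v where v: "v \<in> topspace ?X1" "c = coset U1 v" using c by blast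
      have "continuous_map (quotient_top ?X1 U1) (quotient_top ?X2 U2) T"
        using T unfolding intertwining_operator_def by (elim conjE)
      then have "T c \<in> coset U2 ` topspace ?X2"
        using c by (auto simp: continuous_map_def topspace_quotient_top)
      then obtain w where w: "w \<in> topspace ?X2" "T c = coset U2 w" by blast
      note join = join_parts_pi_delta[OF v(1) w(1)]
      have "join_parts (length \<delta>1) v w \<in> ?\<Gamma>"
        unfolding intertwiner_graph_def mem_Collect_eq join(2,3) using join(1) w(2) v(2) by simp
      then have "phi_delta G \<phi> (\<delta>1 @ \<delta>2) (join_parts (length \<delta>1) v w) \<in> ?\<Gamma>" using \<Gamma> by blast
      then have "T (coset U1 (phi_delta G \<phi> \<delta>1 v)) = coset U2 (phi_delta G \<phi> \<delta>2 w)"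
        unfolding intertwiner_graph_def mem_Collect_eq phi_parts join(2,3) by (rule conjunct2)
      moreover have "F1 c = coset U1 (phi_delta G \<phi> \<delta>1 v)" using F1 v unfolding induces_def by blast
      moreover have "F2 (T c) = coset U2 (phi_delta G \<phi> \<delta>2 w)"
        unfolding w(2) using F2 w(1) unfolding induces_def by blast
      ultimately show ?thesis by simp
    qed
    then show ?thesis unfolding intertwines_quotients_def using F1 F2 by blast
  qed
  then have "commutes_with_intertwiners G \<Xi> \<phi>"
    unfolding commutes_with_intertwiners_def by (metis list.size(3) not_one_le_zero)
  with pres show "delorme_conditions G \<Xi> \<phi>" unfolding delorme_conditions_def by (rule conjI)
qed

end
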